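(* Let $\mathsf{DS}=(\mathsf{Gen},\mathsf{Sign},\mathsf{Puncture},\mathsf{Verify},\mathsf{Sign}^* )$ be a puncturable digital signature scheme with message length $n(\lambda)$ and signature length $s(\lambda)$. Suppose $(\mathsf{Obf},\mathsf{Eval})$ is an unclonable puncturable obfuscation scheme with UPO security for $\mathcal{F}=\{\mathcal{F}_\lambda\}_\lambda$, $\mathcal{F}_\lambda=\{\mathsf{Sign}(k,\cdot)\}_{k\in\mathrm{Support}(\mathsf{Gen}(1^\lambda))}$, equipped with $\mathsf{Puncture}$ as puncturing algorithm, with respect to the product of uniform distributions $\mathcal{D}_{\mathcal X}=\mathcal{U}\times\mathcal{U}$. Then there exists a copy-protection scheme for signatures $\mathsf{CP\text{-}DS}=(\mathsf{Gen},\mathsf{QKeyGen},\mathsf{Sign},\mathsf{Verify})$ (satisfying correctness and anti-piracy), where $\mathsf{CP\text{-}DS.Gen}$ and $\mathsf{CP\text{-}DS.Verify}$ are those of $\mathsf{DS}$, $\mathsf{CP\text{-}DS.QKeyGen}(sk)=\mathsf{Obf}(\mathsf{DS.Sign}(sk,\cdot))$, and $\mathsf{CP\text{-}DS.Sign}$ is the algorithm $\mathsf{Eval}$ of the UPO scheme.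
   Context: QPT means quantum polynomial time. **Puncturable digital signature.** A digital signature scheme $(\mathsf{Gen},\mathsf{Sign},\mathsf{Verify})$ with efficient algorithms $\mathsf{Puncture}$, taking a signing key and a message (or polynomially many messages) and outputting a punctured key, and $\mathsf{Sign}^*$, such that $\mathsf{Sign}^*(sk_{m_1,m_2},\cdot)$ agrees with $\mathsf{Sign}(sk,\cdot)$ on all messages not in $\{m_1,m_2\}$ and outputs $\bot$ on $m_1,m_2$. Puncturable security: for every QPT $\mathcal{D}$, sampling $(sk,vk)\leftarrow\mathsf{Gen}(1^\lambda)$, $m_1,m_2$ uniform in $\{0,1\}^n$, $sk_{m_1,m_2}\leftarrow\mathsf{Puncture}(sk,\{m_1,m_2\})$, $\sigma\leftarrow\mathcal{D}(m_1,vk,sk_{m_1,m_2})$, the probability that $\mathsf{Verify}(vk,m_1,\sigma)=1$ is negligible. The keyed class $\{\mathsf{Sign}(sk,\cdot)\}$ is punctured by replacing $\mathsf{Sign}(sk,\cdot)$ with $\mathsf{Sign}^*(sk_{m_1,m_2},\cdot)$. **UPO scheme** for a keyed circuit class $\{C_k\}$ (same-size poly-size circuits on $n$-bit inputs) with $\mathsf{Puncture}$. QPT algorithms $\mathsf{Obf}(1^\lambda,C)\to\rho_C$ and $\mathsf{Eval}(\rho_C,x)\to(\rho_C',y)$, with $y=C(x)$ with probability negligibly close to 1 for every $C$ in the class and $x$. UPO security with respect to $\mathcal{D}_{\mathcal X}$: for every QPT $(\mathcal{A},\mathcal{B},\mathcal{C})$, the following experiment with uniform $b\in\{0,1\}$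 outputs 1 with probability at most $\frac12+\mathsf{negl}(\lambda)$: $\mathcal{A}$ sends a key $k$; the challenger samples $(x^{\mathcal B},x^{\mathcal C})\leftarrow\mathcal{D}_{\mathcal X}$, computes the circuit $G$ obtained by puncturing $C_k$ at $x^{\mathcal B},x^{\mathcal C}$, and sends $\mathcal{A}$ the state $\mathsf{Obf}(1^\lambda,C_k)$ if $b=0$, $\mathsf{Obf}(1^\lambda,G)$ if $b=1$; $\mathcal{A}$ outputs a bipartite state $\sigma$; $(\mathcal{B}(x^{\mathcal B},\cdot)\otimes\mathcal{C}(x^{\mathcal C},\cdot))(\sigma)$ gives $(b_{\mathcal B},b_{\mathcal C})$; output 1 iff $b_{\mathcal B}=b_{\mathcal C}=b$. **Copy-protection for signatures.** $\mathsf{Gen}(1^\lambda)\to(sk,vk)$ classical; $\mathsf{QKeyGen}(sk)\to\rho_{sk}$ quantum signing key; $\mathsf{Sign}(\rho_{sk},m)\to$ classical signature; $\mathsf{Verify}(vk,m,\mathsf{sig})\to$ bit. Correctness: for every $m$, honestly generated signatures verify with probability at least $1-\mathsf{negl}(\lambda)$. Anti-piracy (uniform independent challenges): for every QPT $(\mathcal{A},\mathcal{B},\mathcal{C})$ the following outputs 1 with negligible probability: $(sk,vk)\leftarrow\mathsf{Gen}(1^\lambda)$, $\mathcal{A}$ gets $(\mathsf{QKeyGen}(sk),vk)$ and outputs a bipartite state $\sigma$; $m^{\mathcal B},m^{\mathcal C}$ are independent uniform in $\{0,1\}^n$; $(\mathcal{B}(m^{\mathcal B},\cdot)\otimes\mathcal{C}(m^{\mathcal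 C},\cdot))(\sigma)$ gives $(\mathsf{sig}^{\mathcal B},\mathsf{sig}^{\mathcal C})$; output 1 iff $\mathsf{Verify}(vk,m^{\mathcal B},\mathsf{sig}^{\mathcal B})=\mathsf{Verify}(vk,m^{\mathcal C},\mathsf{sig}^{\mathcal C})=1$. *)

theory Defs
  imports "HOL-Probability.Probability" "HOL-Library.List_Lexorder"
begin

section \<open>Polynomial time\<close>

text \<open>
  Uniformity is expressed with structured programs over finitely many stacks of bits. One
  command manipulates one top bit in one time unit, so such programs simulate multi-tape
  Turing machines, and are simulated by them, with polynomial overhead.
  \<open>IfTop\<close> branches on whether the stack is nonempty with top bit 1; \<open>While\<close> iterates as long as
  the stack is nonempty.
\<close>

type_synonym bits = "bool list"

datatype com =
    Skip
  | Push nat bool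
  | Pop nat
  | Seq com com
  | IfTop nat com com
  | While nat com

inductive exec :: "com \<Rightarrow> (nat \<Rightarrow> bits) \<Rightarrow> nat \<Rightarrow> (nat \<Rightarrow> bits) \<Rightarrow> bool" where
  exec_Skip: "exec Skip S 1 S"
| exec_Push: "exec (Push x b) S 1 (S(x := b # S x))"
| exec_Pop: "exec (Pop x) S 1 (S(x := tl (S x)))"
| exec_Seq: "exec c S t S' \<Longrightarrow> exec d S' t' S'' \<Longrightarrow> exec (Seq c d) S (t + t') S''"
| exec_IfTrue: "S x \<noteq> [] \<and> hd (S x) \<Longrightarrow> exec c S t S' \<Longrightarrow> exec (IfTop x c d) S (Suc t) S'"
| exec_IfFalse: "\<not> (S x \<noteq> [] \<and> hd (S x)) \<Longrightarrow> exec d S t S' \<Longrightarrow> exec (IfTop x c d) S (Suc t) S'"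
| exec_WhileEnd: "S x = [] \<Longrightarrow> exec (While x c) S 1 S"
| exec_WhileStep: "S x \<noteq> [] \<Longrightarrow> exec c S t S' \<Longrightarrow> exec (While x c) S' t' S'' \<Longrightarrow>
    exec (While x c) S (Suc (t + t')) S''"

abbreviation unary :: "nat \<Rightarrow> bits" where
  "unary n \<equiv> replicate n True"

text \<open>
  \<open>f a b\<close> is computable in time polynomial in \<open>a + b\<close>; the two arguments are given in unary in
  stacks 0 and 1, and the result is left in stack 0. Every polynomial in \<open>a + b\<close> is bounded by
  some \<open>(a + b + 2) ^ d\<close>.
\<close>

definition polytime :: "(nat \<Rightarrow> nat \<Rightarrow> bits) \<Rightarrow> bool" where
  "polytime f \<longleftrightarrow> (\<exists>c d. \<forall>a b. \<exists>t S.
     exec c ((\<lambda>_. [])(0 := unary a, 1 := unary b)) t S \<and> S 0 = f a b \<and> t \<le> (a + b + 2) ^ d)"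

definition poly_length :: "(nat \<Rightarrow> nat) \<Rightarrow> bool" where
  "poly_length f \<longleftrightarrow> polytime (\<lambda>l _. unary (f l))"

definition negligible :: "(nat \<Rightarrow> real) \<Rightarrow> bool" where
  "negligible f \<longleftrightarrow> (\<forall>c. \<exists>N. \<forall>l\<ge>N. \<bar>f l\<bar> < 1 / real l ^ c)"

definition words :: "nat \<Rightarrow> bits set" where
  "words n = {w. length w = n}"

definition uniform :: "nat \<Rightarrow> bits pmf" where
  "uniform n = pmf_of_set (words n)"


section \<open>Boolean circuits and classical algorithms\<close>

text \<open>
  A circuit is a straight-line program. Wires \<open>0, \<dots>, i - 1\<close> carry the \<open>i\<close> input bits, each gate
  appends one wire, and an \<open>out\<close>-bit output is read from the last \<open>out\<close> wires.
\<close>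

datatype bgate = Const bool | Nand nat nat

type_synonym bcirc = "bgate list"

fun gate_value :: "bits \<Rightarrow> bgate \<Rightarrow> bool" where
  "gate_value w (Const b) = b"
| "gate_value w (Nand i j) = (\<not> (w ! i \<and> w ! j))"

definition wires :: "bcirc \<Rightarrow> bits \<Rightarrow> bits" where
  "wires C x = foldl (\<lambda>w g. w @ [gate_value w g]) x C"

definition beval :: "nat \<Rightarrow> bcirc \<Rightarrow> bits \<Rightarrow> bits" where
  "beval out C x = drop (length (wires C x) - out) (wires C x)"

fun gate_wf :: "nat \<Rightarrow> bgate \<Rightarrow> bool" where
  "gate_wf k (Const b) \<longleftrightarrow> True"
| "gate_wf k (Nand i j) \<longleftrightarrow> i < k \<and> j < k"

definition bcirc_wf :: "nat \<Rightarrow> nat \<Rightarrow> bcirc \<Rightarrow> bool" where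
  "bcirc_wf inp out C \<longleftrightarrow> (\<forall>j < length C. gate_wf (inp + j) (C ! j)) \<and> out \<le> inp + length C"

text \<open>
  Hard-wiring a key whose wires directly follow the remaining inputs: the key bits become constant
  gates, and no wire is renumbered.
\<close>

definition hardwire :: "bits \<Rightarrow> bcirc \<Rightarrow> bcirc" where
  "hardwire k C = map Const k @ C"

lemma wires_map_Const: "wires (map Const k) x = x @ k"
  unfolding wires_def by (induction k arbitrary: x) auto

lemma beval_hardwire: "beval out (hardwire k C) x = beval out C (x @ k)"
proof -
  have "wires (hardwire k C) x = wires C (wires (map Const k) x)"
    by (simp add: wires_def hardwire_def)
  then show ?thesis
    by (simp add: beval_def wires_map_Const)
qed

text \<open>Prefix-free binary encodings of gates; wire numbers are written in unary.\<close>

fun enc_nat :: "nat \<Rightarrow> bits" where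
  "enc_nat n = unary n @ [False]"

fun enc_bgate :: "bgate \<Rightarrow> bits" where
  "enc_bgate (Const b) = [False, b]"
| "enc_bgate (Nand i j) = True # enc_nat i @ enc_nat j"

definition enc_bcirc :: "bcirc \<Rightarrow> bits" where
  "enc_bcirc C = concat (map enc_bgate C)"

text \<open>
  Deterministic polynomial-time algorithms are P-uniform circuit families; probabilistic ones
  receive in addition, after the input, a uniform string of coins.
\<close>

definition det_poly :: "(nat \<Rightarrow> nat) \<Rightarrow> (nat \<Rightarrow> nat) \<Rightarrow> (nat \<Rightarrow> bcirc) \<Rightarrow> bool" where
  "det_poly inp out F \<longleftrightarrow>
     polytime (\<lambda>l _. enc_bcirc (F l)) \<and> (\<forall>l. bcirc_wf (inp l) (out l) (F l))"

record palg =
  coins :: "nat \<Rightarrow> nat"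
  pcirc :: "nat \<Rightarrow> bcirc"

definition prob_poly :: "(nat \<Rightarrow> nat) \<Rightarrow> (nat \<Rightarrow> nat) \<Rightarrow> palg \<Rightarrow> bool" where
  "prob_poly inp out P \<longleftrightarrow>
     poly_length (coins P) \<and> det_poly (\<lambda>l. inp l + coins P l) out (pcirc P)"

definition prun :: "nat \<Rightarrow> palg \<Rightarrow> nat \<Rightarrow> bits \<Rightarrow> bits pmf" where
  "prun out P l x = map_pmf (\<lambda>r. beval out (pcirc P l) (x @ r)) (uniform (coins P l))"


section \<open>Quantum circuits and QPT algorithms\<close>

text \<open>
  Computational basis states of \<open>k\<close> qubits are bit strings of length \<open>k\<close>, so that tensor products
  are concatenations. An operator is given by its matrix entries \<open>\<langle>u|\<rho>|v\<rangle>\<close>.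
\<close>

type_synonym qop = "bits \<Rightarrow> bits \<Rightarrow> complex"

datatype qgate = GH nat | GT nat | GX nat | GCX nat nat | GCCX nat nat nat

fun apply_gate :: "qgate \<Rightarrow> (bits \<Rightarrow> complex) \<Rightarrow> (bits \<Rightarrow> complex)" where
  "apply_gate (GH i) \<psi> = (\<lambda>w.
     (\<psi> (w[i := False]) + (if w ! i then -1 else 1) * \<psi> (w[i := True])) / complex_of_real (sqrt 2))"
| "apply_gate (GT i) \<psi> = (\<lambda>w. (if w ! i then cis (pi / 4) else 1) * \<psi> w)"
| "apply_gate (GX i) \<psi> = (\<lambda>w. \<psi> (w[i := (\<not> w ! i)]))"
| "apply_gate (GCX a t) \<psi> = (\<lambda>w. \<psi> (w[t := (w ! t \<noteq> w ! a)]))"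
| "apply_gate (GCCX a b t) \<psi> = (\<lambda>w. \<psi> (w[t := (w ! t \<noteq> (w ! a \<and> w ! b))]))"

fun qgate_wires :: "qgate \<Rightarrow> nat list" where
  "qgate_wires (GH i) = [i]"
| "qgate_wires (GT i) = [i]"
| "qgate_wires (GX i) = [i]"
| "qgate_wires (GCX a t) = [a, t]"
| "qgate_wires (GCCX a b t) = [a, b, t]"

text \<open>
  A circuit on \<open>k\<close> input qubits appends \<open>q_anc\<close> ancillas in state 0, applies its gates, outputs the
  first \<open>q_out\<close> qubits and traces out the remaining ones. Measurements are deferred to the end.
\<close>

record qcirc =
  q_anc :: nat
  q_gates :: "qgate list"
  q_out :: nat

definition qcirc_wf :: "nat \<Rightarrow> qcirc \<Rightarrow> bool" where
  "qcirc_wf k Q \<longleftrightarrow> q_out Q \<le> k + q_anc Q \<and>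
     (\<forall>g \<in> set (q_gates Q). distinct (qgate_wires g) \<and> set (qgate_wires g) \<subseteq> {..<k + q_anc Q})"

fun enc_qgate :: "qgate \<Rightarrow> bits" where
  "enc_qgate (GH i) = [False, False, False] @ enc_nat i"
| "enc_qgate (GT i) = [False, False, True] @ enc_nat i"
| "enc_qgate (GX i) = [False, True, False] @ enc_nat i"
| "enc_qgate (GCX a t) = [False, True, True] @ enc_nat a @ enc_nat t"
| "enc_qgate (GCCX a b t) = [True, False, False] @ enc_nat a @ enc_nat b @ enc_nat t"

definition enc_qcirc :: "qcirc \<Rightarrow> bits" where
  "enc_qcirc Q = enc_nat (q_anc Q) @ enc_nat (q_out Q) @ concat (map enc_qgate (q_gates Q))"

text \<open>
  A QPT algorithm is a P-uniform family of quantum circuits, indexed by the security parameter and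
  the number of input qubits. Classical inputs are basis states.
\<close>

type_synonym qalg = "nat \<Rightarrow> nat \<Rightarrow> qcirc"

definition qpt :: "qalg \<Rightarrow> bool" where
  "qpt Q \<longleftrightarrow> polytime (\<lambda>l k. enc_qcirc (Q l k)) \<and> (\<forall>l k. qcirc_wf k (Q l k))"

text \<open>Amplitude \<open>\<langle>w|U|x,0\<dots>0\<rangle>\<close> of the circuit unitary \<open>U\<close>.\<close>

definition amp :: "qcirc \<Rightarrow> bits \<Rightarrow> bits \<Rightarrow> complex" where
  "amp Q x = fold apply_gate (q_gates Q)
     (\<lambda>w. if w = x @ replicate (q_anc Q) False then 1 else 0)"

text \<open>
  A superoperator \<open>\<Phi>\<close> is given by \<open>\<Phi> x y u v = \<langle>u|\<Phi>(|x\<rangle>\<langle>y|)|v\<rangle>\<close>. For a circuit, \<open>g\<close> ranges over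
  the basis states of the qubits that are traced out.
\<close>

type_synonym sop = "bits \<Rightarrow> bits \<Rightarrow> bits \<Rightarrow> bits \<Rightarrow> complex"

definition sop_of :: "qcirc \<Rightarrow> sop" where
  "sop_of Q x y u v =
     (\<Sum>g \<in> words (length x + q_anc Q - q_out Q). amp Q x (u @ g) * cnj (amp Q y (v @ g)))"

text \<open>Application to an operator on \<open>k\<close> qubits.\<close>

definition sop_apply :: "nat \<Rightarrow> sop \<Rightarrow> qop \<Rightarrow> qop" where
  "sop_apply k \<Phi> \<rho> u v = (\<Sum>x \<in> words k. \<Sum>y \<in> words k. \<Phi> x y u v * \<rho> x y)"

text \<open>\<open>\<rho> \<mapsto> \<Phi>(|z\<rangle>\<langle>z| \<otimes> \<rho>)\<close>\<close>

definition sop_fix :: "bits \<Rightarrow> sop \<Rightarrow> sop" where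
  "sop_fix z \<Phi> x y = \<Phi> (z @ x) (z @ y)"

text \<open>\<open>\<Phi> \<otimes> \<Psi>\<close>, where \<open>\<Phi>\<close> maps \<open>a\<close> qubits to \<open>p\<close> qubits\<close>

definition sop_tensor :: "nat \<Rightarrow> nat \<Rightarrow> sop \<Rightarrow> sop \<Rightarrow> sop" where
  "sop_tensor a p \<Phi> \<Psi> x y u v =
     \<Phi> (take a x) (take a y) (take p u) (take p v) * \<Psi> (drop a x) (drop a y) (drop p u) (drop p v)"

definition basis_state :: "bits \<Rightarrow> qop" where
  "basis_state z x y = (if x = z \<and> y = z then 1 else 0)"

text \<open>\<open>\<rho> \<otimes> \<tau>\<close>, where \<open>\<rho>\<close> is an operator on \<open>a\<close> qubits\<close>

definition qop_tensor :: "nat \<Rightarrow> qop \<Rightarrow> qop \<Rightarrow> qop" where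
  "qop_tensor a \<rho> \<tau> x y = \<rho> (take a x) (take a y) * \<tau> (drop a x) (drop a y)"

definition qrun :: "qalg \<Rightarrow> nat \<Rightarrow> nat \<Rightarrow> qop \<Rightarrow> qop" where
  "qrun Q l k \<rho> = sop_apply k (sop_of (Q l k)) \<rho>"

text \<open>
  Born rule in the computational basis: \<open>meas\<close> measures all qubits, \<open>meas_first\<close> the first \<open>p\<close> of
  \<open>q\<close> qubits, and \<open>post\<close> is the unnormalised state of the remaining qubits after outcome \<open>z\<close>, whose
  trace is the probability of that outcome.
\<close>

definition meas :: "qop \<Rightarrow> bits \<Rightarrow> real" where
  "meas \<rho> z = Re (\<rho> z z)"

definition meas_first :: "nat \<Rightarrow> nat \<Rightarrow> qop \<Rightarrow> bits \<Rightarrow> real" where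
  "meas_first q p \<rho> z = (\<Sum>w \<in> words (q - p). meas \<rho> (z @ w))"

definition post :: "bits \<Rightarrow> qop \<Rightarrow> qop" where
  "post z \<rho> x y = \<rho> (z @ x) (z @ y)"

text \<open>
  A QPT algorithm with bipartite output: its first \<open>split l k\<close> output qubits form the first register,
  the other ones the second register.
\<close>

definition qpt_bipartite :: "qalg \<Rightarrow> (nat \<Rightarrow> nat \<Rightarrow> nat) \<Rightarrow> bool" where
  "qpt_bipartite Q split \<longleftrightarrow>
     qpt Q \<and> polytime (\<lambda>l k. unary (split l k)) \<and> (\<forall>l k. split l k \<le> q_out (Q l k))"

text \<open>
  Probability that measuring \<open>(B(x,\<cdot>) \<otimes> C(y,\<cdot>))(\<sigma>)\<close> gives \<open>(u, v)\<close>, for \<open>\<sigma>\<close> on \<open>a + b\<close> qubits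
\<close>

definition split_prob ::
    "qalg \<Rightarrow> qalg \<Rightarrow> nat \<Rightarrow> nat \<Rightarrow> nat \<Rightarrow> bits \<Rightarrow> bits \<Rightarrow> qop \<Rightarrow> bits \<Rightarrow> bits \<Rightarrow> real" where
  "split_prob B C l a b x y \<sigma> u v =
     (let QB = B l (length x + a); QC = C l (length y + b) in
      meas (sop_apply (a + b)
              (sop_tensor a (q_out QB) (sop_fix x (sop_of QB)) (sop_fix y (sop_of QC))) \<sigma>)
           (u @ v))"


section \<open>Puncturable digital signatures\<close>

text \<open>
  All lengths are functions of the security parameter. Signatures are strings of length \<open>ds_siglen\<close>;
  the all-zero string is reserved for the symbol bottom. The input orders are: key generation: none;
  Sign: message, signing key; Verify: verification key, message, signature; Puncture: signing key,
  pair of messages; punctured signing: message, punctured key.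
\<close>

record pds =
  ds_msglen :: "nat \<Rightarrow> nat"
  ds_siglen :: "nat \<Rightarrow> nat"
  ds_sklen :: "nat \<Rightarrow> nat"
  ds_vklen :: "nat \<Rightarrow> nat"
  ds_pklen :: "nat \<Rightarrow> nat"
  ds_gen :: palg
  ds_sign :: "nat \<Rightarrow> bcirc"
  ds_puncture :: palg
  ds_verify :: "nat \<Rightarrow> bcirc"
  ds_sign_star :: "nat \<Rightarrow> bcirc"

definition bottom :: "nat \<Rightarrow> bits" where
  "bottom s = replicate s False"

text \<open>Key pairs and verification, shared by all signature schemes below\<close>

definition gen_keys :: "palg \<Rightarrow> (nat \<Rightarrow> nat) \<Rightarrow> (nat \<Rightarrow> nat) \<Rightarrow> nat \<Rightarrow> (bits \<times> bits) pmf" where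
  "gen_keys G sklen vklen l =
     map_pmf (\<lambda>w. (take (sklen l) w, drop (sklen l) w)) (prun (sklen l + vklen l) G l [])"

definition accepts :: "(nat \<Rightarrow> bcirc) \<Rightarrow> nat \<Rightarrow> bits \<Rightarrow> bits \<Rightarrow> bits \<Rightarrow> bool" where
  "accepts V l vk m \<sigma> \<longleftrightarrow> beval 1 (V l) (vk @ m @ \<sigma>) = [True]"

abbreviation ds_keys :: "pds \<Rightarrow> nat \<Rightarrow> (bits \<times> bits) pmf" where
  "ds_keys DS \<equiv> gen_keys (ds_gen DS) (ds_sklen DS) (ds_vklen DS)"

definition ds_support :: "pds \<Rightarrow> nat \<Rightarrow> bits set" where
  "ds_support DS l = fst ` set_pmf (ds_keys DS l)"

text \<open>The circuits \<open>Sign(sk,\<cdot>)\<close> and \<open>Sign\<^sup>*(pk,\<cdot>)\<close>\<close>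

definition sign_circ :: "pds \<Rightarrow> nat \<Rightarrow> bits \<Rightarrow> bcirc" where
  "sign_circ DS l sk = hardwire sk (ds_sign DS l)"

definition sign_star_circ :: "pds \<Rightarrow> nat \<Rightarrow> bits \<Rightarrow> bcirc" where
  "sign_star_circ DS l pk = hardwire pk (ds_sign_star DS l)"

text \<open>Sorting encodes the unordered pair of messages canonically.\<close>

definition puncture_key :: "pds \<Rightarrow> nat \<Rightarrow> bits \<Rightarrow> bits \<Rightarrow> bits \<Rightarrow> bits pmf" where
  "puncture_key DS l sk m1 m2 =
     prun (ds_pklen DS l) (ds_puncture DS) l (sk @ concat (sort [m1, m2]))"

definition ds_efficient :: "pds \<Rightarrow> bool" where
  "ds_efficient DS \<longleftrightarrow>
     poly_length (ds_msglen DS) \<and> poly_length (ds_siglen DS) \<and> poly_length (ds_sklen DS) \<and>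
     poly_length (ds_vklen DS) \<and> poly_length (ds_pklen DS) \<and>
     prob_poly (\<lambda>l. 0) (\<lambda>l. ds_sklen DS l + ds_vklen DS l) (ds_gen DS) \<and>
     det_poly (\<lambda>l. ds_msglen DS l + ds_sklen DS l) (ds_siglen DS) (ds_sign DS) \<and>
     prob_poly (\<lambda>l. ds_sklen DS l + 2 * ds_msglen DS l) (ds_pklen DS) (ds_puncture DS) \<and>
     det_poly (\<lambda>l. ds_vklen DS l + ds_msglen DS l + ds_siglen DS l) (\<lambda>l. 1) (ds_verify DS) \<and>
     det_poly (\<lambda>l. ds_msglen DS l + ds_pklen DS l) (ds_siglen DS) (ds_sign_star DS)"

definition ds_correct :: "pds \<Rightarrow> bool" where
  "ds_correct DS \<longleftrightarrow>
     (\<forall>l. \<forall>sk \<in> ds_support DS l. \<forall>m \<in> words (ds_msglen DS l).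
        beval (ds_siglen DS l) (sign_circ DS l sk) m \<noteq> bottom (ds_siglen DS l)) \<and>
     (\<exists>\<epsilon>. negligible \<epsilon> \<and> (\<forall>l. \<forall>m \<in> words (ds_msglen DS l).
        measure_pmf.prob (ds_keys DS l)
          {(sk, vk). accepts (ds_verify DS) l vk m (beval (ds_siglen DS l) (sign_circ DS l sk) m)}
        \<ge> 1 - \<epsilon> l))"

definition ds_punctured_correct :: "pds \<Rightarrow> bool" where
  "ds_punctured_correct DS \<longleftrightarrow>
     (\<forall>l. \<forall>sk \<in> ds_support DS l. \<forall>m1 \<in> words (ds_msglen DS l). \<forall>m2 \<in> words (ds_msglen DS l).
      \<forall>pk \<in> set_pmf (puncture_key DS l sk m1 m2). \<forall>m \<in> words (ds_msglen DS l).
        beval (ds_siglen DS l) (sign_star_circ DS l pk) m =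
          (if m \<in> {m1, m2} then bottom (ds_siglen DS l)
           else beval (ds_siglen DS l) (sign_circ DS l sk) m))"

definition forge_prob :: "pds \<Rightarrow> qalg \<Rightarrow> nat \<Rightarrow> real" where
  "forge_prob DS D l =
     measure_pmf.expectation (ds_keys DS l) (\<lambda>(sk, vk).
     measure_pmf.expectation (pair_pmf (uniform (ds_msglen DS l)) (uniform (ds_msglen DS l)))
       (\<lambda>(m1, m2).
     measure_pmf.expectation (puncture_key DS l sk m1 m2) (\<lambda>pk.
       \<Sum>\<sigma> \<in> {\<sigma> \<in> words (ds_siglen DS l). accepts (ds_verify DS) l vk m1 \<sigma>}.
         meas (qrun D l (length (m1 @ vk @ pk)) (basis_state (m1 @ vk @ pk))) \<sigma>)))"

definition puncturable_secure :: "pds \<Rightarrow> bool" where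
  "puncturable_secure DS \<longleftrightarrow>
     (\<forall>D. qpt D \<and> (\<forall>l k. q_out (D l k) = ds_siglen DS l) \<longrightarrow> negligible (forge_prob DS D))"

definition puncturable_ds :: "pds \<Rightarrow> bool" where
  "puncturable_ds DS \<longleftrightarrow>
     ds_efficient DS \<and> ds_correct DS \<and> ds_punctured_correct DS \<and> puncturable_secure DS"


section \<open>Unclonable puncturable obfuscation\<close>

text \<open>
  A keyed circuit class with a puncturing procedure, which may be probabilistic and directly yields
  the punctured circuit.
\<close>

record kclass =
  kc_in :: "nat \<Rightarrow> nat"
  kc_out :: "nat \<Rightarrow> nat"
  kc_keylen :: "nat \<Rightarrow> nat"
  kc_keys :: "nat \<Rightarrow> bits set"
  kc_circ :: "nat \<Rightarrow> bits \<Rightarrow> bcirc"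
  kc_punct :: "nat \<Rightarrow> bits \<Rightarrow> bits \<Rightarrow> bits \<Rightarrow> bcirc pmf"

definition kclass_wf :: "kclass \<Rightarrow> bool" where
  "kclass_wf K \<longleftrightarrow>
     (\<forall>l. kc_keys K l \<subseteq> words (kc_keylen K l)) \<and>
     (\<forall>l. \<forall>k \<in> kc_keys K l. bcirc_wf (kc_in K l) (kc_out K l) (kc_circ K l k)) \<and>
     (\<forall>l. \<forall>k \<in> kc_keys K l. \<forall>k' \<in> kc_keys K l. length (kc_circ K l k) = length (kc_circ K l k')) \<and>
     (\<exists>d. \<forall>l. \<forall>k \<in> kc_keys K l. length (kc_circ K l k) \<le> (l + 2) ^ d)"

text \<open>The state \<open>Obf(1\<^sup>l, C)\<close> and its number of qubits; \<open>Obf\<close> receives the description of \<open>C\<close>.\<close>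

definition obf_state :: "qalg \<Rightarrow> nat \<Rightarrow> bcirc \<Rightarrow> qop" where
  "obf_state Obf l C = qrun Obf l (length (enc_bcirc C)) (basis_state (enc_bcirc C))"

definition obf_qubits :: "qalg \<Rightarrow> nat \<Rightarrow> bcirc \<Rightarrow> nat" where
  "obf_qubits Obf l C = q_out (Obf l (length (enc_bcirc C)))"

text \<open>
  Probability that an algorithm with input a state \<open>\<rho>\<close> on \<open>q\<close> qubits and a classical string \<open>x\<close>
  returns the classical \<open>p\<close>-bit string \<open>y\<close>, contained in its first \<open>p\<close> output qubits. The other
  output qubits hold the residual quantum state.
\<close>

definition output_prob :: "qalg \<Rightarrow> nat \<Rightarrow> nat \<Rightarrow> qop \<Rightarrow> bits \<Rightarrow> nat \<Rightarrow> bits \<Rightarrow> real" where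
  "output_prob E l q \<rho> x p y =
     meas_first (q_out (E l (q + length x))) p
       (qrun E l (q + length x) (qop_tensor q \<rho> (basis_state x))) y"

definition upo_correct :: "kclass \<Rightarrow> qalg \<Rightarrow> qalg \<Rightarrow> bool" where
  "upo_correct K Obf Eval \<longleftrightarrow>
     (\<exists>\<epsilon>. negligible \<epsilon> \<and> (\<forall>l. \<forall>k \<in> kc_keys K l. \<forall>x \<in> words (kc_in K l).
        let C = kc_circ K l k in
        output_prob Eval l (obf_qubits Obf l C) (obf_state Obf l C) x (kc_out K l)
          (beval (kc_out K l) C x) \<ge> 1 - \<epsilon> l))"

text \<open>
  Probability that the UPO experiment outputs 1. The first stage \<open>A1\<close> of the adversary has no input
  qubits; its first \<open>kc_keylen\<close> output qubits are measured to give the key, and the other ones are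
  the internal state handed to \<open>A2\<close>. The experiment outputs 0 if the key is not a key of the class.
\<close>

definition upo_prob ::
    "kclass \<Rightarrow> (nat \<Rightarrow> (bits \<times> bits) pmf) \<Rightarrow> qalg \<Rightarrow>
     qalg \<Rightarrow> qalg \<Rightarrow> (nat \<Rightarrow> nat \<Rightarrow> nat) \<Rightarrow> qalg \<Rightarrow> qalg \<Rightarrow> nat \<Rightarrow> real" where
  "upo_prob K DX Obf A1 A2 split B C l =
     measure_pmf.expectation (pmf_of_set (UNIV :: bool set)) (\<lambda>b.
     \<Sum>k \<in> kc_keys K l.
     measure_pmf.expectation (DX l) (\<lambda>(xB, xC).
     measure_pmf.expectation
       (if b then kc_punct K l k xB xC else return_pmf (kc_circ K l k)) (\<lambda>G.
       let r = q_out (A1 l 0) - kc_keylen K l;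
           st = post k (qrun A1 l 0 (basis_state []));
           q = r + obf_qubits Obf l G;
           \<sigma> = qrun A2 l q (qop_tensor r st (obf_state Obf l G))
       in split_prob B C l (split l q) (q_out (A2 l q) - split l q) xB xC \<sigma> [b] [b])))"

definition upo_secure :: "kclass \<Rightarrow> (nat \<Rightarrow> (bits \<times> bits) pmf) \<Rightarrow> qalg \<Rightarrow> bool" where
  "upo_secure K DX Obf \<longleftrightarrow>
     (\<forall>A1 A2 split B C.
        qpt A1 \<and> (\<forall>l. kc_keylen K l \<le> q_out (A1 l 0)) \<and> qpt_bipartite A2 split \<and>
        qpt B \<and> (\<forall>l k. q_out (B l k) = 1) \<and> qpt C \<and> (\<forall>l k. q_out (C l k) = 1) \<longrightarrow>
        (\<exists>\<epsilon>. negligible \<epsilon> \<and> (\<forall>l. upo_prob K DX Obf A1 A2 split B C l \<le> 1 / 2 + \<epsilon> l)))"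

definition upo_scheme ::
    "kclass \<Rightarrow> (nat \<Rightarrow> (bits \<times> bits) pmf) \<Rightarrow> qalg \<Rightarrow> qalg \<Rightarrow> bool" where
  "upo_scheme K DX Obf Eval \<longleftrightarrow>
     kclass_wf K \<and> qpt Obf \<and> qpt Eval \<and> (\<forall>l k. kc_out K l \<le> q_out (Eval l k)) \<and>
     upo_correct K Obf Eval \<and> upo_secure K DX Obf"

definition sign_class :: "pds \<Rightarrow> kclass" where
  "sign_class DS =
     \<lparr>kc_in = ds_msglen DS, kc_out = ds_siglen DS, kc_keylen = ds_sklen DS,
      kc_keys = ds_support DS, kc_circ = sign_circ DS,
      kc_punct = (\<lambda>l sk m1 m2. map_pmf (sign_star_circ DS l) (puncture_key DS l sk m1 m2))\<rparr>"

definition uniform_pair :: "(nat \<Rightarrow> nat) \<Rightarrow> nat \<Rightarrow> (bits \<times> bits) pmf" where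
  "uniform_pair n l = pair_pmf (uniform (n l)) (uniform (n l))"


section \<open>Copy-protection for signatures\<close>

text \<open>
  The signing algorithm takes the quantum key followed by the message; the signature is contained in
  its first \<open>cp_siglen\<close> output qubits.
\<close>

record cpds =
  cp_msglen :: "nat \<Rightarrow> nat"
  cp_siglen :: "nat \<Rightarrow> nat"
  cp_sklen :: "nat \<Rightarrow> nat"
  cp_vklen :: "nat \<Rightarrow> nat"
  cp_gen :: palg
  cp_qkeygen :: qalg
  cp_sign :: qalg
  cp_verify :: "nat \<Rightarrow> bcirc"

abbreviation cp_keys :: "cpds \<Rightarrow> nat \<Rightarrow> (bits \<times> bits) pmf" where
  "cp_keys CP \<equiv> gen_keys (cp_gen CP) (cp_sklen CP) (cp_vklen CP)"

definition cp_key_state :: "cpds \<Rightarrow> nat \<Rightarrow> bits \<Rightarrow> qop" where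
  "cp_key_state CP l sk = qrun (cp_qkeygen CP) l (length sk) (basis_state sk)"

definition cp_key_qubits :: "cpds \<Rightarrow> nat \<Rightarrow> nat" where
  "cp_key_qubits CP l = q_out (cp_qkeygen CP l (cp_sklen CP l))"

definition cp_efficient :: "cpds \<Rightarrow> bool" where
  "cp_efficient CP \<longleftrightarrow>
     poly_length (cp_msglen CP) \<and> poly_length (cp_siglen CP) \<and>
     poly_length (cp_sklen CP) \<and> poly_length (cp_vklen CP) \<and>
     prob_poly (\<lambda>l. 0) (\<lambda>l. cp_sklen CP l + cp_vklen CP l) (cp_gen CP) \<and>
     qpt (cp_qkeygen CP) \<and>
     qpt (cp_sign CP) \<and> (\<forall>l k. cp_siglen CP l \<le> q_out (cp_sign CP l k)) \<and>
     det_poly (\<lambda>l. cp_vklen CP l + cp_msglen CP l + cp_siglen CP l) (\<lambda>l. 1) (cp_verify CP)"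

definition cp_correct :: "cpds \<Rightarrow> bool" where
  "cp_correct CP \<longleftrightarrow>
     (\<exists>\<epsilon>. negligible \<epsilon> \<and> (\<forall>l. \<forall>m \<in> words (cp_msglen CP l).
        measure_pmf.expectation (cp_keys CP l) (\<lambda>(sk, vk).
          \<Sum>\<sigma> \<in> {\<sigma> \<in> words (cp_siglen CP l). accepts (cp_verify CP) l vk m \<sigma>}.
            output_prob (cp_sign CP) l (cp_key_qubits CP l) (cp_key_state CP l sk) m
              (cp_siglen CP l) \<sigma>)
        \<ge> 1 - \<epsilon> l))"

definition piracy_prob ::
    "cpds \<Rightarrow> qalg \<Rightarrow> (nat \<Rightarrow> nat \<Rightarrow> nat) \<Rightarrow> qalg \<Rightarrow> qalg \<Rightarrow> nat \<Rightarrow> real" where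
  "piracy_prob CP A split B C l =
     measure_pmf.expectation (cp_keys CP l) (\<lambda>(sk, vk).
       let q = cp_key_qubits CP l;
           q' = q + length vk;
           \<sigma> = qrun A l q' (qop_tensor q (cp_key_state CP l sk) (basis_state vk))
       in measure_pmf.expectation (uniform_pair (cp_msglen CP) l) (\<lambda>(mB, mC).
            \<Sum>sB \<in> {s \<in> words (cp_siglen CP l). accepts (cp_verify CP) l vk mB s}.
            \<Sum>sC \<in> {s \<in> words (cp_siglen CP l). accepts (cp_verify CP) l vk mC s}.
              split_prob B C l (split l q') (q_out (A l q') - split l q') mB mC \<sigma> sB sC))"

definition cp_anti_piracy :: "cpds \<Rightarrow> bool" where
  "cp_anti_piracy CP \<longleftrightarrow>
     (\<forall>A split B C.
        qpt_bipartite A split \<and>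
        qpt B \<and> (\<forall>l k. q_out (B l k) = cp_siglen CP l) \<and>
        qpt C \<and> (\<forall>l k. q_out (C l k) = cp_siglen CP l) \<longrightarrow>
        negligible (piracy_prob CP A split B C))"

definition copy_protection :: "cpds \<Rightarrow> bool" where
  "copy_protection CP \<longleftrightarrow> cp_efficient CP \<and> cp_correct CP \<and> cp_anti_piracy CP"

end

theory Submission
  imports Defs
begin

text \<open>
  A pirate \<open>(A, B, C)\<close> yields a UPO adversary: it generates the key pair itself, submits \<open>sk\<close>, runs
  \<open>A\<close> on the obfuscated circuit and \<open>vk\<close>, and lets both parties guess ``not punctured'' iff the signature
  produced by \<open>B\<close> (resp. \<open>C\<close>) verifies. If the circuit is not punctured, both guess correctly with the
  success probability \<open>p\<close> of the pirate. If it is punctured, a verifying signature of one party is a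
  forgery computed from the punctured key, since obfuscation and pirate can be run on
  \<open>Sign\<^sup>*(pk,\<cdot>)\<close>; hence both reject with probability at least \<open>1 - f\<^sub>1 - f\<^sub>2\<close> for two forgers. UPO security
  gives \<open>p / 2 + (1 - f\<^sub>1 - f\<^sub>2) / 2 \<le> 1 / 2 + \<epsilon>\<close>, that is, \<open>p \<le> 2 \<epsilon> + f\<^sub>1 + f\<^sub>2\<close>.

  All these adversaries have to be uniform circuit families with explicit encodings. They are composed
  from few combinators, whose gate lists are concatenations of blocks that a stack program can print;
  a reference to a subcircuit never renumbers its wires, because registers are moved in front of it
  instead.
\<close>

section \<open>Polynomial bounds and stack programs\<close>

text \<open>\<open>qop\<close> and \<open>sop\<close> are bare matrices, so positivity and trace
  preservation are no part of any type. They are derived from the circuits, by Kraus sums and by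
  unitarity of the gates, and they carry the union bound of the punctured case: the joint outcomes
  of the two pirates are nonnegative and sum to 1. Key generation run by the adversary is a quantum
  circuit, too. Its coins are a uniform superposition, measured by being left in the traced out
  wires, and the unnormalised state after the outcome \<open>sk\<close> weighs each
  \<open>vk\<close> with the joint probability of the pair. Thus the sum over keys in the UPO
  experiment becomes an expectation over key pairs. Both parties verify, so \<open>vk\<close> is
  copied into both registers. A forger keeps the output of one pirate only. That the message and the
  algorithm of the other one do not influence it is no-signalling. The challenge of a forger is the
  first punctured message; the forger for the second register therefore exchanges the registers and
  relies on the symmetry of puncturing in its two messages.\<close>

definition poly_bounded :: "(nat \<Rightarrow> nat) \<Rightarrow> bool" where
  "poly_bounded g \<longleftrightarrow> (\<exists>d. \<forall>n. g n \<le> (n + 2) ^ d)"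

lemma poly_boundedI: "(\<And>n. g n \<le> (n + 2) ^ d) \<Longrightarrow> poly_bounded g"
  unfolding poly_bounded_def by blast

lemma poly_bounded_mono: "poly_bounded g \<Longrightarrow> (\<And>n. f n \<le> g n) \<Longrightarrow> poly_bounded f"
  unfolding poly_bounded_def by (meson le_trans)

lemma poly_bounded_const: "poly_bounded (\<lambda>_. c)"
proof (rule poly_boundedI)
  fix n show "c \<le> (n + 2) ^ c"
  proof -
    have "c \<le> 2 ^ c" by (simp add: less_imp_le_nat)
    also have "\<dots> \<le> (n + 2) ^ c" by (rule power_mono) auto
    finally show ?thesis .
  qed
qed

lemma poly_bounded_id: "poly_bounded (\<lambda>n. n)"
  by (rule poly_boundedI[of _ 1]) auto

lemma poly_bounded_mult: "poly_bounded f \<Longrightarrow> poly_bounded g \<Longrightarrow> poly_bounded (\<lambda>n. f n * g n)"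
proof -
  assume "poly_bounded f" "poly_bounded g"
  then obtain d e where "\<And>n. f n \<le> (n + 2) ^ d" "\<And>n. g n \<le> (n + 2) ^ e"
    unfolding poly_bounded_def by blast
  then have "f n * g n \<le> (n + 2) ^ (d + e)" for n
    unfolding power_add by (rule mult_le_mono)
  then show ?thesis by (rule poly_boundedI)
qed

lemma poly_bounded_add: "poly_bounded f \<Longrightarrow> poly_bounded g \<Longrightarrow> poly_bounded (\<lambda>n. f n + g n)"
proof -
  assume "poly_bounded f" "poly_bounded g"
  then obtain d e where *: "\<And>n. f n \<le> (n + 2) ^ d" "\<And>n. g n \<le> (n + 2) ^ e"
    unfolding poly_bounded_def by blast
  \<comment> \<open>Both bounds are below \<open>(n + 2) ^ (d + e)\<close>; one more factor
    \<open>n + 2 \<ge> 2\<close> absorbs the doubling.\<close>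
  have "f n + g n \<le> (n + 2) ^ (d + e + 1)" for n
  proof -
    have "(n + 2) ^ d \<le> (n + 2) ^ (d + e)" "(n + 2) ^ e \<le> (n + 2) ^ (d + e)"
      by (auto intro: power_increasing)
    then have "f n + g n \<le> 2 * (n + 2) ^ (d + e)" using *[of n] by linarith
    also have "\<dots> \<le> (n + 2) * (n + 2) ^ (d + e)" by (rule mult_le_mono1) simp
    finally show ?thesis by simp
  qed
  then show ?thesis by (rule poly_boundedI)
qed

lemma poly_bounded_power: "poly_bounded f \<Longrightarrow> poly_bounded (\<lambda>n. f n ^ d)"
  by (induction d) (auto intro: poly_bounded_const poly_bounded_mult)

lemma poly_bounded_comp: "poly_bounded f \<Longrightarrow> poly_bounded g \<Longrightarrow> poly_bounded (\<lambda>n. g (f n))"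
proof -
  assume f: "poly_bounded f" and "poly_bounded g"
  then obtain d where d: "\<And>n. g n \<le> (n + 2) ^ d" unfolding poly_bounded_def by blast
  have "poly_bounded (\<lambda>n. (f n + 2) ^ d)"
    by (intro poly_bounded_power poly_bounded_add f poly_bounded_const)
  then show ?thesis using d by (rule poly_bounded_mono)
qed

lemmas poly_bounded_intros =
  poly_bounded_const poly_bounded_id poly_bounded_mult poly_bounded_add poly_bounded_power

text \<open>Running times are evaluated at mere upper bounds of the input length, which requires
  monotonicity; \<open>poly_bounded\<close> itself allows arbitrary fluctuation below the
  power.\<close>

lemma poly_bounded_mono_witness:
  assumes "poly_bounded f"
  obtains g where "poly_bounded g" "mono g" "\<And>n. f n \<le> g n"
proof -
  from assms obtain d where d: "\<And>n. f n \<le> (n + 2) ^ d" unfolding poly_bounded_def by blast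
  have "mono (\<lambda>n::nat. (n + 2) ^ d)" by (auto intro!: monoI power_mono)
  moreover have "poly_bounded (\<lambda>n. (n + 2) ^ d)" by (intro poly_bounded_intros)
  ultimately show ?thesis using d that by blast
qed

section \<open>Stack programs as subroutines: renaming of stacks\<close>

fun com_vars :: "com \<Rightarrow> nat set" where
  "com_vars Skip = {}"
| "com_vars (Push x b) = {x}"
| "com_vars (Pop x) = {x}"
| "com_vars (Seq c d) = com_vars c \<union> com_vars d"
| "com_vars (IfTop x c d) = insert x (com_vars c \<union> com_vars d)"
| "com_vars (While x c) = insert x (com_vars c)"

fun com_rename :: "(nat \<Rightarrow> nat) \<Rightarrow> com \<Rightarrow> com" where
  "com_rename p Skip = Skip"
| "com_rename p (Push x b) = Push (p x) b"
| "com_rename p (Pop x) = Pop (p x)"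
| "com_rename p (Seq c d) = Seq (com_rename p c) (com_rename p d)"
| "com_rename p (IfTop x c d) = IfTop (p x) (com_rename p c) (com_rename p d)"
| "com_rename p (While x c) = While (p x) (com_rename p c)"

lemma finite_com_vars: "finite (com_vars c)"
  by (induction c) auto

lemma exec_length: "exec c S t S' \<Longrightarrow> length (S' x) \<le> length (S x) + t"
proof (induction rule: exec.induct)
  case (exec_Seq c S t S' d t' S'') then show ?case by linarith
next
  case (exec_WhileStep S x c t S' t' S'') then show ?case by linarith
qed auto

text \<open>Memory for a program whose stacks \<open>V\<close> have been relocated along
  \<open>p\<close>; \<open>R\<close> supplies the stacks that the relocated program cannot
  touch.\<close>

definition transplant :: "nat set \<Rightarrow> (nat \<Rightarrow> nat) \<Rightarrow> (nat \<Rightarrow> bits) \<Rightarrow> (nat \<Rightarrow> bits) \<Rightarrow> nat \<Rightarrow> bits" where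
  "transplant V p S R y = (if y \<in> p ` V then S (inv_into V p y) else R y)"

lemma transplant_apply: "inj_on p V \<Longrightarrow> x \<in> V \<Longrightarrow> transplant V p S R (p x) = S x"
  unfolding transplant_def by simp

lemma transplant_upd:
  "inj_on p V \<Longrightarrow> x \<in> V \<Longrightarrow> transplant V p (S(x := w)) R = (transplant V p S R)(p x := w)"
  unfolding transplant_def by (auto simp: fun_eq_iff inj_on_eq_iff)

lemma exec_transplant:
  assumes "inj_on p V"
  shows "exec c S t S' \<Longrightarrow> com_vars c \<subseteq> V \<Longrightarrow>
    exec (com_rename p c) (transplant V p S R) t (transplant V p S' R)"
proof (induction rule: exec.induct)
  case (exec_Push x b S)
  then have "x \<in> V" by simp
  then show ?case
    unfolding com_rename.simps transplant_upd[OF assms \<open>x \<in> V\<close>]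
    using exec.exec_Push[of "p x" b "transplant V p S R"] by (simp only: transplant_apply[OF assms])
next
  case (exec_Pop x S)
  then have "x \<in> V" by simp
  then show ?case
    unfolding com_rename.simps transplant_upd[OF assms \<open>x \<in> V\<close>]
    using exec.exec_Pop[of "p x" "transplant V p S R"] by (simp only: transplant_apply[OF assms])
next
  case (exec_WhileStep S x c t S' t' S'')
  then show ?case
    using exec.exec_WhileStep[of "transplant V p S R" "p x" "com_rename p c"] assms by (simp add: transplant_apply)
qed (use assms in \<open>auto simp: transplant_apply intro: exec.intros[simplified]\<close>)

text \<open>Subroutine principle. A memory \<open>R\<close> that shows \<open>S\<close> on the
  renamed stacks is its own transplant of \<open>S\<close>, so the original run can be replayed in
  it, and everything outside the image of \<open>V\<close> survives.\<close>

lemma exec_rename: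
  assumes "inj p" "exec c S t S'" "com_vars c \<subseteq> V" "\<forall>x\<in>V. R (p x) = S x"
  shows "\<exists>R'. exec (com_rename p c) R t R' \<and> (\<forall>x\<in>V. R' (p x) = S' x) \<and> (\<forall>y. y \<notin> p ` V \<longrightarrow> R' y = R y)"
proof -
  have p: "inj_on p V" using assms(1) by (rule inj_on_subset) simp
  have "transplant V p S R = R"
    using assms(4) p by (auto simp: fun_eq_iff transplant_def)
  then have "exec (com_rename p c) R t (transplant V p S' R)"
    using exec_transplant[OF p assms(2,3), of R] by simp
  then show ?thesis using p by (intro exI[of _ "transplant V p S' R"]) (auto simp: transplant_def)
qed

definition runs :: "com \<Rightarrow> (nat \<Rightarrow> bits) \<Rightarrow> (nat \<Rightarrow> bits) \<Rightarrow> nat \<Rightarrow> bool" where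
  "runs c S S' T \<longleftrightarrow> (\<exists>t\<le>T. exec c S t S')"

lemma runs_weaken: "runs c S S' T \<Longrightarrow> T \<le> T' \<Longrightarrow> runs c S S' T'"
  unfolding runs_def by (meson le_trans)

lemma runs_Skip: "runs Skip S S 1"
  and runs_Push: "runs (Push x b) S (S(x := b # S x)) 1"
  and runs_Pop: "runs (Pop x) S (S(x := tl (S x))) 1"
  unfolding runs_def using exec.intros(1-3) by blast+

lemma runs_Seq: "runs c S S' T \<Longrightarrow> runs d S' S'' T' \<Longrightarrow> runs (Seq c d) S S'' (T + T')"
  unfolding runs_def by (meson add_mono exec_Seq)

lemma runs_IfTrue: "S x \<noteq> [] \<Longrightarrow> hd (S x) \<Longrightarrow> runs c S S' T \<Longrightarrow> runs (IfTop x c d) S S' (Suc T)"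
  unfolding runs_def by (meson Suc_le_mono exec_IfTrue)

lemma runs_IfFalse: "\<not> (S x \<noteq> [] \<and> hd (S x)) \<Longrightarrow> runs d S S' T \<Longrightarrow> runs (IfTop x c d) S S' (Suc T)"
  unfolding runs_def by (meson Suc_le_mono exec_IfFalse)

lemma runs_If:
  "(S x \<noteq> [] \<and> hd (S x) \<Longrightarrow> runs c S S' T) \<Longrightarrow> (\<not> (S x \<noteq> [] \<and> hd (S x)) \<Longrightarrow> runs d S S' T) \<Longrightarrow>
    runs (IfTop x c d) S S' (Suc T)"
  using runs_IfTrue runs_IfFalse by blast

lemma runs_WhileEnd: "S x = [] \<Longrightarrow> runs (While x c) S S 1"
  unfolding runs_def using exec_WhileEnd by blast

lemma runs_WhileStep: "S x \<noteq> [] \<Longrightarrow> runs c S S' T \<Longrightarrow> runs (While x c) S' S'' T' \<Longrightarrow>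
    runs (While x c) S S'' (Suc (T + T'))"
  unfolding runs_def by (meson Suc_le_mono add_mono exec_WhileStep)

section \<open>Elementary programs: clearing, moving and copying stacks\<close>

definition clear :: "nat \<Rightarrow> com" where
  "clear x = While x (Pop x)"

lemma runs_clear: "runs (clear x) S (S(x := [])) (2 * length (S x) + 1)"
proof (induction "S x" arbitrary: S)
  case Nil
  then have "S(x := []) = S" by auto
  with Nil show ?case unfolding clear_def by (metis runs_WhileEnd runs_weaken le_add2)
next
  case (Cons b w)
  have "runs (clear x) (S(x := w)) (S(x := [])) (2 * length w + 1)"
    using Cons(1)[of "S(x := w)"] by simp
  moreover have "runs (Pop x) S (S(x := w)) 1"
    using runs_Pop[of x S] Cons(2)[symmetric] by simp
  ultimately have "runs (clear x) S (S(x := [])) (Suc (1 + (2 * length w + 1)))"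
    unfolding clear_def using Cons(2)[symmetric] by (intro runs_WhileStep) auto
  then show ?case using Cons(2)[symmetric] by simp
qed

definition move_rev :: "nat \<Rightarrow> nat \<Rightarrow> com" where
  "move_rev x y = While x (IfTop x (Seq (Pop x) (Push y True)) (Seq (Pop x) (Push y False)))"

text \<open>Four time units per bit: loop test, branch, pop and push. The last unit is the final
  loop test.\<close>

lemma runs_move_rev:
  "x \<noteq> y \<Longrightarrow> runs (move_rev x y) S (S(x := [], y := rev (S x) @ S y)) (4 * length (S x) + 1)"
proof (induction "S x" arbitrary: S)
  case Nil
  then have "S(x := [], y := rev (S x) @ S y) = S" by auto
  with Nil show ?case unfolding move_rev_def by (metis runs_WhileEnd runs_weaken le_add2)
next
  case (Cons b w)
  note Sx = Cons(2)[symmetric]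
  have 1: "runs (move_rev x y) (S(x := w, y := b # S y)) (S(x := [], y := rev (S x) @ S y)) (4 * length w + 1)"
    using Cons(1)[of "S(x := w, y := b # S y)"] Cons(3) Sx
    by (simp add: fun_upd_twist)
  have 2: "runs (Seq (Pop x) (Push y b)) S (S(x := w, y := b # S y)) 2"
    using runs_Seq[OF runs_Pop[of x S] runs_Push[of y b]] Sx Cons(3) by (simp add: numeral_2_eq_2)
  have "runs (IfTop x (Seq (Pop x) (Push y True)) (Seq (Pop x) (Push y False))) S
      (S(x := w, y := b # S y)) (Suc 2)"
    by (rule runs_If) (use 2 Sx in \<open>cases b; simp\<close>)+
  from runs_WhileStep[OF _ this, of x, OF _ 1[unfolded move_rev_def]] show ?case
    unfolding move_rev_def using Sx by (auto elim: runs_weaken)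
qed

text \<open>Two reversals through the scratch stack \<open>z\<close> cancel.\<close>

definition move :: "nat \<Rightarrow> nat \<Rightarrow> nat \<Rightarrow> com" where
  "move x y z = Seq (move_rev x z) (move_rev z y)"

lemma runs_move:
  assumes "x \<noteq> y" "x \<noteq> z" "y \<noteq> z" "S z = []"
  shows "runs (move x y z) S (S(x := [], y := S x @ S y)) (8 * length (S x) + 2)"
proof -
  let ?S = "S(x := [], z := rev (S x) @ S z)"
  have e: "?S(z := [], y := rev (?S z) @ ?S y) = S(x := [], y := S x @ S y)"
    using assms by (auto simp: fun_eq_iff)
  have "runs (move x y z) S (S(x := [], y := S x @ S y)) (4 * length (S x) + 1 + (4 * length (?S z) + 1))"
    unfolding move_def e[symmetric]
    by (rule runs_Seq[OF runs_move_rev runs_move_rev]) (use assms in simp_all)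
  then show ?thesis using assms by (auto elim!: runs_weaken)
qed

text \<open>A stack can be read only destructively, so copying first reverses \<open>x\<close> onto
  a scratch stack and then pours it back onto both \<open>x\<close> and the target.\<close>

definition copy_back :: "nat \<Rightarrow> nat \<Rightarrow> nat \<Rightarrow> com" where
  "copy_back z x y = While z (IfTop z (Seq (Pop z) (Seq (Push x True) (Push y True)))
      (Seq (Pop z) (Seq (Push x False) (Push y False))))"

lemma runs_copy_back:
  "x \<noteq> y \<Longrightarrow> x \<noteq> z \<Longrightarrow> y \<noteq> z \<Longrightarrow> runs (copy_back z x y) S
    (S(z := [], x := rev (S z) @ S x, y := rev (S z) @ S y)) (5 * length (S z) + 1)"
proof (induction "S z" arbitrary: S)
  case Nil
  then have "S(z := [], x := rev (S z) @ S x, y := rev (S z) @ S y) = S" by auto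
  with Nil show ?case unfolding copy_back_def by (metis runs_WhileEnd runs_weaken le_add2)
next
  case (Cons b w)
  note Sz = Cons(2)[symmetric]
  let ?S = "S(z := w, x := b # S x, y := b # S y)"
  have e: "?S(z := [], x := rev (?S z) @ ?S x, y := rev (?S z) @ ?S y) =
      S(z := [], x := rev (S z) @ S x, y := rev (S z) @ S y)"
    using Cons(3-) Sz by (auto simp: fun_eq_iff)
  have 1: "runs (copy_back z x y) ?S (S(z := [], x := rev (S z) @ S x, y := rev (S z) @ S y)) (5 * length w + 1)"
    using Cons(1)[of ?S] Cons(3-) unfolding e by simp
  have 2: "runs (Seq (Pop z) (Seq (Push x b) (Push y b))) S ?S 3"
    using runs_Seq[OF runs_Pop[of z S] runs_Seq[OF runs_Push[of x b] runs_Push[of y b]]] Sz Cons(3-)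
    by (simp add: numeral_eq_Suc)
  have "runs (IfTop z (Seq (Pop z) (Seq (Push x True) (Push y True)))
      (Seq (Pop z) (Seq (Push x False) (Push y False)))) S ?S (Suc 3)"
    by (rule runs_If) (use 2 Sz in \<open>cases b; simp\<close>)+
  from runs_WhileStep[OF _ this, of z, OF _ 1[unfolded copy_back_def]] show ?case
    unfolding copy_back_def using Sz by (auto elim: runs_weaken)
qed

definition copy :: "nat \<Rightarrow> nat \<Rightarrow> nat \<Rightarrow> com" where
  "copy x y z = Seq (move_rev x z) (copy_back z x y)"

lemma runs_copy:
  assumes "x \<noteq> y" "x \<noteq> z" "y \<noteq> z" "S z = []"
  shows "runs (copy x y z) S (S(y := S x @ S y)) (9 * length (S x) + 2)"
proof -
  let ?S = "S(x := [], z := rev (S x) @ S z)"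
  have e: "?S(z := [], x := rev (?S z) @ ?S x, y := rev (?S z) @ ?S y) = S(y := S x @ S y)"
    using assms by (auto simp: fun_eq_iff)
  have "runs (copy x y z) S (S(y := S x @ S y)) (4 * length (S x) + 1 + (5 * length (?S z) + 1))"
    unfolding copy_def e[symmetric]
    by (rule runs_Seq[OF runs_move_rev runs_copy_back]) (use assms in simp_all)
  then show ?thesis using assms by (auto elim!: runs_weaken)
qed

section \<open>Functions computed in polynomial time\<close>

definition load :: "bits list \<Rightarrow> nat \<Rightarrow> bits" where
  "load xs i = (if i < length xs then xs ! i else [])"

definition total_length :: "bits list \<Rightarrow> nat" where
  "total_length xs = sum_list (map length xs)"

text \<open>More liberal than \<open>polytime\<close>, for the sake of closure proofs: the inputs
  are arbitrary bit strings rather than unary numbers, the result may be left in any stack, and all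
  other stacks may end up dirty.\<close>

definition ptime :: "nat \<Rightarrow> (bits list \<Rightarrow> bits) \<Rightarrow> bool" where
  "ptime r f \<longleftrightarrow> (\<exists>c out T. poly_bounded T \<and>
     (\<forall>xs. length xs = r \<longrightarrow> (\<exists>S. runs c (load xs) S (T (total_length xs)) \<and> S out = f xs)))"

lemma ptimeI:
  assumes "poly_bounded T"
    and "\<And>xs. length xs = r \<Longrightarrow> \<exists>S. runs c (load xs) S (T (total_length xs)) \<and> S out = f xs"
  shows "ptime r f"
  unfolding ptime_def using assms by blast

lemma ptime_cong: "ptime r f \<Longrightarrow> (\<And>xs. length xs = r \<Longrightarrow> f xs = g xs) \<Longrightarrow> ptime r g"
  unfolding ptime_def by simp

lemma length_le_total: "x \<in> set xs \<Longrightarrow> length x \<le> total_length xs"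
  unfolding total_length_def by (simp add: member_le_sum_list)

lemma length_load_le: "length (load xs i) \<le> total_length xs"
  unfolding load_def by (simp add: length_le_total)

lemma total_length_append [simp]: "total_length (xs @ ys) = total_length xs + total_length ys"
  and total_length_Cons [simp]: "total_length (x # xs) = length x + total_length xs"
  and total_length_Nil [simp]: "total_length [] = 0"
  unfolding total_length_def by auto

fun seqs :: "com list \<Rightarrow> com" where
  "seqs [] = Skip"
| "seqs (c # cs) = Seq c (seqs cs)"

lemma runs_clears:
  "distinct zs \<Longrightarrow> (\<forall>z\<in>set zs. length (S z) \<le> L) \<Longrightarrow>
    runs (seqs (map clear zs)) S (\<lambda>i. if i \<in> set zs then [] else S i) ((2 * L + 2) * length zs + 1)"
proof (induction zs arbitrary: S)
  case Nil
  then show ?case using runs_Skip by auto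
next
  case (Cons z zs)
  have 1: "runs (clear z) S (S(z := [])) (2 * L + 1)"
    by (rule runs_weaken[OF runs_clear]) (use Cons.prems in auto)
  have 2: "runs (seqs (map clear zs)) (S(z := [])) (\<lambda>i. if i \<in> set zs then [] else (S(z := [])) i)
      ((2 * L + 2) * length zs + 1)"
    by (rule Cons.IH) (use Cons.prems in auto)
  have e: "(\<lambda>i. if i \<in> set zs then [] else (S(z := [])) i) = (\<lambda>i. if i \<in> set (z # zs) then [] else S i)"
    by auto
  show ?case using runs_Seq[OF 1 2] unfolding e by (auto elim!: runs_weaken)
qed

lemma runs_copies:
  assumes "r \<le> B" "z < B" "r \<le> z" "S z = []"
    and "\<And>i. i < r \<Longrightarrow> length (S i) \<le> L" and "\<And>i. i < r \<Longrightarrow> S (B + i) = []"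
  shows "runs (seqs (map (\<lambda>i. copy i (B + i) z) [0..<r])) S
      (\<lambda>i. if B \<le> i \<and> i < B + r then S (i - B) else S i) ((9 * L + 3) * r + 1)"
proof -
  \<comment> \<open>Generalised over the first index \<open>k\<close> that is still to be copied, so
    that the induction can peel off one copy at a time.\<close>
  have gen: "runs (seqs (map (\<lambda>i. copy i (B + i) z) [k..<r])) S
      (\<lambda>i. if B + k \<le> i \<and> i < B + r then S (i - B) else S i) ((9 * L + 3) * (r - k) + 1)"
    if "k \<le> r" "S z = []" "\<And>i. i < r \<Longrightarrow> length (S i) \<le> L" "\<And>i. k \<le> i \<Longrightarrow> i < r \<Longrightarrow> S (B + i) = []" for k S
    using that
  proof (induction "r - k" arbitrary: k S)
    case 0
    then have "(\<lambda>i. if B + k \<le> i \<and> i < B + r then S (i - B) else S i) = S" by (intro ext) auto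
    with 0 show ?case by (auto intro: runs_weaken[OF runs_Skip])
  next
    case (Suc n)
    have up: "[k..<r] = k # [Suc k..<r]" using Suc by (simp add: upt_conv_Cons)
    let ?S = "S(B + k := S k)"
    have k: "k < B" "z < B" using Suc assms by auto
    have 1: "runs (copy k (B + k) z) S (S(B + k := S k @ S (B + k))) (9 * length (S k) + 2)"
      by (rule runs_copy) (use k Suc assms in auto)
    then have 1: "runs (copy k (B + k) z) S ?S (9 * L + 2)"
      using Suc.prems(3)[of k] Suc.prems(4)[of k] Suc.hyps by (auto elim!: runs_weaken)
    have 2: "runs (seqs (map (\<lambda>i. copy i (B + i) z) [Suc k..<r])) ?S
      (\<lambda>i. if B + Suc k \<le> i \<and> i < B + r then ?S (i - B) else ?S i) ((9 * L + 3) * (r - Suc k) + 1)"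
      by (rule Suc.hyps) (use Suc k assms in auto)
    have e: "(\<lambda>i. if B + Suc k \<le> i \<and> i < B + r then ?S (i - B) else ?S i) =
        (\<lambda>i. if B + k \<le> i \<and> i < B + r then S (i - B) else S i)"
      using Suc assms(1) by (auto simp: fun_eq_iff)
    have n: "r - k = Suc (r - Suc k)" using Suc by linarith
    from runs_Seq[OF 1 2] show ?case unfolding up e n by (auto elim!: runs_weaken)
  qed
  from gen[of 0 S] assms show ?thesis by simp
qed

text \<open>The clean calling convention behind composition: arguments survive, the result goes to
  stack \<open>r\<close>, and apart from that the memory is restored exactly, so that the work area
  below \<open>m\<close> can be reused by the next call.\<close>

definition procedure :: "nat \<Rightarrow> (bits list \<Rightarrow> bits) \<Rightarrow> com \<Rightarrow> nat \<Rightarrow> (nat \<Rightarrow> nat) \<Rightarrow> bool" where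
  "procedure r f c m T \<longleftrightarrow> poly_bounded T \<and> mono T \<and> r < m \<and>
     (\<forall>xs S. length xs = r \<longrightarrow> (\<forall>i<r. S i = xs ! i) \<longrightarrow> (\<forall>i. r \<le> i \<longrightarrow> i < m \<longrightarrow> S i = []) \<longrightarrow>
       runs c S (S(r := f xs)) (T (total_length xs)))"

lemma procedureD:
  assumes "procedure r f c m T"
  shows "poly_bounded T" "mono T" "r < m"
    "length xs = r \<Longrightarrow> (\<And>i. i < r \<Longrightarrow> S i = xs ! i) \<Longrightarrow> (\<And>i. r \<le> i \<Longrightarrow> i < m \<Longrightarrow> S i = []) \<Longrightarrow>
      runs c S (S(r := f xs)) (T (total_length xs))"
  using assms unfolding procedure_def by blast+

text \<open>A dirty program becomes a clean procedure by running it on copies of the arguments in a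
  private area, moving the result out and clearing that area.\<close>

lemma ptime_procedure:
  assumes "ptime r f"
  obtains c m T where "procedure r f c m T"
proof -
  from assms obtain c out T0 where "poly_bounded T0" and
    *: "\<And>xs. length xs = r \<Longrightarrow> \<exists>S. runs c (load xs) S (T0 (total_length xs)) \<and> S out = f xs"
    unfolding ptime_def by blast
  obtain T where T: "poly_bounded T" "mono T" "\<And>n. T0 n \<le> T n"
    using poly_bounded_mono_witness[OF \<open>poly_bounded T0\<close>] by blast
  define V where "V = {..<r} \<union> com_vars c \<union> {out}"
  have fV: "finite V" unfolding V_def by (simp add: finite_com_vars)
  \<comment> \<open>The arguments, the output and all stacks that the program mentions lie below
    \<open>v\<close>, so clearing \<open>v\<close> relocated stacks erases every trace of the
    run.\<close>
  define v where "v = Suc (Max V)"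
  have v: "i \<in> V \<Longrightarrow> i < v" for i unfolding v_def using fV by (simp add: less_Suc_eq_le)
  \<comment> \<open>Stack \<open>r\<close> receives the result and \<open>Suc r\<close> is scratch
    for copying and moving; the private area starts behind them.\<close>
  define B where "B = r + 2"
  define p where "p = (\<lambda>i::nat. B + i)"
  have p: "inj p" unfolding p_def by (auto intro: injI)
  define prog where "prog = Seq (seqs (map (\<lambda>i. copy i (B + i) (Suc r)) [0..<r]))
    (Seq (com_rename p c) (Seq (move (B + out) r (Suc r)) (seqs (map clear [B..<B + v]))))"
  define T' where "T' = (\<lambda>n. ((9 * n + 3) * r + 1) + (T n + ((8 * (n + T n) + 2) + ((2 * (n + T n) + 2) * v + 1))))"
  have T': "poly_bounded T'" unfolding T'_def by (intro poly_bounded_intros T)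
  have "mono T'" unfolding T'_def using T(2) by (auto intro!: monoI add_mono mult_mono dest: monoD)
  moreover have "r < B + v" unfolding B_def by simp
  moreover have "runs prog S (S(r := f xs)) (T' (total_length xs))"
    if len: "length xs = r" and S: "\<And>i. i < r \<Longrightarrow> S i = xs ! i" "\<And>i. r \<le> i \<Longrightarrow> i < B + v \<Longrightarrow> S i = []" for xs S
  proof -
    let ?N = "total_length xs"
    have le: "length (S i) \<le> ?N" if "i < r" for i
      using that S(1) len length_le_total[of "xs ! i" xs] by auto
    let ?S1 = "\<lambda>i. if B \<le> i \<and> i < B + r then S (i - B) else S i"
    have rv: "r \<le> v" using v[of "r - 1"] unfolding V_def by (cases r) auto
    have 1: "runs (seqs (map (\<lambda>i. copy i (B + i) (Suc r)) [0..<r])) S ?S1 ((9 * ?N + 3) * r + 1)"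
      by (rule runs_copies) (use S le rv in \<open>auto simp: B_def\<close>)
    from *[OF len] obtain X where X: "runs c (load xs) X (T0 ?N)" "X out = f xs" by blast
    then obtain t where t: "t \<le> T0 ?N" "exec c (load xs) t X" unfolding runs_def by blast
    have agree: "?S1 (p x) = load xs x" if "x < v" for x
      using that S len unfolding p_def load_def by (auto simp: B_def)
    have sub: "com_vars c \<subseteq> {..<v}" using v unfolding V_def by auto
    have "\<forall>x\<in>{..<v}. ?S1 (p x) = load xs x" using agree by blast
    from exec_rename[OF p t(2) sub this] obtain S2 where S2: "exec (com_rename p c) ?S1 t S2"
      "\<forall>x\<in>{..<v}. S2 (p x) = X x" "\<forall>y. y \<notin> p ` {..<v} \<longrightarrow> S2 y = ?S1 y" by blast
    have out: "out < v" using v unfolding V_def by auto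
    have 2: "runs (com_rename p c) ?S1 S2 (T ?N)"
      unfolding runs_def using S2(1) t(1) T(3)[of ?N] by (meson le_trans)
    have Xout: "S2 (B + out) = f xs" using S2(2) X(2) out unfolding p_def by auto
    have low: "S2 i = S i" if "i < B \<or> B + v \<le> i" for i
    proof -
      have "i \<notin> p ` {..<v}" using that unfolding p_def by fastforce
      then have "S2 i = ?S1 i" using S2(3) by blast
      then show ?thesis using that rv by auto
    qed
    \<comment> \<open>A run of \<open>t\<close> steps pushes at most \<open>t\<close> bits, which
      bounds the cost of clearing whatever the program left behind.\<close>
    have S2len: "length (S2 i) \<le> ?N + T ?N" if "B \<le> i" "i < B + v" for i
    proof -
      have "length (S2 i) \<le> length (?S1 i) + t" using exec_length[OF S2(1)] by simp
      moreover have "?S1 i = load xs (i - B)" using agree[of "i - B"] that unfolding p_def by auto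
      then have "length (?S1 i) \<le> ?N" by (rule ssubst[where P = "\<lambda>w. length w \<le> ?N"]) (rule length_load_le)
      ultimately show ?thesis using t(1) T(3)[of ?N] by linarith
    qed
    let ?S3 = "S2(B + out := [], r := S2 (B + out) @ S2 r)"
    have r: "S2 r = []" using low[of r] S(2)[of r] by (auto simp: B_def)
    have "runs (move (B + out) r (Suc r)) S2 ?S3 (8 * length (S2 (B + out)) + 2)"
      by (rule runs_move) (use low[of "Suc r"] S(2)[of "Suc r"] in \<open>auto simp: B_def\<close>)
    then have 3: "runs (move (B + out) r (Suc r)) S2 ?S3 (8 * (?N + T ?N) + 2)"
      using S2len[of "B + out"] out by (auto elim!: runs_weaken)
    have "runs (seqs (map clear [B..<B + v])) ?S3 (\<lambda>i. if i \<in> set [B..<B + v] then [] else ?S3 i)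
        ((2 * (?N + T ?N) + 2) * length [B..<B + v] + 1)"
      by (rule runs_clears) (use S2len in \<open>auto simp: B_def\<close>)
    then have 4: "runs (seqs (map clear [B..<B + v])) ?S3 (\<lambda>i. if i \<in> set [B..<B + v] then [] else ?S3 i)
        ((2 * (?N + T ?N) + 2) * v + 1)" by simp
    have e: "(\<lambda>i. if i \<in> set [B..<B + v] then [] else ?S3 i) = S(r := f xs)"
    proof
      fix i
      have "r < B" "r < B + out" unfolding B_def by auto
      consider "i = r" | "B \<le> i" "i < B + v" | "i \<noteq> r" "i < B \<or> B + v \<le> i" by linarith
      then show "(if i \<in> set [B..<B + v] then [] else ?S3 i) = (S(r := f xs)) i"
        using \<open>r < B\<close> S(2)[of i] low[of i] r Xout out by cases auto
    qed
    show ?thesis using runs_Seq[OF 1 runs_Seq[OF 2 runs_Seq[OF 3 4]]] unfolding prog_def T'_def e .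
  qed
  ultimately have "procedure r f prog (B + v) T'" unfolding procedure_def using T' by blast
  then show ?thesis by (rule that)
qed

section \<open>Closure properties of polynomial-time functions\<close>

lemma ptime_nth: "i < r \<Longrightarrow> ptime r (\<lambda>xs. xs ! i)"
proof (rule ptimeI[of "\<lambda>_. 1" _ Skip i])
  show "\<exists>S. runs Skip (load xs) S 1 \<and> S i = xs ! i" if "i < r" "length xs = r" for xs
    using runs_Skip[of "load xs"] that by (auto simp: load_def)
qed (rule poly_bounded_const)

lemma ptime_Nil: "ptime r (\<lambda>_. [])"
proof (rule ptimeI[of "\<lambda>_. 1" _ Skip r])
  show "\<exists>S. runs Skip (load xs) S 1 \<and> S r = []" if "length xs = r" for xs
    using runs_Skip[of "load xs"] that by (auto simp: load_def)
qed (rule poly_bounded_const)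

text \<open>One command pushes at most one bit, so the output is not longer than input plus running
  time.\<close>

lemma ptime_output_bound:
  assumes "ptime r f"
  obtains T where "poly_bounded T" "mono T" "\<And>xs. length xs = r \<Longrightarrow> length (f xs) \<le> T (total_length xs)"
proof -
  from assms obtain c out T0 where T0: "poly_bounded T0" and
    *: "\<And>xs. length xs = r \<Longrightarrow> \<exists>S. runs c (load xs) S (T0 (total_length xs)) \<and> S out = f xs"
    unfolding ptime_def by blast
  have "length (f xs) \<le> total_length xs + T0 (total_length xs)" if "length xs = r" for xs
  proof -
    from *[OF that] obtain S t where "t \<le> T0 (total_length xs)" "exec c (load xs) t S" "S out = f xs"
      unfolding runs_def by blast
    then show ?thesis using exec_length[of c "load xs" t S out] length_load_le[of xs out] by simp
  qed
  moreover have "poly_bounded (\<lambda>n. n + T0 n)" by (intro poly_bounded_intros T0)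
  then obtain T where "poly_bounded T" "mono T" "\<And>n. n + T0 n \<le> T n"
    by (rule poly_bounded_mono_witness) blast
  ultimately show ?thesis using that by (meson le_trans)
qed

lemma load_simps:
  "length xs = r \<Longrightarrow> i < r \<Longrightarrow> load xs i = xs ! i"
  "length xs = r \<Longrightarrow> r \<le> i \<Longrightarrow> load xs i = []"
  unfolding load_def by auto

lemma ptime_Cons:
  assumes "ptime r f" shows "ptime r (\<lambda>xs. b # f xs)"
proof -
  from ptime_procedure[OF assms] obtain c m T where "procedure r f c m T" .
  note c = procedureD[OF this]
  show ?thesis
  proof (rule ptimeI[of "\<lambda>n. T n + 1" _ "Seq c (Push r b)" r])
    fix xs :: "bits list" assume len: "length xs = r"
    have "runs c (load xs) ((load xs)(r := f xs)) (T (total_length xs))"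
      by (rule c(4)) (auto simp: load_simps len)
    from runs_Seq[OF this runs_Push]
    show "\<exists>S. runs (Seq c (Push r b)) (load xs) S (T (total_length xs) + 1) \<and> S r = b # f xs" by fastforce
  qed (intro poly_bounded_intros c)
qed

lemma ptime_tl:
  assumes "ptime r f" shows "ptime r (\<lambda>xs. tl (f xs))"
proof -
  from ptime_procedure[OF assms] obtain c m T where "procedure r f c m T" .
  note c = procedureD[OF this]
  show ?thesis
  proof (rule ptimeI[of "\<lambda>n. T n + 1" _ "Seq c (Pop r)" r])
    fix xs :: "bits list" assume len: "length xs = r"
    have "runs c (load xs) ((load xs)(r := f xs)) (T (total_length xs))"
      by (rule c(4)) (auto simp: load_simps len)
    from runs_Seq[OF this runs_Pop]
    show "\<exists>S. runs (Seq c (Pop r)) (load xs) S (T (total_length xs) + 1) \<and> S r = tl (f xs)" by fastforce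
  qed (intro poly_bounded_intros c)
qed

lemma ptime_const: "ptime r (\<lambda>_. w)"
  by (induction w) (auto intro: ptime_Nil ptime_Cons)

text \<open>Both calls deliver into stack \<open>r\<close>, so the first result is parked at
  \<open>M\<close>, beyond both work areas, and put on top of the second one afterwards.\<close>

lemma ptime_append:
  assumes "ptime r f" "ptime r g" shows "ptime r (\<lambda>xs. f xs @ g xs)"
proof -
  from ptime_procedure[OF assms(1)] obtain c m T where "procedure r f c m T" .
  note c = procedureD[OF this]
  from ptime_procedure[OF assms(2)] obtain c' m' T' where "procedure r g c' m' T'" .
  note c' = procedureD[OF this]
  from ptime_output_bound[OF assms(1)] obtain L where L: "poly_bounded L"
    "\<And>xs. length xs = r \<Longrightarrow> length (f xs) \<le> L (total_length xs)" by metis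
  define M where "M = m + m'"
  let ?c = "Seq c (Seq (move r M (Suc M)) (Seq c' (move M r (Suc M))))"
  show ?thesis
  proof (rule ptimeI[of "\<lambda>n. T n + ((8 * L n + 2) + (T' n + (8 * L n + 2)))" _ ?c r])
    fix xs :: "bits list" assume len: "length xs = r"
    let ?N = "total_length xs"
    let ?S1 = "(load xs)(r := f xs)"
    have 1: "runs c (load xs) ?S1 (T ?N)"
      by (rule c(4)) (auto simp: load_simps len)
    let ?S2 = "?S1(r := [], M := ?S1 r @ ?S1 M)"
    have "runs (move r M (Suc M)) ?S1 ?S2 (8 * length (?S1 r) + 2)"
      by (rule runs_move) (use c(3) in \<open>auto simp: load_simps len M_def\<close>)
    then have 2: "runs (move r M (Suc M)) ?S1 ?S2 (8 * L ?N + 2)"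
      using L(2)[OF len] by (auto elim!: runs_weaken)
    have 3: "runs c' ?S2 (?S2(r := g xs)) (T' ?N)"
      by (rule c'(4)) (use c(3) in \<open>auto simp: load_simps len M_def\<close>)
    let ?S3 = "?S2(r := g xs)"
    have "runs (move M r (Suc M)) ?S3 (?S3(M := [], r := ?S3 M @ ?S3 r)) (8 * length (?S3 M) + 2)"
      by (rule runs_move) (use c(3) in \<open>auto simp: load_simps len M_def\<close>)
    moreover have M: "?S3 M = f xs" using c(3) by (auto simp: load_simps len M_def)
    ultimately have 4: "runs (move M r (Suc M)) ?S3 (?S3(M := [], r := ?S3 M @ ?S3 r)) (8 * L ?N + 2)"
      using L(2)[OF len] by (auto elim!: runs_weaken)
    have "(?S3(M := [], r := ?S3 M @ ?S3 r)) r = f xs @ g xs" using M by simp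
    with runs_Seq[OF 1 runs_Seq[OF 2 runs_Seq[OF 3 4]]]
    show "\<exists>S. runs ?c (load xs) S (T ?N + ((8 * L ?N + 2) + (T' ?N + (8 * L ?N + 2)))) \<and> S r = f xs @ g xs"
      by blast
  qed (intro poly_bounded_intros c c' L)
qed

lemma ptime_if:
  assumes "ptime r f" "ptime r g" "ptime r h"
  shows "ptime r (\<lambda>xs. if f xs \<noteq> [] \<and> hd (f xs) then g xs else h xs)"
proof -
  from ptime_procedure[OF assms(1)] obtain c m T where "procedure r f c m T" .
  note c = procedureD[OF this]
  from ptime_procedure[OF assms(2)] obtain c1 m1 T1 where "procedure r g c1 m1 T1" .
  note c1 = procedureD[OF this]
  from ptime_procedure[OF assms(3)] obtain c2 m2 T2 where "procedure r h c2 m2 T2" .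
  note c2 = procedureD[OF this]
  from ptime_output_bound[OF assms(1)] obtain L where L: "poly_bounded L"
    "\<And>xs. length xs = r \<Longrightarrow> length (f xs) \<le> L (total_length xs)" by metis
  let ?c = "Seq c (IfTop r (Seq (clear r) c1) (Seq (clear r) c2))"
  show ?thesis
  proof (rule ptimeI[of "\<lambda>n. T n + ((2 * L n + 1) + (T1 n + T2 n) + 1)" _ ?c r])
    fix xs :: "bits list" assume len: "length xs = r"
    let ?N = "total_length xs"
    let ?S1 = "(load xs)(r := f xs)"
    have 1: "runs c (load xs) ?S1 (T ?N)"
      by (rule c(4)) (auto simp: load_simps len)
    have 2: "runs (clear r) ?S1 (?S1(r := [])) (2 * L ?N + 1)"
      by (rule runs_weaken[OF runs_clear]) (use L(2)[OF len] in simp)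
    have 3: "runs c1 (?S1(r := [])) (?S1(r := [], r := g xs)) (T1 ?N)"
      by (rule c1(4)) (auto simp: load_simps len)
    have 4: "runs c2 (?S1(r := [])) (?S1(r := [], r := h xs)) (T2 ?N)"
      by (rule c2(4)) (auto simp: load_simps len)
    show "\<exists>S. runs ?c (load xs) S (T ?N + ((2 * L ?N + 1) + (T1 ?N + T2 ?N) + 1)) \<and>
        S r = (if f xs \<noteq> [] \<and> hd (f xs) then g xs else h xs)"
    proof (cases "f xs \<noteq> [] \<and> hd (f xs)")
      case True
      then have "runs (IfTop r (Seq (clear r) c1) (Seq (clear r) c2)) ?S1 (?S1(r := [], r := g xs))
          (Suc (2 * L ?N + 1 + T1 ?N))"
        using runs_Seq[OF 2 3] by (intro runs_IfTrue) auto
      from runs_Seq[OF 1 this] show ?thesis using True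
        by (intro exI[of _ "?S1(r := [], r := g xs)"]) (auto elim!: runs_weaken)
    next
      case False
      then have "runs (IfTop r (Seq (clear r) c1) (Seq (clear r) c2)) ?S1 (?S1(r := [], r := h xs))
          (Suc (2 * L ?N + 1 + T2 ?N))"
        using runs_Seq[OF 2 4] by (intro runs_IfFalse) auto
      from runs_Seq[OF 1 this] show ?thesis using False
        by (intro exI[of _ "?S1(r := [], r := h xs)"]) (auto elim!: runs_weaken)
    qed
  qed (intro poly_bounded_intros c c1 c2 L)
qed

text \<open>The results are parked one after the other from stack \<open>M\<close> on. The position
  is left open from a threshold onwards, because each further component brings its own work area,
  which must stay below \<open>M\<close>.\<close>

lemma ptime_tuple:
  assumes "\<forall>g\<in>set gs. ptime r g"
  shows "\<exists>M0. \<forall>M\<ge>M0. \<exists>c T. poly_bounded T \<and> (\<forall>xs. length xs = r \<longrightarrow>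
    runs c (load xs) (\<lambda>i. if M \<le> i \<and> i < M + length gs then (gs ! (i - M)) xs else load xs i)
      (T (total_length xs)))"
  using assms
proof (induction gs rule: rev_induct)
  case Nil
  have "runs Skip (load xs) (\<lambda>i. if M \<le> i \<and> i < M + length [] then ([] ! (i - M)) xs else load xs i) 1" for xs :: "bits list" and M
  proof -
    have "(\<lambda>i. if M \<le> i \<and> i < M + length [] then ([] ! (i - M)) xs else load xs i) = load xs"
      by (intro ext) auto
    then show ?thesis using runs_Skip by metis
  qed
  then show ?case using poly_bounded_const[of 1] by blast
next
  case (snoc g gs)
  then obtain M0 where M0: "\<And>M. M \<ge> M0 \<Longrightarrow> \<exists>c T. poly_bounded T \<and> (\<forall>xs. length xs = r \<longrightarrow>
    runs c (load xs) (\<lambda>i. if M \<le> i \<and> i < M + length gs then (gs ! (i - M)) xs else load xs i)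
      (T (total_length xs)))" by auto
  have g: "ptime r g" using snoc by auto
  from ptime_procedure[OF g] obtain c m T where "procedure r g c m T" .
  note c = procedureD[OF this]
  from ptime_output_bound[OF g] obtain L where L: "poly_bounded L"
    "\<And>xs. length xs = r \<Longrightarrow> length (g xs) \<le> L (total_length xs)" by metis
  have "\<exists>c T. poly_bounded T \<and> (\<forall>xs. length xs = r \<longrightarrow>
    runs c (load xs) (\<lambda>i. if M \<le> i \<and> i < M + length (gs @ [g]) then ((gs @ [g]) ! (i - M)) xs else load xs i)
      (T (total_length xs)))" if M: "M \<ge> max m M0" for M
  proof -
    from M0[of M] M obtain c1 T1 where c1: "poly_bounded T1" "\<And>xs. length xs = r \<Longrightarrow>
      runs c1 (load xs) (\<lambda>i. if M \<le> i \<and> i < M + length gs then (gs ! (i - M)) xs else load xs i)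
      (T1 (total_length xs))" by auto
    let ?z = "M + length gs"
    let ?c = "Seq c1 (Seq c (move r ?z (Suc ?z)))"
    have "runs ?c (load xs) (\<lambda>i. if M \<le> i \<and> i < M + length (gs @ [g]) then ((gs @ [g]) ! (i - M)) xs else load xs i)
      (T1 (total_length xs) + (T (total_length xs) + (8 * L (total_length xs) + 2)))" if len: "length xs = r" for xs
    proof -
      let ?S1 = "\<lambda>i. if M \<le> i \<and> i < M + length gs then (gs ! (i - M)) xs else load xs i"
      let ?S2 = "?S1(r := g xs)"
      have 2: "runs c ?S1 ?S2 (T (total_length xs))"
        by (rule c(4)) (use M c(3) in \<open>auto simp: load_simps len\<close>)
      let ?S3 = "?S2(r := [], ?z := ?S2 r @ ?S2 ?z)"
      have "runs (move r ?z (Suc ?z)) ?S2 ?S3 (8 * length (?S2 r) + 2)"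
        by (rule runs_move) (use M c(3) in \<open>auto simp: load_simps len\<close>)
      then have 3: "runs (move r ?z (Suc ?z)) ?S2 ?S3 (8 * L (total_length xs) + 2)"
        using L(2)[OF len] by (auto elim!: runs_weaken)
      have "?S3 = (\<lambda>i. if M \<le> i \<and> i < M + length (gs @ [g]) then ((gs @ [g]) ! (i - M)) xs else load xs i)"
        using M c(3) by (intro ext) (auto simp: load_simps len nth_append)
      then show ?thesis using runs_Seq[OF c1(2)[OF len] runs_Seq[OF 2 3]] by simp
    qed
    moreover have "poly_bounded (\<lambda>n. T1 n + (T n + (8 * L n + 2)))" by (intro poly_bounded_intros c c1 L)
    ultimately show ?thesis by blast
  qed
  then show ?case by blast
qed

lemma total_length_map_bound:
  assumes "\<forall>g\<in>set gs. ptime r g"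
  shows "\<exists>L. poly_bounded L \<and> (\<forall>xs. length xs = r \<longrightarrow> total_length (map (\<lambda>g. g xs) gs) \<le> L (total_length xs))"
  using assms
proof (induction gs)
  case Nil then show ?case by (auto intro!: exI[of _ "\<lambda>_. 0"] poly_bounded_const)
next
  case (Cons g gs)
  then obtain L where L: "poly_bounded L" "\<And>xs. length xs = r \<Longrightarrow> total_length (map (\<lambda>g. g xs) gs) \<le> L (total_length xs)" by auto
  have "ptime r g" using Cons by auto
  from ptime_output_bound[OF this] obtain L' where L': "poly_bounded L'"
    "\<And>xs. length xs = r \<Longrightarrow> length (g xs) \<le> L' (total_length xs)" by metis
  show ?case using L L' by (intro exI[of _ "\<lambda>n. L' n + L n"]) (auto intro!: poly_bounded_intros add_mono)
qed

text \<open>A \<open>polytime\<close> program promises nothing on inputs that are not unary, hence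
  the restriction to a domain.\<close>

definition ptime_on :: "bits list set \<Rightarrow> (bits list \<Rightarrow> bits) \<Rightarrow> bool" where
  "ptime_on D f \<longleftrightarrow> (\<exists>c out T. poly_bounded T \<and>
     (\<forall>xs\<in>D. \<exists>S. runs c (load xs) S (T (total_length xs)) \<and> S out = f xs))"

lemma ptime_iff_ptime_on: "ptime r f \<longleftrightarrow> ptime_on {xs. length xs = r} f"
  unfolding ptime_def ptime_on_def by simp

lemma ptime_on_comp:
  assumes "ptime_on D f" "\<forall>g\<in>set gs. ptime r g"
    and D: "\<And>xs. length xs = r \<Longrightarrow> map (\<lambda>g. g xs) gs \<in> D"
  shows "ptime r (\<lambda>xs. f (map (\<lambda>g. g xs) gs))"
proof -
  let ?s = "length gs"
  from assms(1) obtain c out T0 where T0: "poly_bounded T0" and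
    *: "\<And>xs. xs \<in> D \<Longrightarrow> \<exists>S. runs c (load xs) S (T0 (total_length xs)) \<and> S out = f xs"
    unfolding ptime_on_def by blast
  obtain T where T: "poly_bounded T" "mono T" "\<And>n. T0 n \<le> T n"
    using poly_bounded_mono_witness[OF T0] by blast
  from total_length_map_bound[OF assms(2)] obtain L where L: "poly_bounded L"
    "\<And>xs. length xs = r \<Longrightarrow> total_length (map (\<lambda>g. g xs) gs) \<le> L (total_length xs)" by blast
  from ptime_tuple[OF assms(2)] obtain M where "M \<ge> r" "\<exists>c T. poly_bounded T \<and> (\<forall>xs. length xs = r \<longrightarrow>
    runs c (load xs) (\<lambda>i. if M \<le> i \<and> i < M + length gs then (gs ! (i - M)) xs else load xs i)
      (T (total_length xs)))" by (meson le_cases le_trans)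
  then obtain c1 T1 where M: "M \<ge> r" and c1: "poly_bounded T1" "\<And>xs. length xs = r \<Longrightarrow>
      runs c1 (load xs) (\<lambda>i. if M \<le> i \<and> i < M + length gs then (gs ! (i - M)) xs else load xs i)
      (T1 (total_length xs))" by auto
  define p where "p = (\<lambda>i::nat. M + i)"
  have p: "inj p" unfolding p_def by (auto intro: injI)
  show ?thesis
  proof (rule ptimeI[of "\<lambda>n. T1 n + T (L n)" _ "Seq c1 (com_rename p c)" "p out"])
    show "poly_bounded (\<lambda>n. T1 n + T (L n))"
      by (intro poly_bounded_add c1 poly_bounded_comp[OF L(1) T(1)])
    fix xs :: "bits list" assume len: "length xs = r"
    let ?ys = "map (\<lambda>g. g xs) gs"
    let ?S1 = "\<lambda>i. if M \<le> i \<and> i < M + length gs then (gs ! (i - M)) xs else load xs i"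
    \<comment> \<open>Since \<open>M \<ge> r\<close>, the memory from \<open>M\<close> on holds the
      tuple followed by empty stacks, which is a fresh memory for \<open>c\<close>.\<close>
    have agree: "?S1 (p x) = load ?ys x" for x
      using M len unfolding p_def load_def by auto
    obtain X where X: "runs c (load ?ys) X (T0 (total_length ?ys))" "X out = f ?ys" using *[OF D[OF len]] by auto
    then obtain t where t: "t \<le> T0 (total_length ?ys)" "exec c (load ?ys) t X" unfolding runs_def by blast
    have "\<forall>x\<in>UNIV. ?S1 (p x) = load ?ys x" using agree by blast
    from exec_rename[OF p t(2) subset_UNIV this] obtain S2 where S2: "exec (com_rename p c) ?S1 t S2"
      "\<And>x. S2 (p x) = X x" by blast
    have "t \<le> T (L (total_length xs))"
      using t(1) T(3)[of "total_length ?ys"] monoD[OF T(2) L(2)[OF len]] by linarith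
    then have 2: "runs (com_rename p c) ?S1 S2 (T (L (total_length xs)))" using S2(1) unfolding runs_def by blast
    have "S2 (p out) = f ?ys" using S2(2) X(2) by simp
    then show "\<exists>S. runs (Seq c1 (com_rename p c)) (load xs) S (T1 (total_length xs) + T (L (total_length xs)))
       \<and> S (p out) = f (map (\<lambda>g. g xs) gs)"
      using runs_Seq[OF c1(2)[OF len] 2] by blast
  qed
qed

lemma ptime_comp:
  assumes "ptime (length gs) f" "\<forall>g\<in>set gs. ptime r g"
  shows "ptime r (\<lambda>xs. f (map (\<lambda>g. g xs) gs))"
  by (rule ptime_on_comp[OF assms(1)[unfolded ptime_iff_ptime_on] assms(2)]) simp

text \<open>Limited recursion in the spirit of Cobham: a polynomial bound on all intermediate values
  keeps every round, and thus the whole loop, polynomial. The step function receives the round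
  number in unary.\<close>

lemma ptime_rec:
  assumes n: "ptime r n" and init: "ptime r a" and h: "ptime (Suc (Suc r)) h"
    and B: "poly_bounded B"
    and bound: "\<And>xs i. length xs = r \<Longrightarrow> i \<le> length (n xs) \<Longrightarrow>
      length (rec_nat (a xs) (\<lambda>i s. h (xs @ [unary i, s])) i) \<le> B (total_length xs)"
  shows "ptime r (\<lambda>xs. rec_nat (a xs) (\<lambda>i s. h (xs @ [unary i, s])) (length (n xs)))"
proof -
  from ptime_procedure[OF n] obtain cn mn Tn where "procedure r n cn mn Tn" .
  note cn = procedureD[OF this]
  from ptime_procedure[OF init] obtain ca ma Ta where "procedure r a ca ma Ta" .
  note ca = procedureD[OF this]
  let ?r = "Suc (Suc r)"
  from ptime_procedure[OF h] obtain ch mh Th where "procedure ?r h ch mh Th" .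
  note ch = procedureD[OF this]
  from ptime_output_bound[OF n] obtain Ln where Ln: "poly_bounded Ln"
    "\<And>xs. length xs = r \<Longrightarrow> length (n xs) \<le> Ln (total_length xs)" by metis
  define M where "M = mn + ma + mh"
  let ?i = "r" and ?s = "Suc r"
  let ?body = "Seq (Pop M) (Seq ch (Seq (clear ?s) (Seq (move ?r ?s (Suc M)) (Push ?i True))))"
  let ?c = "Seq cn (Seq (move r M (Suc M)) (Seq ca (Seq (move r ?s (Suc M)) (While M ?body))))"
  define Tb where "Tb = (\<lambda>n. 1 + (Th (n + (Ln n + B n)) + (2 * B n + 1 + (8 * B n + 2 + 1))))"
  have Tb: "poly_bounded Tb"
    unfolding Tb_def by (intro poly_bounded_intros B poly_bounded_comp[OF _ ch(1)] Ln)
  define T where "T = (\<lambda>n. Tn n + ((8 * Ln n + 2) + (Ta n + ((8 * B n + 2) + (Ln n * (Tb n + 1) + 1)))))"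
  show ?thesis
  proof (rule ptimeI[of T _ ?c ?s])
    show "poly_bounded T" unfolding T_def by (intro poly_bounded_intros cn ca Ln B Tb)
    fix xs :: "bits list" assume len: "length xs = r"
    let ?N = "total_length xs"
    define st where "st = rec_nat (a xs) (\<lambda>i s. h (xs @ [unary i, s]))"
    define k where "k = length (n xs)"
    have k: "k \<le> Ln ?N" unfolding k_def by (rule Ln(2)[OF len])
    have st: "st 0 = a xs" "\<And>i. st (Suc i) = h (xs @ [unary i, st i])" unfolding st_def by auto
    have stB: "i \<le> k \<Longrightarrow> length (st i) \<le> B ?N" for i unfolding st_def k_def using bound[OF len] .
    \<comment> \<open>The rest of \<open>n xs\<close> at \<open>M\<close> is the countdown, while
      stacks \<open>r\<close> and \<open>Suc r\<close> hold the round number and the current value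
      exactly where the procedure for \<open>h\<close> expects its last two arguments.\<close>
    define inv where "inv = (\<lambda>i. (load xs)(M := drop i (n xs), ?i := unary i, ?s := st i))"
    have rM: "?r < M" unfolding M_def using ch by simp
    have body: "runs ?body (inv i) (inv (Suc i)) (Tb ?N)" if "i < k" for i
    proof -
      have ik: "i \<le> k" "Suc i \<le> k" using that by auto
      let ?S1 = "(inv i)(M := tl (inv i M))"
      let ?ys = "xs @ [unary i, st i]"
      let ?S2 = "?S1(?r := h ?ys)"
      have 1: "runs (Pop M) (inv i) ?S1 1" by (rule runs_Pop)
      have "runs ch ?S1 ?S2 (Th (total_length ?ys))"
      proof (rule ch(4))
        fix j assume "j < ?r"
        then consider "j < r" | "j = r" | "j = ?s" by linarith
        then show "?S1 j = ?ys ! j"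
          using rM len by cases (auto simp: inv_def load_def nth_append)
      qed (use rM len in \<open>auto simp: inv_def load_def M_def\<close>)
      moreover have "total_length ?ys \<le> ?N + (Ln ?N + B ?N)" using stB[OF ik(1)] k that by simp
      ultimately have 2: "runs ch ?S1 ?S2 (Th (?N + (Ln ?N + B ?N)))"
        using monoD[OF ch(2)] runs_weaken by blast
      have "runs (clear ?s) ?S2 (?S2(?s := [])) (2 * length (?S2 ?s) + 1)" by (rule runs_clear)
      then have 3: "runs (clear ?s) ?S2 (?S2(?s := [])) (2 * B ?N + 1)"
        using stB[OF ik(1)] rM by (elim runs_weaken) (auto simp: inv_def)
      let ?S3 = "?S2(?s := [])"
      let ?S4 = "?S3(?r := [], ?s := ?S3 ?r @ ?S3 ?s)"
      have "runs (move ?r ?s (Suc M)) ?S3 ?S4 (8 * length (?S3 ?r) + 2)"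
        by (rule runs_move) (use rM len in \<open>auto simp: inv_def load_def\<close>)
      then have 4: "runs (move ?r ?s (Suc M)) ?S3 ?S4 (8 * B ?N + 2)"
        using stB[OF ik(2)] st by (elim runs_weaken) auto
      have 5: "runs (Push ?i True) ?S4 (?S4(?i := True # ?S4 ?i)) 1" by (rule runs_Push)
      have "?S4(?i := True # ?S4 ?i) = inv (Suc i)"
        using rM len by (auto simp: fun_eq_iff inv_def load_def st tl_drop drop_Suc)
      then show ?thesis
        using runs_Seq[OF 1 runs_Seq[OF 2 runs_Seq[OF 3 runs_Seq[OF 4 5]]]] unfolding Tb_def by simp
    qed
    have loop: "runs (While M ?body) (inv i) (inv k) ((k - i) * (Tb ?N + 1) + 1)" if "i \<le> k" for i
      using that
    proof (induction "k - i" arbitrary: i)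
      case 0
      then have "inv i M = []" using rM by (auto simp: inv_def k_def)
      then show ?case using 0 runs_WhileEnd[of "inv i" M ?body] by auto
    next
      case (Suc d)
      then have "i < k" by linarith
      then have ne: "inv i M \<noteq> []" using rM by (auto simp: inv_def k_def)
      have "runs (While M ?body) (inv (Suc i)) (inv k) ((k - Suc i) * (Tb ?N + 1) + 1)"
        by (rule Suc.hyps(1)) (use Suc in auto)
      from runs_WhileStep[OF ne body[OF \<open>i < k\<close>] this]
      moreover have "k - i = Suc (k - Suc i)" using \<open>i < k\<close> by simp
      ultimately show ?case by (elim runs_weaken) simp
    qed
    let ?S1 = "(load xs)(r := n xs)"
    have 1: "runs cn (load xs) ?S1 (Tn ?N)" by (rule cn(4)) (auto simp: load_simps len)
    let ?S2 = "?S1(r := [], M := ?S1 r @ ?S1 M)"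
    have "runs (move r M (Suc M)) ?S1 ?S2 (8 * length (?S1 r) + 2)"
      by (rule runs_move) (use rM in \<open>auto simp: load_simps len\<close>)
    then have 2: "runs (move r M (Suc M)) ?S1 ?S2 (8 * Ln ?N + 2)"
      using Ln(2)[OF len] by (elim runs_weaken) auto
    let ?S3 = "?S2(r := a xs)"
    have 3: "runs ca ?S2 ?S3 (Ta ?N)"
      by (rule ca(4)) (use rM in \<open>auto simp: load_simps len M_def\<close>)
    let ?S4 = "?S3(r := [], ?s := ?S3 r @ ?S3 ?s)"
    have "runs (move r ?s (Suc M)) ?S3 ?S4 (8 * length (?S3 r) + 2)"
      by (rule runs_move) (use rM in \<open>auto simp: load_simps len\<close>)
    then have 4: "runs (move r ?s (Suc M)) ?S3 ?S4 (8 * B ?N + 2)"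
      using stB[of 0] st by (elim runs_weaken) auto
    have e: "?S4 = inv 0" using rM len by (auto simp: fun_eq_iff inv_def load_def st)
    have "runs (While M ?body) (inv 0) (inv k) (k * (Tb ?N + 1) + 1)" using loop[of 0] by simp
    then have 5: "runs (While M ?body) ?S4 (inv k) (Ln ?N * (Tb ?N + 1) + 1)"
      unfolding e by (rule runs_weaken) (intro add_mono mult_le_mono k order_refl)
    have "inv k ?s = st k" using rM by (simp add: inv_def)
    then show "\<exists>S. runs ?c (load xs) S (T ?N) \<and>
       S ?s = rec_nat (a xs) (\<lambda>i s. h (xs @ [unary i, s])) (length (n xs))"
      using runs_Seq[OF 1 runs_Seq[OF 2 runs_Seq[OF 3 runs_Seq[OF 4 5]]]]
      unfolding T_def st_def k_def by blast
  qed
qed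

lemma ptime_args:
  assumes "ptime s f" "length js = s" "\<forall>j\<in>set js. j < r"
  shows "ptime r (\<lambda>xs. f (map (\<lambda>j. xs ! j) js))"
proof -
  have "ptime r (\<lambda>xs. f (map (\<lambda>g. g xs) (map (\<lambda>j xs. xs ! j) js)))"
    using assms by (intro ptime_comp) (auto intro: ptime_nth)
  then show ?thesis by (simp add: comp_def)
qed

lemma ptime_take:
  assumes "ptime s f" "s \<le> r" shows "ptime r (\<lambda>xs. f (take s xs))"
proof -
  have "ptime r (\<lambda>xs. f (map (\<lambda>j. xs ! j) [0..<s]))"
    using assms by (intro ptime_args) auto
  moreover have "map (\<lambda>j. xs ! j) [0..<s] = take s xs" if "length xs = r" for xs :: "bits list"
    using that assms(2) by (intro nth_equalityI) auto
  ultimately show ?thesis by (elim ptime_cong) simp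
qed

text \<open>The printing loop behind the uniformity proofs: each block is computed from the
  arguments and its index, and the state of the recursion is the output so far.\<close>

lemma ptime_concat_map:
  assumes n: "ptime r n" and g: "ptime (Suc r) g"
  shows "ptime r (\<lambda>xs. concat (map (\<lambda>i. g (xs @ [unary i])) [0..<length (n xs)]))"
proof -
  define h where "h = (\<lambda>zs. zs ! Suc r @ g (take (Suc r) zs))"
  have h: "ptime (Suc (Suc r)) h"
    unfolding h_def by (intro ptime_append ptime_nth ptime_take g) auto
  have rec: "rec_nat [] (\<lambda>i s. h (xs @ [unary i, s])) k = concat (map (\<lambda>i. g (xs @ [unary i])) [0..<k])"
    if "length xs = r" for xs k
    using that by (induction k) (auto simp: h_def nth_append)
  from ptime_output_bound[OF n] obtain Ln where Ln: "poly_bounded Ln"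
    "\<And>xs. length xs = r \<Longrightarrow> length (n xs) \<le> Ln (total_length xs)" by metis
  from ptime_output_bound[OF g] obtain Lg where Lg: "poly_bounded Lg" "mono Lg"
    "\<And>xs. length xs = Suc r \<Longrightarrow> length (g xs) \<le> Lg (total_length xs)" by metis
  have "ptime r (\<lambda>xs. rec_nat [] (\<lambda>i s. h (xs @ [unary i, s])) (length (n xs)))"
  proof (rule ptime_rec[OF n ptime_Nil h, where B = "\<lambda>k. Ln k * Lg (k + Ln k)"])
    show "poly_bounded (\<lambda>k. Ln k * Lg (k + Ln k))"
      by (intro poly_bounded_mult Ln poly_bounded_comp[OF _ Lg(1)] poly_bounded_add poly_bounded_id)
    fix xs :: "bits list" and i assume len: "length xs = r" and i: "i \<le> length (n xs)"
    let ?N = "total_length xs"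
    have "length (concat (map (\<lambda>i. g (xs @ [unary i])) [0..<k])) \<le> k * Lg (?N + Ln ?N)" if "k \<le> length (n xs)" for k
      using that
    proof (induction k)
      case (Suc k)
      have "length (g (xs @ [unary k])) \<le> Lg (total_length (xs @ [unary k]))" using len by (intro Lg(3)) simp
      also have "\<dots> \<le> Lg (?N + Ln ?N)" using Suc.prems Ln(2)[OF len] by (intro monoD[OF Lg(2)]) simp
      finally show ?case using Suc by simp
    qed simp
    from this[OF i] have "length (concat (map (\<lambda>i. g (xs @ [unary i])) [0..<i])) \<le> Ln ?N * Lg (?N + Ln ?N)"
      by (rule le_trans) (use i Ln(2)[OF len] in \<open>auto intro!: mult_le_mono\<close>)
    then show "length (rec_nat [] (\<lambda>i s. h (xs @ [unary i, s])) i) \<le> Ln ?N * Lg (?N + Ln ?N)"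
      unfolding rec[OF len] .
  qed
  then show ?thesis by (rule ptime_cong) (simp add: rec)
qed

text \<open>If \<open>h\<close> never lengthens its argument, all iterates are bounded by the
  initial value, as \<open>ptime_rec\<close> demands.\<close>

lemma ptime_funpow:
  assumes n: "ptime r n" and a: "ptime r a" and h: "ptime 1 (\<lambda>zs. h (zs ! 0))"
    and short: "\<And>s. length (h s) \<le> length s"
  shows "ptime r (\<lambda>xs. (h ^^ length (n xs)) (a xs))"
proof -
  define h' where "h' = (\<lambda>zs::bits list. h (zs ! Suc r))"
  have "ptime (Suc (Suc r)) (\<lambda>xs. (\<lambda>zs. h (zs ! 0)) (map (\<lambda>j. xs ! j) [Suc r]))"
    by (intro ptime_args[OF h]) auto
  then have h': "ptime (Suc (Suc r)) h'" unfolding h'_def by simp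
  have rec: "rec_nat (a xs) (\<lambda>i s. h' (xs @ [unary i, s])) k = (h ^^ k) (a xs)"
    if "length xs = r" for xs k
    using that by (induction k) (auto simp: h'_def nth_append)
  from ptime_output_bound[OF a] obtain L where L: "poly_bounded L"
    "\<And>xs. length xs = r \<Longrightarrow> length (a xs) \<le> L (total_length xs)" by metis
  have len: "length ((h ^^ k) s) \<le> length s" for k s
    by (induction k) (auto intro: le_trans[OF short])
  have "ptime r (\<lambda>xs. rec_nat (a xs) (\<lambda>i s. h' (xs @ [unary i, s])) (length (n xs)))"
  proof (rule ptime_rec[OF n a h' L(1)])
    show "length (rec_nat (a xs) (\<lambda>i s. h' (xs @ [unary i, s])) i) \<le> L (total_length xs)"
      if "length xs = r" for xs i
      unfolding rec[OF that] using len L(2)[OF that] by (rule le_trans)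
  qed
  then show ?thesis by (rule ptime_cong) (simp add: rec)
qed

lemma ptime_unary_length: "ptime r f \<Longrightarrow> ptime r (\<lambda>xs. unary (length (f xs)))"
proof -
  assume "ptime r f"
  note * = ptime_concat_map[OF this ptime_const[of "Suc r" "[True]"]]
  have "concat (map (\<lambda>i. [True]) [0..<k]) = unary k" for k
    by (induction k) (auto simp: replicate_append_same)
  then show ?thesis using * by simp
qed

lemma ptime_drop:
  assumes "ptime r n" "ptime r f" shows "ptime r (\<lambda>xs. drop (length (n xs)) (f xs))"
proof -
  have "(tl ^^ k) s = drop k s" for k and s :: bits
    by (induction k) (auto simp: tl_drop drop_Suc)
  moreover have "ptime r (\<lambda>xs. (tl ^^ length (n xs)) (f xs))"
    by (rule ptime_funpow[OF assms]) (auto intro: ptime_tl ptime_nth)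
  ultimately show ?thesis by simp
qed

text \<open>\<open>IfTop\<close> cannot tell an empty stack from top bit 0; after conversion to
  unary, nonemptiness shows as a top bit 1.\<close>

lemma ptime_if_nonempty:
  assumes "ptime r f" "ptime r g" "ptime r h"
  shows "ptime r (\<lambda>xs. if f xs \<noteq> [] then g xs else h xs)"
  by (rule ptime_cong[OF ptime_if[OF ptime_unary_length[OF assms(1)] assms(2,3)]]) auto

text \<open>Search becomes iteration: removing a leading 1 if there is one, as often as the word is
  long, reaches a fixed point.\<close>

lemma ptime_dropWhile:
  assumes "ptime r f" shows "ptime r (\<lambda>xs. dropWhile id (f xs))"
proof -
  let ?h = "\<lambda>s::bits. if s \<noteq> [] \<and> hd s then tl s else s"
  have "ptime r (\<lambda>xs. (?h ^^ length (f xs)) (f xs))"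
    by (rule ptime_funpow[OF assms assms]) (auto intro!: ptime_if ptime_tl ptime_nth)
  moreover have "length s \<le> k \<Longrightarrow> (?h ^^ k) s = dropWhile id s" for k s
  proof (induction k arbitrary: s)
    case (Suc k)
    have "(?h ^^ Suc k) s = (?h ^^ k) (?h s)" by (simp only: funpow_Suc_right comp_def)
    also have "\<dots> = dropWhile id s"
    proof (cases s)
      case (Cons b w)
      have stay: "(?h ^^ k) w = w" if "\<not> (w \<noteq> [] \<and> hd w)" for w
        using that by (induction k) auto
      show ?thesis using Cons Suc stay[of s] by (cases b) (auto simp: id_def)
    qed (induction k, auto)
    finally show ?case .
  qed simp
  ultimately show ?thesis by simp
qed

lemma ptime_unary_diff:
  assumes "ptime r f" "ptime r g" shows "ptime r (\<lambda>xs. unary (length (f xs) - length (g xs)))"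
  by (rule ptime_cong[OF ptime_unary_length[OF ptime_drop[OF assms(2,1)]]]) simp

text \<open>From left to right, the given program is specified on unary inputs only, so it is
  composed with the conversion of both arguments to unary. From right to left, a clean procedure is
  followed by bringing its result from stack 2 to stack 0.\<close>

lemma polytime_iff: "polytime f \<longleftrightarrow> ptime 2 (\<lambda>xs. f (length (xs ! 0)) (length (xs ! 1)))"
proof
  assume "polytime f"
  then obtain c d where c: "\<And>a b. \<exists>t S.
     exec c ((\<lambda>_. [])(0 := unary a, 1 := unary b)) t S \<and> S 0 = f a b \<and> t \<le> (a + b + 2) ^ d"
    unfolding polytime_def by blast
  let ?D = "{[unary a, unary b] | a b. True}"
  let ?f = "\<lambda>xs. f (length (xs ! 0)) (length (xs ! 1))"
  have load: "load [unary a, unary b] = (\<lambda>_. [])(0 := unary a, 1 := unary b)" for a b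
    by (auto simp: load_def fun_eq_iff nth_Cons')
  have "\<exists>S. runs c (load xs) S ((total_length xs + 2) ^ d) \<and> S 0 = ?f xs" if "xs \<in> ?D" for xs
  proof -
    from that obtain a b where xs: "xs = [unary a, unary b]" by blast
    from c[of a b] obtain t S where "exec c (load xs) t S" "S 0 = f a b" "t \<le> (a + b + 2) ^ d"
      unfolding xs load by blast
    then show ?thesis unfolding runs_def xs by auto
  qed
  moreover have "poly_bounded (\<lambda>n. (n + 2) ^ d)" by (intro poly_bounded_intros)
  ultimately have "ptime_on ?D ?f" unfolding ptime_on_def by blast
  from ptime_on_comp[OF this, of "[\<lambda>xs. unary (length (xs ! 0)), \<lambda>xs. unary (length (xs ! 1))]" 2]
  show "ptime 2 ?f" by (simp add: ptime_unary_length ptime_nth)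
next
  assume "ptime 2 (\<lambda>xs. f (length (xs ! 0)) (length (xs ! 1)))"
  note p = this
  from ptime_procedure[OF p] obtain c m T where
    "procedure 2 (\<lambda>xs. f (length (xs ! 0)) (length (xs ! 1))) c m T" .
  note c = procedureD[OF this]
  from ptime_output_bound[OF p] obtain L where L: "poly_bounded L"
    "\<And>xs. length xs = 2 \<Longrightarrow> length (f (length (xs ! 0)) (length (xs ! 1))) \<le> L (total_length xs)" by metis
  let ?c = "Seq c (Seq (clear 0) (move 2 0 3))"
  have "poly_bounded (\<lambda>n. T n + (2 * n + 1 + (8 * L n + 2)))" by (intro poly_bounded_intros c L)
  then obtain d where d: "\<And>n. T n + (2 * n + 1 + (8 * L n + 2)) \<le> (n + 2) ^ d"
    unfolding poly_bounded_def by blast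
  have "\<exists>t S. exec ?c ((\<lambda>_. [])(0 := unary a, 1 := unary b)) t S \<and> S 0 = f a b \<and> t \<le> (a + b + 2) ^ d" for a b
  proof -
    let ?S0 = "(\<lambda>_::nat. [])(0 := unary a, 1 := unary b)"
    let ?S1 = "?S0(2 := f a b)"
    have 1: "runs c ?S0 ?S1 (T (a + b))"
    proof -
      have "?S0 i = [unary a, unary b] ! i" if "i < 2" for i using that by (auto simp: less_2_cases_iff)
      moreover have "?S0 i = []" if "2 \<le> i" for i :: nat using that by simp
      ultimately show ?thesis using c(4)[of "[unary a, unary b]" ?S0] by simp
    qed
    have 2: "runs (clear 0) ?S1 (?S1(0 := [])) (2 * (a + b) + 1)"
      by (rule runs_weaken[OF runs_clear]) simp
    let ?S2 = "?S1(0 := [])"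
    have "length (f a b) \<le> L (a + b)" using L(2)[of "[unary a, unary b]"] by simp
    then have 3: "runs (move 2 0 3) ?S2 (?S2(2 := [], 0 := ?S2 2 @ ?S2 0)) (8 * L (a + b) + 2)"
      by (intro runs_weaken[OF runs_move]) auto
    from runs_weaken[OF runs_Seq[OF 1 runs_Seq[OF 2 3]] d] show ?thesis
      unfolding runs_def by fastforce
  qed
  then show "polytime f" unfolding polytime_def by blast
qed

lemma polytime_comp:
  assumes "ptime (length gs) F" "\<forall>g\<in>set gs. polytime g"
  shows "polytime (\<lambda>l k. F (map (\<lambda>g. g l k) gs))"
proof -
  have "ptime 2 (\<lambda>xs. F (map (\<lambda>g. g xs) (map (\<lambda>g xs. g (length (xs ! 0)) (length (xs ! 1))) gs)))"
    using assms by (intro ptime_comp) (auto simp: polytime_iff)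
  then show ?thesis unfolding polytime_iff by (simp add: comp_def)
qed

abbreviation pnat :: "(nat \<Rightarrow> nat \<Rightarrow> nat) \<Rightarrow> bool" where
  "pnat n \<equiv> polytime (\<lambda>l k. unary (n l k))"

lemma polytime_const: "polytime (\<lambda>_ _. w)"
  unfolding polytime_iff by (rule ptime_const)

lemma polytime_append: "polytime f \<Longrightarrow> polytime g \<Longrightarrow> polytime (\<lambda>l k. f l k @ g l k)"
  unfolding polytime_iff by (rule ptime_append)

lemma pnat_length: "polytime f \<Longrightarrow> pnat (\<lambda>l k. length (f l k))"
  unfolding polytime_iff by (rule ptime_unary_length)

lemma pnat_const: "pnat (\<lambda>_ _. n)"
  by (rule polytime_const)

lemma pnat_fst: "pnat (\<lambda>l _. l)" and pnat_snd: "pnat (\<lambda>_ k. k)"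
  unfolding polytime_iff by (rule ptime_unary_length, rule ptime_nth, simp)+

lemma pnat_add: "pnat m \<Longrightarrow> pnat n \<Longrightarrow> pnat (\<lambda>l k. m l k + n l k)"
  using polytime_append[of "\<lambda>l k. unary (m l k)" "\<lambda>l k. unary (n l k)"] by (simp add: replicate_add)

lemma pnat_diff: "pnat m \<Longrightarrow> pnat n \<Longrightarrow> pnat (\<lambda>l k. m l k - n l k)"
  unfolding polytime_iff by (drule (1) ptime_unary_diff) simp

lemma pnat_min: "pnat m \<Longrightarrow> pnat n \<Longrightarrow> pnat (\<lambda>l k. min (m l k) (n l k))"
proof -
  assume "pnat m" "pnat n"
  then have "pnat (\<lambda>l k. m l k - (m l k - n l k))" by (intro pnat_diff)
  moreover have "a - (a - b) = min a b" for a b :: nat by simp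
  ultimately show ?thesis by simp
qed

lemma polytime_subst:
  assumes "polytime f" "pnat m" "pnat n"
  shows "polytime (\<lambda>l k. f (m l k) (n l k))"
proof -
  let ?gs = "[\<lambda>l k. unary (m l k), \<lambda>l k. unary (n l k)]"
  have "ptime (length ?gs) (\<lambda>xs. f (length (xs ! 0)) (length (xs ! 1)))"
    using assms(1) by (simp add: polytime_iff numeral_2_eq_2)
  from polytime_comp[OF this] show ?thesis using assms by simp
qed

lemma poly_length_pnat: "poly_length f \<Longrightarrow> pnat m \<Longrightarrow> pnat (\<lambda>l k. f (m l k))"
  unfolding poly_length_def by (rule polytime_subst[OF _ _ pnat_snd])

section \<open>Uniform gate lists\<close>

definition enc_gates :: "qgate list \<Rightarrow> bits" where
  "enc_gates gs = concat (map enc_qgate gs)"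

lemma enc_gates_append [simp]: "enc_gates (gs @ hs) = enc_gates gs @ enc_gates hs"
  and enc_gates_Nil [simp]: "enc_gates [] = []"
  and enc_gates_Cons [simp]: "enc_gates (g # gs) = enc_qgate g @ enc_gates gs"
  unfolding enc_gates_def by auto

lemma enc_gates_concat_map: "enc_gates (concat (map f xs)) = concat (map (\<lambda>x. enc_gates (f x)) xs)"
  by (induction xs) auto

lemma enc_gates_map: "enc_gates (map f xs) = concat (map (\<lambda>x. enc_qgate (f x)) xs)"
  by (induction xs) auto

lemma ptime_unary_add:
  "ptime r (\<lambda>xs. unary (m xs)) \<Longrightarrow> ptime r (\<lambda>xs. unary (n xs)) \<Longrightarrow> ptime r (\<lambda>xs. unary (m xs + n xs))"
  using ptime_append[of r "\<lambda>xs. unary (m xs)" "\<lambda>xs. unary (n xs)"] by (simp add: replicate_add)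

lemma ptime_unary_times:
  "ptime r (\<lambda>xs. unary (m xs)) \<Longrightarrow> ptime r (\<lambda>xs. unary (c * m xs))"
proof (induction c)
  case 0 then show ?case by (simp add: ptime_Nil)
next
  case (Suc c) then show ?case by (simp add: ptime_unary_add)
qed

lemma ptime_enc_nat: "ptime r (\<lambda>xs. unary (m xs)) \<Longrightarrow> ptime r (\<lambda>xs. enc_nat (m xs))"
  unfolding enc_nat.simps by (intro ptime_append ptime_const)

text \<open>The third argument is the block index of a printing loop.\<close>

abbreviation polytime3 :: "(nat \<Rightarrow> nat \<Rightarrow> nat \<Rightarrow> bits) \<Rightarrow> bool" where
  "polytime3 g \<equiv> ptime 3 (\<lambda>xs. g (length (xs ! 0)) (length (xs ! 1)) (length (xs ! 2)))"

lemma polytime3_lift: "polytime f \<Longrightarrow> polytime3 (\<lambda>l k _. f l k)"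
proof -
  assume "polytime f"
  then have "ptime 2 (\<lambda>xs. f (length (xs ! 0)) (length (xs ! 1)))" unfolding polytime_iff .
  from ptime_args[OF this, of "[0, 1]" 3] show ?thesis by simp
qed

lemma polytime3_index: "polytime3 (\<lambda>_ _ i. unary i)"
  by (rule ptime_unary_length, rule ptime_nth) simp

lemma polytime_concat_map:
  assumes "pnat n" "polytime3 g"
  shows "polytime (\<lambda>l k. concat (map (g l k) [0..<n l k]))"
proof -
  have "ptime 2 (\<lambda>xs. unary (n (length (xs ! 0)) (length (xs ! 1))))" using assms(1) unfolding polytime_iff .
  moreover have "ptime (Suc 2) (\<lambda>xs. g (length (xs ! 0)) (length (xs ! 1)) (length (xs ! 2)))"
    using assms(2) by (simp add: numeral_3_eq_3 numeral_2_eq_2)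
  ultimately show ?thesis
    unfolding polytime_iff by (rule ptime_cong[OF ptime_concat_map]) (simp add: nth_append)
qed

text \<open>Stride 1 copies registers; stride 2 spreads bits over every other wire, as the encoding
  of constant gates requires.\<close>

definition cxs :: "nat \<Rightarrow> nat \<Rightarrow> nat \<Rightarrow> nat \<Rightarrow> qgate list" where
  "cxs c a b n = map (\<lambda>i. GCX (a + i) (b + c * i)) [0..<n]"

definition xors :: "nat \<Rightarrow> bits \<Rightarrow> qgate list" where
  "xors a w = concat (map (\<lambda>i. if w ! i then [GX (a + i)] else []) [0..<length w])"

definition hadamards :: "nat \<Rightarrow> qgate list" where
  "hadamards n = map GH [0..<n]"

lemma polytime_cxs:
  assumes "pnat a" "pnat b" "pnat n"
  shows "polytime (\<lambda>l k. enc_gates (cxs c (a l k) (b l k) (n l k)))"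
  unfolding cxs_def enc_gates_map enc_qgate.simps
  by (rule polytime_concat_map[OF assms(3)], intro ptime_append ptime_const ptime_enc_nat ptime_unary_add
      ptime_unary_times polytime3_lift[OF assms(1)] polytime3_lift[OF assms(2)] polytime3_index)

lemma polytime_hadamards:
  assumes "pnat n" shows "polytime (\<lambda>l k. enc_gates (hadamards (n l k)))"
  unfolding hadamards_def enc_gates_map enc_qgate.simps
  by (rule polytime_concat_map[OF assms], intro ptime_append ptime_const ptime_enc_nat polytime3_index)

lemma polytime_xors:
  assumes "pnat a" "polytime w"
  shows "polytime (\<lambda>l k. enc_gates (xors (a l k) (w l k)))"
proof -
  \<comment> \<open>Bit \<open>i\<close> of the word is the head of \<open>drop i\<close>, which a
    stack program can test.\<close>
  let ?g = "\<lambda>l k i. if drop i (w l k) \<noteq> [] \<and> hd (drop i (w l k)) then enc_qgate (GX (a l k + i)) else []"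
  have "ptime 3 (\<lambda>xs. drop (length (xs ! 2)) (w (length (xs ! 0)) (length (xs ! 1))))"
    by (intro ptime_drop ptime_nth polytime3_lift[OF assms(2)]) simp
  then have "polytime3 ?g"
    unfolding enc_qgate.simps
    by (intro ptime_if ptime_append ptime_const ptime_enc_nat ptime_unary_add
        polytime3_lift[OF assms(1)] polytime3_index)
  from polytime_concat_map[OF pnat_length[OF assms(2)] this]
  have "polytime (\<lambda>l k. concat (map (?g l k) [0..<length (w l k)]))" .
  moreover have "concat (map (?g l k) [0..<length (w l k)]) = enc_gates (xors (a l k) (w l k))" for l k
    unfolding xors_def enc_gates_concat_map
    by (intro arg_cong[of _ _ concat] map_cong refl) (auto simp: hd_drop_conv_nth)
  ultimately show ?thesis by simp
qed

section \<open>Reading encoded circuits, and translating Boolean gates into quantum gates\<close>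

lemma dropWhile_unary: "dropWhile id (unary n @ False # w) = False # w"
  by (induction n) auto

lemma length_diff_dropWhile_unary:
  "length (unary n @ False # w) - length (dropWhile id (unary n @ False # w)) = n"
  by (simp add: dropWhile_unary)

lemma polytime_dropWhile: "polytime f \<Longrightarrow> polytime (\<lambda>l k. dropWhile id (f l k))"
  and polytime_tl: "polytime f \<Longrightarrow> polytime (\<lambda>l k. tl (f l k))"
  unfolding polytime_iff by (auto intro: ptime_dropWhile ptime_tl)

text \<open>Decoding a circuit description: a unary number is terminated by 0, so it is the number
  of bits that removing the leading ones takes away.\<close>

lemma polytime_enc_qcirc_parts:
  assumes "polytime (\<lambda>l k. enc_qcirc (Q l k))"
  shows "pnat (\<lambda>l k. q_anc (Q l k))" and "pnat (\<lambda>l k. q_out (Q l k))"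
    and "polytime (\<lambda>l k. enc_gates (q_gates (Q l k)))"
proof -
  have e: "enc_qcirc (Q l k) =
      unary (q_anc (Q l k)) @ False # unary (q_out (Q l k)) @ False # enc_gates (q_gates (Q l k))" for l k
    unfolding enc_qcirc_def enc_gates_def by simp
  have 1: "polytime (\<lambda>l k. tl (dropWhile id (enc_qcirc (Q l k))))"
    by (intro polytime_tl polytime_dropWhile assms)
  show "pnat (\<lambda>l k. q_anc (Q l k))"
    using pnat_diff[OF pnat_length[OF assms] pnat_length[OF polytime_dropWhile[OF assms]]]
    unfolding e length_diff_dropWhile_unary .
  show "pnat (\<lambda>l k. q_out (Q l k))"
    using pnat_diff[OF pnat_length[OF 1] pnat_length[OF polytime_dropWhile[OF 1]]]
    unfolding e dropWhile_unary list.sel by simp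
  show "polytime (\<lambda>l k. enc_gates (q_gates (Q l k)))"
    using polytime_tl[OF polytime_dropWhile[OF 1]] unfolding e dropWhile_unary list.sel .
qed

lemma polytime_enc_qcircI:
  assumes "pnat (\<lambda>l k. q_anc (Q l k))" "pnat (\<lambda>l k. q_out (Q l k))"
    "polytime (\<lambda>l k. enc_gates (q_gates (Q l k)))"
  shows "polytime (\<lambda>l k. enc_qcirc (Q l k))"
  unfolding enc_qcirc_def enc_nat.simps enc_gates_def[symmetric]
  by (intro polytime_append assms polytime_const)

text \<open>The target \<open>t\<close> starts at 0, is set to 1, and the Toffoli gate flips it back
  if both inputs are 1. Since \<open>Nand i i\<close> is allowed while a Toffoli gate needs distinct
  wires, wire \<open>i\<close> is first copied to the scratch wire \<open>s\<close>, which is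
  cleaned afterwards.\<close>

fun gate_code :: "nat \<Rightarrow> nat \<Rightarrow> bgate \<Rightarrow> qgate list" where
  "gate_code t s (Const b) = (if b then [GX t] else [])"
| "gate_code t s (Nand i j) = [GX t, GCX i s, GCCX s j t, GCX i s]"

fun codes :: "nat \<Rightarrow> nat \<Rightarrow> bcirc \<Rightarrow> qgate list" where
  "codes p s [] = []"
| "codes p s (g # C) = gate_code p s g @ codes (Suc p) s C"

text \<open>Reads past the first encoded gate; the leading bit distinguishes a NAND with two unary
  numbers from a constant, which takes two bits.\<close>

definition skip_token :: "bits \<Rightarrow> bits" where
  "skip_token w = (if w \<noteq> [] \<and> hd w then tl (dropWhile id (tl (dropWhile id (tl w)))) else tl (tl w))"

lemma skip_token_enc: "skip_token (enc_bgate g @ w) = w"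
  by (cases g) (auto simp: skip_token_def dropWhile_unary)

lemma enc_bcirc_Cons [simp]: "enc_bcirc (g # C) = enc_bgate g @ enc_bcirc C"
  and enc_bcirc_Nil [simp]: "enc_bcirc [] = []"
  and enc_bcirc_append [simp]: "enc_bcirc (C @ D) = enc_bcirc C @ enc_bcirc D"
  unfolding enc_bcirc_def by auto

text \<open>\<open>skip_token\<close> fixes the empty word, so the equation extends to
  \<open>j\<close> beyond the number of gates.\<close>

lemma skip_tokens: "(skip_token ^^ j) (enc_bcirc C) = enc_bcirc (drop j C)"
proof (induction j arbitrary: C)
  case (Suc j)
  show ?case
  proof (cases C)
    case Nil
    then show ?thesis using Suc[of "[]"] by (simp add: skip_token_def)
  next
    case (Cons g D)
    then show ?thesis using Suc[of D] by (simp add: funpow_swap1 skip_token_enc)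
  qed
qed simp

lemma length_skip_token: "length (skip_token w) \<le> length w"
proof -
  have "length (tl (dropWhile id (tl (dropWhile id (tl w))))) \<le> length w"
    using length_dropWhile_le[of id "tl (dropWhile id (tl w))"] length_dropWhile_le[of id "tl w"] by simp
  then show ?thesis unfolding skip_token_def by simp
qed

lemma polytime3_skip_tokens:
  assumes "polytime f" shows "polytime3 (\<lambda>l k i. (skip_token ^^ i) (f l k))"
proof -
  have "ptime 1 (\<lambda>zs. skip_token (zs ! 0))"
    unfolding skip_token_def by (intro ptime_if ptime_tl ptime_dropWhile ptime_nth) simp_all
  from ptime_funpow[OF ptime_nth[of 2 3] polytime3_lift[OF assms] this length_skip_token]
  show ?thesis by simp
qed

lemma enc_bcirc_eq_Nil_iff: "enc_bcirc C = [] \<longleftrightarrow> C = []"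
proof (cases C)
  case (Cons g D) then show ?thesis by (cases g) auto
qed simp

lemma length_enc_bcirc_ge: "length C \<le> length (enc_bcirc C)"
proof (induction C)
  case (Cons g C) then show ?case by (cases g) auto
qed simp

text \<open>Counts the gates by running \<open>i\<close> up to the length of the encoding and
  printing one bit whenever something is left after \<open>i\<close> gates. The range suffices
  because no gate has an empty encoding.\<close>

lemma pnat_length_bcirc:
  assumes "polytime (\<lambda>l k. enc_bcirc (C l k))" shows "pnat (\<lambda>l k. length (C l k))"
proof -
  let ?g = "\<lambda>l k i. if (skip_token ^^ i) (enc_bcirc (C l k)) \<noteq> [] then [True] else []"
  have "polytime3 ?g"
    by (intro ptime_if_nonempty ptime_const polytime3_skip_tokens[OF assms])
  from polytime_concat_map[OF pnat_length[OF assms] this]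
  have "polytime (\<lambda>l k. concat (map (?g l k) [0..<length (enc_bcirc (C l k))]))" .
  moreover have "concat (map (?g l k) [0..<m]) = unary (min m (length (C l k)))" for l k m
    by (induction m)
      (auto simp: skip_tokens enc_bcirc_eq_Nil_iff min_def replicate_append_same le_Suc_eq)
  ultimately show ?thesis using length_enc_bcirc_ge by (simp add: min_absorb2)
qed

text \<open>
  The quantum code of the gate encoded at the beginning of \<open>w\<close>, with unary wire numbers read
  off as maximal prefixes of ones.
\<close>

definition token_code :: "bits \<Rightarrow> nat \<Rightarrow> nat \<Rightarrow> bits" where
  "token_code w t s =
    (if w \<noteq> [] \<and> hd w then
       let u = tl w; v = tl (dropWhile id u);
           i = length u - length (dropWhile id u); j = length v - length (dropWhile id v)
       in enc_gates [GX t, GCX i s, GCCX s j t, GCX i s]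
     else if tl w \<noteq> [] \<and> hd (tl w) then enc_gates [GX t] else [])"

lemma token_code_enc: "token_code (enc_bgate g @ w) t s = enc_gates (gate_code t s g)"
proof (cases g)
  case (Nand i j)
  then show ?thesis
    using length_diff_dropWhile_unary[of i "unary j @ False # w"] length_diff_dropWhile_unary[of j w]
    unfolding token_code_def Let_def by (simp add: dropWhile_unary)
qed (simp add: token_code_def)

text \<open>Gate \<open>i\<close> is found by skipping \<open>i\<close> tokens and writes to wire
  \<open>p + i\<close>, so its block can be printed from the index alone.\<close>

lemma polytime_codes:
  assumes C: "polytime (\<lambda>l k. enc_bcirc (C l k))" and p: "pnat p" and s: "pnat s"
  shows "polytime (\<lambda>l k. enc_gates (codes (p l k) (s l k) (C l k)))"
proof -
  let ?w = "\<lambda>l k i. (skip_token ^^ i) (enc_bcirc (C l k))"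
  let ?g = "\<lambda>l k i. token_code (?w l k i) (p l k + i) (s l k)"
  have "polytime3 ?g"
    unfolding token_code_def Let_def enc_gates_Cons enc_gates_Nil append_Nil2 enc_qgate.simps
    by (intro ptime_if ptime_tl ptime_append ptime_const ptime_enc_nat ptime_unary_add ptime_unary_diff
        ptime_dropWhile polytime3_skip_tokens[OF C] polytime3_index
        polytime3_lift[OF p] polytime3_lift[OF s])
  from polytime_concat_map[OF pnat_length_bcirc[OF C] this]
  have "polytime (\<lambda>l k. concat (map (?g l k) [0..<length (C l k)]))" .
  moreover have "concat (map (\<lambda>i. token_code ((skip_token ^^ i) (enc_bcirc D)) (q + i) t) [0..<length D]) =
      enc_gates (codes q t D)" for q t D
  proof (induction D arbitrary: q)
    case (Cons g D)
    have "[0..<length (g # D)] = 0 # map Suc [0..<length D]"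
      by (simp add: map_Suc_upt upt_conv_Cons del: upt_Suc)
    then have "concat (map (\<lambda>i. token_code ((skip_token ^^ i) (enc_bcirc (g # D))) (q + i) t) [0..<length (g # D)]) =
      token_code (enc_bcirc (g # D)) q t @
      concat (map (\<lambda>i. token_code ((skip_token ^^ i) (enc_bcirc D)) (Suc q + i) t) [0..<length D])"
      by (simp add: comp_def funpow_swap1 skip_token_enc del: upt_Suc)
    also have "\<dots> = enc_gates (codes q t (g # D))"
      unfolding Cons.IH by (simp add: token_code_enc)
    finally show ?case .
  qed simp
  ultimately show ?thesis by simp
qed

section \<open>Quantum circuits on basis states\<close>

lemma words_0 [simp]: "words 0 = {[]}"
  unfolding words_def by auto

lemma finite_words [simp]: "finite (words n)"
proof -
  have "words n = {w. set w \<subseteq> UNIV \<and> length w = n}" unfolding words_def by auto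
  then show ?thesis using finite_lists_length_eq[of "UNIV :: bool set" n] by simp
qed

lemma card_words: "card (words n) = 2 ^ n"
proof -
  have "words n = {w. set w \<subseteq> UNIV \<and> length w = n}" unfolding words_def by auto
  then show ?thesis using card_lists_length_eq[of "UNIV :: bool set" n] by simp
qed

lemma words_nonempty [simp]: "words n \<noteq> {}"
  unfolding words_def by (auto intro: exI[of _ "replicate n False"])

lemma words_iff [simp]: "w \<in> words n \<longleftrightarrow> length w = n"
  unfolding words_def by simp

lemma words_add: "words (m + n) = (\<lambda>(u, v). u @ v) ` (words m \<times> words n)"
proof (intro equalityI subsetI)
  fix w :: bits assume "w \<in> words (m + n)"
  then show "w \<in> (\<lambda>(u, v). u @ v) ` (words m \<times> words n)"
    by (auto intro!: image_eqI[of _ _ "(take m w, drop m w)"])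
qed auto

lemma sum_words_add:
  "(\<Sum>w\<in>words (m + n). f w) = (\<Sum>u\<in>words m. \<Sum>v\<in>words n. f (u @ v))"
proof -
  have "inj_on (\<lambda>(u, v). u @ v) (words m \<times> words n)"
    by (auto simp: inj_on_def)
  then have "(\<Sum>w\<in>words (m + n). f w) = (\<Sum>(u, v)\<in>words m \<times> words n. f (u @ v))"
    unfolding words_add by (subst sum.reindex) (auto intro: sum.cong)
  then show ?thesis by (simp add: sum.cartesian_product)
qed

abbreviation zeros :: "nat \<Rightarrow> bits" where
  "zeros n \<equiv> replicate n False"

type_synonym qvec = "bits \<Rightarrow> complex"

definition ket :: "bits \<Rightarrow> qvec" where
  "ket x w = (if w = x then 1 else 0)"

abbreviation run :: "qgate list \<Rightarrow> qvec \<Rightarrow> qvec" where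
  "run gs \<psi> \<equiv> fold apply_gate gs \<psi>"

lemma amp_run: "amp Q x = run (q_gates Q) (ket (x @ zeros (q_anc Q)))"
  unfolding amp_def ket_def by (simp add: ket_def[abs_def])

definition gates_wf :: "nat \<Rightarrow> qgate list \<Rightarrow> bool" where
  "gates_wf n gs \<longleftrightarrow> (\<forall>g \<in> set gs. distinct (qgate_wires g) \<and> set (qgate_wires g) \<subseteq> {..<n})"

lemma gates_wf_simps [simp]:
  "gates_wf n []"
  "gates_wf n (g # gs) \<longleftrightarrow> distinct (qgate_wires g) \<and> set (qgate_wires g) \<subseteq> {..<n} \<and> gates_wf n gs"
  "gates_wf n (gs @ hs) \<longleftrightarrow> gates_wf n gs \<and> gates_wf n hs"
  unfolding gates_wf_def by auto

lemma gates_wf_mono: "gates_wf m gs \<Longrightarrow> m \<le> n \<Longrightarrow> gates_wf n gs"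
  unfolding gates_wf_def by force

lemma qcirc_wf_iff: "qcirc_wf k Q \<longleftrightarrow> q_out Q \<le> k + q_anc Q \<and> gates_wf (k + q_anc Q) (q_gates Q)"
  unfolding qcirc_wf_def gates_wf_def ..

lemma apply_gate_sum:
  "apply_gate g (\<lambda>w. \<Sum>i\<in>I. c i * \<psi> i w) = (\<lambda>w. \<Sum>i\<in>I. c i * apply_gate g (\<psi> i) w)"
proof (cases g)
  case (GH j)
  have "((\<Sum>i\<in>I. c i * \<psi> i x) + s * (\<Sum>i\<in>I. c i * \<psi> i y)) / r =
      (\<Sum>i\<in>I. c i * ((\<psi> i x + s * \<psi> i y) / r))" for x y s r
    unfolding sum_distrib_left sum.distrib[symmetric] sum_divide_distrib
    by (rule sum.cong) (simp_all add: distrib_left mult.left_commute)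
  then show ?thesis unfolding GH apply_gate.simps by (intro ext)
next
  case (GT j)
  show ?thesis unfolding GT apply_gate.simps sum_distrib_left by (simp add: mult.left_commute)
qed auto

lemma run_sum:
  "run gs (\<lambda>w. \<Sum>i\<in>I. c i * \<psi> i w) = (\<lambda>w. \<Sum>i\<in>I. c i * run gs (\<psi> i) w)"
  by (induction gs arbitrary: \<psi>) (auto simp: apply_gate_sum)

text \<open>A gate reads amplitudes only at words of the same length as its argument, so the values
  of an amplitude function at other lengths are irrelevant.\<close>

lemma apply_gate_cong:
  assumes "\<And>w. length w = n \<Longrightarrow> \<psi> w = \<phi> w" "length w = n"
  shows "apply_gate g \<psi> w = apply_gate g \<phi> w"
  using assms by (cases g) auto

lemma run_cong:
  assumes "\<And>w. length w = n \<Longrightarrow> \<psi> w = \<phi> w" "length w = n"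
  shows "run gs \<psi> w = run gs \<phi> w"
  using assms
proof (induction gs arbitrary: \<psi> \<phi>)
  case (Cons g gs)
  show ?case using Cons.IH[of "apply_gate g \<psi>" "apply_gate g \<phi>"] apply_gate_cong[OF Cons.prems(1)] Cons.prems(2) by simp
qed simp

lemma run_ket_length: "length w \<noteq> length x \<Longrightarrow> run gs (ket x) w = 0"
proof -
  assume "length w \<noteq> length x"
  then have "run gs (ket x) w = run gs (\<lambda>_. 0) w"
    by (intro run_cong[of "length w"]) (auto simp: ket_def)
  also have "\<dots> = 0"
    using run_sum[of gs "\<lambda>_. 0" "\<lambda>_. ket x" "{}"] by simp
  finally show ?thesis .
qed

lemma apply_gate_frame:
  assumes "set (qgate_wires g) \<subseteq> {..<n}" "length u = n"
  shows "apply_gate g \<psi> (u @ z) = apply_gate g (\<lambda>u. \<psi> (u @ z)) u"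
  using assms by (cases g) (auto simp: list_update_append nth_append)

lemma run_frame:
  assumes "gates_wf n gs" "length u = n"
  shows "run gs \<psi> (u @ z) = run gs (\<lambda>u. \<psi> (u @ z)) u"
  using assms
proof (induction gs arbitrary: \<psi>)
  case (Cons g gs)
  have "run (g # gs) \<psi> (u @ z) = run gs (\<lambda>u. apply_gate g \<psi> (u @ z)) u"
    using Cons by simp
  also have "\<dots> = run gs (apply_gate g (\<lambda>u. \<psi> (u @ z))) u"
    by (rule run_cong[of n]) (use Cons in \<open>auto intro!: apply_gate_frame\<close>)
  finally show ?case by simp
qed simp

text \<open>Frame rule: gates below wire \<open>n\<close> act as their unitary tensored with the
  identity, here spelled out on a basis state.\<close>

lemma run_ket_append:
  assumes "gates_wf n gs" "length x = n"
  shows "run gs (ket (x @ z)) = (\<lambda>w. \<Sum>u\<in>words n. run gs (ket x) u * ket (u @ z) w)"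
proof
  fix w :: bits
  have eval: "run gs (ket (x @ z)) (u @ z') = run gs (ket x) u * (if z' = z then 1 else 0)"
    if "length u = n" "length z' = length z" for u z'
  proof -
    have "run gs (ket (x @ z)) (u @ z') = run gs (\<lambda>u. ket (x @ z) (u @ z')) u"
      using run_frame assms(1) that(1) .
    \<comment> \<open>A sum with a single term, so that the linearity \<open>run_sum\<close>
      extracts the scalar.\<close>
    also have "\<dots> = run gs (\<lambda>w. \<Sum>i\<in>{()}. (if z' = z then 1 else 0) * ket x w) u"
      by (rule run_cong[of n]) (use assms that in \<open>auto simp: ket_def\<close>)
    also have "\<dots> = run gs (ket x) u * (if z' = z then 1 else 0)"
      unfolding run_sum by simp
    finally show ?thesis .
  qed
  show "run gs (ket (x @ z)) w = (\<Sum>u\<in>words n. run gs (ket x) u * ket (u @ z) w)"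
  proof (cases "length w = n + length z")
    case True
    define a b where "a = take n w" and "b = drop n w"
    have w: "w = a @ b" "length a = n" "length b = length z" using True unfolding a_def b_def by auto
    have "(\<Sum>u\<in>words n. run gs (ket x) u * ket (u @ z) w) =
        (\<Sum>u\<in>words n. if u = a then run gs (ket x) a * (if b = z then 1 else 0) else 0)"
      using w by (intro sum.cong) (auto simp: ket_def)
    then show ?thesis using w eval[of a b] by (simp add: sum.delta)
  next
    case False
    then have "(\<Sum>u\<in>words n. run gs (ket x) u * ket (u @ z) w) = 0"
      by (intro sum.neutral) (auto simp: ket_def)
    then show ?thesis using False assms by (simp add: run_ket_length)
  qed
qed

section \<open>Reversible gates as permutations of basis states, and unitarity\<close>

fun classical :: "qgate \<Rightarrow> bool" where
  "classical (GX i) = True"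
| "classical (GCX a t) = True"
| "classical (GCCX a b t) = True"
| "classical _ = False"

fun act :: "qgate \<Rightarrow> bits \<Rightarrow> bits" where
  "act (GX i) w = w[i := (\<not> w ! i)]"
| "act (GCX a t) w = w[t := (w ! t \<noteq> w ! a)]"
| "act (GCCX a b t) w = w[t := (w ! t \<noteq> (w ! a \<and> w ! b))]"
| "act _ w = w"

lemma length_act [simp]: "length (act g w) = length w"
  by (cases g) auto

lemma act_act:
  assumes "distinct (qgate_wires g)" "set (qgate_wires g) \<subseteq> {..<length w}"
  shows "act g (act g w) = w"
  using assms by (cases g) (auto simp: list_update_same_conv)

lemma apply_gate_classical: "classical g \<Longrightarrow> apply_gate g \<psi> = (\<lambda>w. \<psi> (act g w))"
  by (cases g) auto

text \<open>A gate evaluates amplitudes at \<open>act g w\<close>, that is, it pulls them back; as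
  \<open>act g\<close> is an involution on words that contain its wires, a basis state moves forward
  to its image.\<close>

lemma run_classical:
  "gates_wf (length x) gs \<Longrightarrow> list_all classical gs \<Longrightarrow> run gs (ket x) = ket (fold act gs x)"
proof (induction gs arbitrary: x)
  case (Cons g gs)
  have "apply_gate g (ket x) = ket (act g x)"
  proof
    fix w
    have "act g w = x \<longleftrightarrow> w = act g x"
    proof
      assume "act g w = x"
      then show "w = act g x" using act_act[of g w] length_act[of g w] Cons.prems by simp
    next
      assume "w = act g x"
      then show "act g w = x" using act_act[of g x] Cons.prems by simp
    qed
    then show "apply_gate g (ket x) w = ket (act g x) w"
      using Cons.prems by (simp add: apply_gate_classical ket_def)
  qed
  then show ?case using Cons by simp
qed simp

definition inner_words :: "nat \<Rightarrow> qvec \<Rightarrow> qvec \<Rightarrow> complex" where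
  "inner_words n \<psi> \<phi> = (\<Sum>w\<in>words n. \<psi> w * cnj (\<phi> w))"

lemma sum_words_involution:
  assumes "\<And>w. length w = n \<Longrightarrow> length (f w) = n" "\<And>w. length w = n \<Longrightarrow> f (f w) = w"
  shows "(\<Sum>w\<in>words n. h (f w)) = (\<Sum>w\<in>words n. h w)"
  by (rule sum.reindex_bij_witness[of _ f f]) (use assms in auto)

text \<open>Unitarity gate by gate: reindexing along an involution for the classical gates,
  cancellation of cross terms for Hadamard, a phase of modulus 1 for T.\<close>

lemma inner_words_apply_gate:
  assumes "distinct (qgate_wires g)" "set (qgate_wires g) \<subseteq> {..<n}"
  shows "inner_words n (apply_gate g \<psi>) (apply_gate g \<phi>) = inner_words n \<psi> \<phi>"
proof (cases "classical g")
  case True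
  then show ?thesis
    unfolding inner_words_def apply_gate_classical[OF True]
    using sum_words_involution[of n "act g" "\<lambda>w. \<psi> w * cnj (\<phi> w)"] act_act assms by auto
next
  case False
  then consider i where "g = GH i" | i where "g = GT i" by (cases g) auto
  then show ?thesis
  proof cases
    case (1 i)
    with assms have i: "i < n" by simp
    let ?f = "\<lambda>w::bits. w[i := \<not> w ! i]"
    let ?s = "\<lambda>w::bits. if w ! i then - 1 else 1 :: complex"
    have H: "apply_gate g \<theta> w = (\<theta> (?f w) + ?s w * \<theta> w) / complex_of_real (sqrt 2)" if "length w = n" for \<theta> w
    proof (cases "w ! i")
      case True
      then have "w[i := True] = w" by (metis list_update_id)
      then show ?thesis using 1 True by simp
    next
      case False
      then have "w[i := False] = w" by (metis list_update_id)
      then show ?thesis using 1 False by simp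
    qed
    have f: "length w = n \<Longrightarrow> length (?f w) = n" "length w = n \<Longrightarrow> ?f (?f w) = w"
      "length w = n \<Longrightarrow> ?s (?f w) = - ?s w" for w
      using i by auto
    have sq: "complex_of_real (sqrt 2) * cnj (complex_of_real (sqrt 2)) = 2"
      by (simp flip: of_real_mult)
    have eq: "apply_gate g \<psi> w * cnj (apply_gate g \<phi> w) =
        1 / 2 * (\<psi> (?f w) * cnj (\<phi> (?f w)) + \<psi> w * cnj (\<phi> w)
          + (?s w * \<psi> w * cnj (\<phi> (?f w)) + ?s w * \<psi> (?f w) * cnj (\<phi> w)))" if "length w = n" for w
    proof -
      have "cnj (?s w) = ?s w" "?s w * ?s w = 1" by auto
      then have "(\<psi> (?f w) + ?s w * \<psi> w) * cnj (\<phi> (?f w) + ?s w * \<phi> w) =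
        \<psi> (?f w) * cnj (\<phi> (?f w)) + (?s w * ?s w) * (\<psi> w * cnj (\<phi> w))
          + (?s w * \<psi> w * cnj (\<phi> (?f w)) + ?s w * \<psi> (?f w) * cnj (\<phi> w))"
        by (simp add: algebra_simps)
      then show ?thesis
        unfolding H[OF that] complex_cnj_divide times_divide_times_eq sq using \<open>?s w * ?s w = 1\<close> by simp
    qed
    \<comment> \<open>Flipping bit \<open>i\<close> exchanges the two kinds of cross terms and
      reverses the sign, so together they vanish.\<close>
    have "(\<Sum>w\<in>words n. ?s w * \<psi> w * cnj (\<phi> (?f w))) = (\<Sum>w\<in>words n. ?s (?f w) * \<psi> (?f w) * cnj (\<phi> (?f (?f w))))"
      by (rule sum_words_involution[symmetric]) (use f in auto)
    also have "\<dots> = (\<Sum>w\<in>words n. - (?s w * \<psi> (?f w) * cnj (\<phi> w)))"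
      by (intro sum.cong refl) (simp only: words_iff f, simp)
    finally have cancel: "(\<Sum>w\<in>words n. ?s w * \<psi> w * cnj (\<phi> (?f w)) + ?s w * \<psi> (?f w) * cnj (\<phi> w)) = 0"
      unfolding sum.distrib sum_negf by simp
    have same: "(\<Sum>w\<in>words n. \<psi> (?f w) * cnj (\<phi> (?f w))) = inner_words n \<psi> \<phi>"
      unfolding inner_words_def using sum_words_involution[of n ?f "\<lambda>w. \<psi> w * cnj (\<phi> w)"] f by auto
    have "inner_words n (apply_gate g \<psi>) (apply_gate g \<phi>) =
      (\<Sum>w\<in>words n. 1 / 2 * (\<psi> (?f w) * cnj (\<phi> (?f w)) + \<psi> w * cnj (\<phi> w)
          + (?s w * \<psi> w * cnj (\<phi> (?f w)) + ?s w * \<psi> (?f w) * cnj (\<phi> w))))"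
      unfolding inner_words_def by (intro sum.cong refl eq) simp
    also have "\<dots> = 1 / 2 * (inner_words n \<psi> \<phi> + inner_words n \<psi> \<phi> + 0)"
      unfolding sum_distrib_left[symmetric] sum.distrib[of "\<lambda>w. _ w + _ w"] cancel[symmetric]
      unfolding sum.distrib same by (simp add: inner_words_def)
    finally show ?thesis by simp
  next
    case (2 i)
    let ?t = "\<lambda>w::bits. if w ! i then cis (pi / 4) else 1"
    have t: "?t w * cnj (?t w) = 1" for w by (simp add: cis_cnj cis_mult)
    have "(?t w * x) * cnj (?t w * y) = x * cnj y" for w x y
    proof -
      have "(?t w * x) * cnj (?t w * y) = (?t w * cnj (?t w)) * (x * cnj y)"
        by (simp only: complex_cnj_mult mult_ac)
      then show ?thesis unfolding t by simp
    qed
    then show ?thesis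
      unfolding inner_words_def 2 apply_gate.simps by (intro sum.cong refl)
  qed
qed

lemma inner_words_run: "gates_wf n gs \<Longrightarrow> inner_words n (run gs \<psi>) (run gs \<phi>) = inner_words n \<psi> \<phi>"
  by (induction gs arbitrary: \<psi> \<phi>) (auto simp: inner_words_apply_gate)

lemma classical_cxs [simp]: "list_all classical (cxs c a b n)"
  unfolding cxs_def by (auto simp: list_all_iff)

lemma gates_wf_cxs:
  assumes "a + k \<le> n" "\<And>i. i < k \<Longrightarrow> b + c * i < n" "\<And>i. i < k \<Longrightarrow> a + i \<noteq> b + c * i"
  shows "gates_wf n (cxs c a b k)"
  using assms unfolding gates_wf_def cxs_def by auto

lemma cxs_Suc: "cxs c a b (Suc n) = GCX a b # cxs c (Suc a) (b + c) n"
  unfolding cxs_def map_upt_Suc by (simp add: algebra_simps)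

definition xor :: "bits \<Rightarrow> bits \<Rightarrow> bits" where
  "xor z x = map2 (\<noteq>) z x"

lemma xor_zeros [simp]: "length x = n \<Longrightarrow> xor (zeros n) x = x"
  unfolding xor_def by (intro nth_equalityI) auto

lemma xor_self [simp]: "xor x x = zeros (length x)"
  unfolding xor_def by (intro nth_equalityI) auto

lemma act_cxs_up:
  "length z = length x \<Longrightarrow> a = length p \<Longrightarrow> b = length (p @ x @ m) \<Longrightarrow> n = length x \<Longrightarrow>
    fold act (cxs 1 a b n) (p @ x @ m @ z @ s) = p @ x @ m @ xor z x @ s"
proof (induction z x arbitrary: p m a b n rule: list_induct2)
  case Nil then show ?case by (simp add: cxs_def xor_def)
next
  case (Cons z0 z x0 x)
  have "act (GCX a b) (p @ (x0 # x) @ m @ (z0 # z) @ s) = (p @ [x0]) @ x @ (m @ [z0 \<noteq> x0]) @ z @ s"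
    using Cons.prems by (simp add: nth_append list_update_append)
  then show ?case
    using Cons.IH[of "Suc a" "p @ [x0]" "b + 1" "m @ [z0 \<noteq> x0]" "length x"] Cons.prems
    by (simp add: cxs_Suc xor_def)
qed

lemma act_cxs_down:
  "length z = length x \<Longrightarrow> b = length p \<Longrightarrow> a = length (p @ z @ m) \<Longrightarrow> n = length x \<Longrightarrow>
    fold act (cxs 1 a b n) (p @ z @ m @ x @ s) = p @ xor z x @ m @ x @ s"
proof (induction z x arbitrary: p m a b n rule: list_induct2)
  case Nil then show ?case by (simp add: cxs_def xor_def)
next
  case (Cons z0 z x0 x)
  have "act (GCX a b) (p @ (z0 # z) @ m @ (x0 # x) @ s) = (p @ [z0 \<noteq> x0]) @ z @ (m @ [x0]) @ x @ s"
    using Cons.prems by (simp add: nth_append list_update_append)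
  then show ?case
    using Cons.IH[of "b + 1" "p @ [z0 \<noteq> x0]" "Suc a" "m @ [x0]" "length x"] Cons.prems
    by (simp add: cxs_Suc xor_def)
qed

text \<open>Two layers of CNOT gates: the first copies the register onto zero wires, the second
  erases the original by xoring the copy into it. No entangled duplicate stays behind.\<close>

definition moves :: "nat \<Rightarrow> nat \<Rightarrow> nat \<Rightarrow> qgate list" where
  "moves a b n = cxs 1 a b n @ cxs 1 b a n"

lemma classical_moves [simp]: "list_all classical (moves a b n)"
  unfolding moves_def by simp

lemma gates_wf_moves: "a + k \<le> n \<Longrightarrow> b + k \<le> n \<Longrightarrow> a \<noteq> b \<or> k = 0 \<Longrightarrow> gates_wf n (moves a b k)"
  unfolding moves_def by (auto intro!: gates_wf_cxs)

lemma act_moves_up: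
  assumes "a = length p" "b = length (p @ x @ m)" "n = length x"
  shows "fold act (moves a b n) (p @ x @ m @ zeros n @ s) = p @ zeros n @ m @ x @ s"
proof -
  have "fold act (cxs 1 a b n) (p @ x @ m @ zeros n @ s) = p @ x @ m @ x @ s"
    using assms by (subst act_cxs_up) auto
  moreover have "fold act (cxs 1 b a n) (p @ x @ m @ x @ s) = p @ zeros n @ m @ x @ s"
    using assms by (subst act_cxs_down) auto
  ultimately show ?thesis unfolding moves_def by simp
qed

lemma act_moves_down:
  assumes "b = length p" "a = length (p @ x @ m)" "n = length x"
  shows "fold act (moves a b n) (p @ zeros n @ m @ x @ s) = p @ x @ m @ zeros n @ s"
proof -
  have "fold act (cxs 1 a b n) (p @ zeros n @ m @ x @ s) = p @ x @ m @ x @ s"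
    using assms by (subst act_cxs_down) auto
  moreover have "fold act (cxs 1 b a n) (p @ x @ m @ x @ s) = p @ x @ m @ zeros n @ s"
    using assms by (subst act_cxs_up) auto
  ultimately show ?thesis unfolding moves_def by simp
qed

section \<open>Combinators for quantum circuits\<close>

lemma amp_length: "length w \<noteq> length x + q_anc Q \<Longrightarrow> amp Q x w = 0"
  unfolding amp_run by (rule run_ket_length) simp

lemma sop_of_length:
  assumes "qcirc_wf (length x) Q" "length y = length x" "length u \<noteq> q_out Q \<or> length v \<noteq> q_out Q"
  shows "sop_of Q x y u v = 0"
proof -
  have "q_out Q \<le> length x + q_anc Q" using assms(1) unfolding qcirc_wf_iff by simp
  then show ?thesis
    unfolding sop_of_def using assms(2,3) by (auto intro!: sum.neutral simp: amp_length)
qed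

text \<open>The circuit permutes basis states; tracing out the trash \<open>s\<close> and
  \<open>t\<close> keeps the coherence between the two images exactly if they coincide.\<close>

lemma sop_of_classical:
  assumes "qcirc_wf k Q" "list_all classical (q_gates Q)" "length x = k" "length y = k"
    and "fold act (q_gates Q) (x @ zeros (q_anc Q)) = x' @ s" "fold act (q_gates Q) (y @ zeros (q_anc Q)) = y' @ t"
    and "length x' = q_out Q" "length y' = q_out Q" "length u = q_out Q" "length v = q_out Q"
  shows "sop_of Q x y u v = (if u = x' \<and> v = y' \<and> s = t then 1 else 0)"
proof -
  have len: "length (fold act gs w) = length w" for gs w
    by (induction gs arbitrary: w) auto
  have amp: "amp Q x = ket (x' @ s)" "amp Q y = ket (y' @ t)"
    unfolding amp_run using assms by (subst run_classical; simp add: qcirc_wf_iff)+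
  have ls: "length s = k + q_anc Q - q_out Q"
    using len[of "q_gates Q" "x @ zeros (q_anc Q)"] assms by simp
  have "sop_of Q x y u v = (\<Sum>g\<in>words (k + q_anc Q - q_out Q). if g = s then (if u = x' \<and> v = y' \<and> s = t then 1 else 0) else 0)"
    unfolding sop_of_def amp using assms by (intro sum.cong) (auto simp: ket_def)
  then show ?thesis using ls by (simp add: sum.delta)
qed

text \<open>
  \<open>Q\<close> runs on the outputs of \<open>P\<close> except the last \<open>m\<close> ones, which are spectators. Since \<open>Q\<close> needs fresh
  ancillas directly behind its input, the spectators and the trash of \<open>P\<close> are parked at wire \<open>R\<close>,
  and afterwards the trash of \<open>Q\<close> is moved behind them to make room for the spectators.
\<close>

definition then_circ :: "nat \<Rightarrow> qcirc \<Rightarrow> qcirc \<Rightarrow> nat \<Rightarrow> qcirc" where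
  "then_circ k P Q m =
    (let h = q_out P - m; n = k + q_anc P; e = n - h; R = n + q_anc Q; T = h + q_anc Q - q_out Q in
     \<lparr>q_anc = q_anc P + q_anc Q + e + T,
      q_gates = q_gates P @ moves h R e @ q_gates Q @ moves (q_out Q) (R + e) T @ moves R (q_out Q) m,
      q_out = q_out Q + m\<rparr>)"

lemma q_out_then_circ [simp]: "q_out (then_circ k P Q m) = q_out Q + m"
  unfolding then_circ_def Let_def by simp

lemma qcirc_wf_then_circ:
  assumes "qcirc_wf k P" "qcirc_wf (q_out P - m) Q" "m \<le> q_out P"
  shows "qcirc_wf k (then_circ k P Q m)"
  using assms unfolding qcirc_wf_iff then_circ_def Let_def
  by (auto intro!: gates_wf_moves elim!: gates_wf_mono)

lemma run_ket_act:
  "gates_wf (length x) gs \<Longrightarrow> list_all classical gs \<Longrightarrow> fold act gs x = y \<Longrightarrow> run gs (ket x) = ket y"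
  using run_classical by blast

lemma zeros_append: "zeros a @ zeros b @ w = zeros (a + b) @ w"
  by (simp add: replicate_add)

lemma sum_delta2:
  assumes "finite A" "finite B" "a \<in> A" "b \<in> B"
  shows "(\<Sum>u\<in>A. \<Sum>t\<in>B. if u = a then if t = b then c else 0 else 0) = (c :: complex)"
proof -
  have "(\<Sum>t\<in>B. if u = a then if t = b then c else 0 else 0) = (if u = a then c else 0)" for u
    using assms by (cases "u = a") (simp_all add: sum.delta)
  then show ?thesis using assms by (simp add: sum.delta)
qed

text \<open>The wires are outputs \<open>u\<close>, spectators \<open>s\<close>, a block
  \<open>z\<close> that ends up clean, and the trash of \<open>P\<close> and of \<open>Q\<close>.
  Amplitudes multiply along the \<open>h\<close> wires passed from \<open>P\<close> to
  \<open>Q\<close>, as in a matrix product.\<close>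

lemma amp_then_circ:
  assumes P: "qcirc_wf k P" and Q: "qcirc_wf h Q" and x: "length x = k"
    and h: "q_out P = h + m" and len: "length u = q_out Q" "length s = m"
      "length t1 = k + q_anc P - q_out P" "length t2 = h + q_anc Q - q_out Q"
      "length z = k + q_anc P - h + (h + q_anc Q - q_out Q)"
  shows "amp (then_circ k P Q m) x (u @ s @ z @ t1 @ t2) =
    (if z = zeros (length z) then \<Sum>w\<in>words h. amp P x (w @ s @ t1) * amp Q w (u @ t2) else 0)"
proof -
  define n e R T where "n = k + q_anc P" and "e = n - h" and "R = n + q_anc Q" and "T = h + q_anc Q - q_out Q"
  define rest where "rest = moves h R e @ q_gates Q @ moves (q_out Q) (R + e) T @ moves R (q_out Q) m"
  have wf: "q_out P \<le> n" "gates_wf n (q_gates P)" "q_out Q \<le> h + q_anc Q" "gates_wf (h + q_anc Q) (q_gates Q)"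
    using P Q unfolding qcirc_wf_iff n_def by auto
  have ne: "n = h + e" "R = h + q_anc Q + e" "h + q_anc Q = q_out Q + T" "m \<le> e" "e - m = n - q_out P"
    using wf h unfolding e_def R_def T_def by auto
  have circ: "q_gates (then_circ k P Q m) = q_gates P @ rest"
    "q_anc (then_circ k P Q m) = q_anc P + (q_anc Q + e + T)"
    using h unfolding then_circ_def Let_def rest_def n_def e_def R_def T_def by auto
  have rest: "run rest (ket ((w @ s' @ t1') @ zeros (q_anc Q + e + T))) =
      (\<lambda>W. \<Sum>b\<in>words (h + q_anc Q). amp Q w b * ket (take (q_out Q) b @ s' @ zeros (e + T) @ t1' @ drop (q_out Q) b) W)"
    if w: "length w = h" "length s' = m" "length t1' = n - q_out P" for w s' t1'
  proof -
    have l1: "(w @ s' @ t1') @ zeros (q_anc Q + e + T) = w @ (s' @ t1') @ zeros (q_anc Q) @ zeros e @ zeros T"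
      by (simp add: replicate_add)
    have "fold act (moves h R e) (w @ (s' @ t1') @ zeros (q_anc Q) @ zeros e @ zeros T) =
        w @ zeros e @ zeros (q_anc Q) @ (s' @ t1') @ zeros T"
      by (rule act_moves_up) (use w ne in auto)
    \<comment> \<open>The wires vacated by the move and the ancillas of \<open>Q\<close> are all
      zero, so they may be regrouped: \<open>Q\<close> finds its ancillas directly behind
      \<open>w\<close>.\<close>
    also have "\<dots> = (w @ zeros (q_anc Q)) @ (zeros e @ s' @ t1' @ zeros T)"
      by (simp add: zeros_append add.commute)
    finally have 1: "run (moves h R e) (ket ((w @ s' @ t1') @ zeros (q_anc Q + e + T))) =
        ket ((w @ zeros (q_anc Q)) @ (zeros e @ s' @ t1' @ zeros T))"
      unfolding l1 using w ne by (intro run_ket_act) (auto intro!: gates_wf_moves)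
    have 2: "run (q_gates Q) (ket ((w @ zeros (q_anc Q)) @ (zeros e @ s' @ t1' @ zeros T))) =
        (\<lambda>W. \<Sum>b\<in>words (h + q_anc Q). amp Q w b * ket (b @ (zeros e @ s' @ t1' @ zeros T)) W)"
      unfolding amp_run by (rule run_ket_append) (use wf w in auto)
    have 3: "run (moves (q_out Q) (R + e) T @ moves R (q_out Q) m) (ket (b @ (zeros e @ s' @ t1' @ zeros T))) =
        ket (take (q_out Q) b @ s' @ zeros (e + T) @ t1' @ drop (q_out Q) b)" if "length b = h + q_anc Q" for b
    proof -
      define u' t2' where "u' = take (q_out Q) b" and "t2' = drop (q_out Q) b"
      have b: "b = u' @ t2'" "length u' = q_out Q" "length t2' = T"
        using that ne unfolding u'_def t2'_def by auto
      have m1: "fold act (moves (q_out Q) (R + e) T) (u' @ t2' @ (zeros e @ s' @ t1') @ zeros T @ []) =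
          u' @ zeros T @ (zeros e @ s' @ t1') @ t2' @ []"
        by (rule act_moves_up) (use b w ne in auto)
      \<comment> \<open>Since \<open>m \<le> e\<close>, the zero wires behind \<open>u'\<close>
        contain room for the spectators.\<close>
      have m2: "u' @ zeros T @ (zeros e @ s' @ t1') @ t2' @ [] =
          u' @ zeros m @ zeros (T + e - m) @ s' @ (t1' @ t2')"
        using ne by (simp add: zeros_append)
      have m3: "fold act (moves R (q_out Q) m) (u' @ zeros m @ zeros (T + e - m) @ s' @ (t1' @ t2')) =
          u' @ s' @ zeros (T + e - m) @ zeros m @ (t1' @ t2')"
        by (rule act_moves_down) (use b w ne in auto)
      have m4: "u' @ s' @ zeros (T + e - m) @ zeros m @ (t1' @ t2') = u' @ s' @ zeros (e + T) @ t1' @ t2'"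
        using ne by (simp add: zeros_append add.commute)
      have "fold act (moves (q_out Q) (R + e) T @ moves R (q_out Q) m) (b @ (zeros e @ s' @ t1' @ zeros T)) =
          fold act (moves R (q_out Q) m)
            (fold act (moves (q_out Q) (R + e) T) (u' @ t2' @ (zeros e @ s' @ t1') @ zeros T @ []))"
        unfolding b(1) by simp
      also have "\<dots> = u' @ s' @ zeros (e + T) @ t1' @ t2'"
        unfolding m1 m2 m3 m4 ..
      finally have "fold act (moves (q_out Q) (R + e) T @ moves R (q_out Q) m) (b @ (zeros e @ s' @ t1' @ zeros T)) =
          u' @ s' @ zeros (e + T) @ t1' @ t2'" .
      then show ?thesis
        unfolding u'_def t2'_def using that w ne by (intro run_ket_act) (auto intro!: gates_wf_moves)
    qed
    have "run rest (ket ((w @ s' @ t1') @ zeros (q_anc Q + e + T))) =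
        run (moves (q_out Q) (R + e) T @ moves R (q_out Q) m)
          (\<lambda>W. \<Sum>b\<in>words (h + q_anc Q). amp Q w b * ket (b @ (zeros e @ s' @ t1' @ zeros T)) W)"
      unfolding rest_def fold_append comp_apply 1 2 ..
    then show ?thesis unfolding run_sum using 3 by simp
  qed
  have "amp (then_circ k P Q m) x = run rest (run (q_gates P) (ket ((x @ zeros (q_anc P)) @ zeros (q_anc Q + e + T))))"
    unfolding amp_run circ by (simp add: replicate_add)
  also have "run (q_gates P) (ket ((x @ zeros (q_anc P)) @ zeros (q_anc Q + e + T))) =
      (\<lambda>W. \<Sum>a\<in>words n. amp P x a * ket (a @ zeros (q_anc Q + e + T)) W)"
    unfolding amp_run by (rule run_ket_append) (use wf x n_def in auto)
  finally have "amp (then_circ k P Q m) x =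
      (\<lambda>W. \<Sum>a\<in>words n. amp P x a * run rest (ket (a @ zeros (q_anc Q + e + T))) W)"
    unfolding run_sum .
  moreover have "h + (m + (n - q_out P)) = n" using wf h by simp
  then have "(\<Sum>a\<in>words n. f a) = (\<Sum>w\<in>words h. \<Sum>s'\<in>words m. \<Sum>t1'\<in>words (n - q_out P). f (w @ s' @ t1'))"
    for f :: "bits \<Rightarrow> complex"
    using sum_words_add[of f h "m + (n - q_out P)"] by (simp add: sum_words_add)
  ultimately have amp: "amp (then_circ k P Q m) x W = (\<Sum>w\<in>words h. \<Sum>s'\<in>words m. \<Sum>t1'\<in>words (n - q_out P).
      amp P x (w @ s' @ t1') * run rest (ket ((w @ s' @ t1') @ zeros (q_anc Q + e + T))) W)" for W
    by simp
  have lz: "length z = e + T" using len unfolding e_def T_def n_def by simp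
  have inner: "run rest (ket ((w @ s' @ t1') @ zeros (q_anc Q + e + T))) (u @ s @ z @ t1 @ t2) =
      (if s' = s then if t1' = t1 then if z = zeros (e + T) then amp Q w (u @ t2) else 0 else 0 else 0)"
    if w: "length w = h" "length s' = m" "length t1' = n - q_out P" for w s' t1'
  proof -
    have "run rest (ket ((w @ s' @ t1') @ zeros (q_anc Q + e + T))) (u @ s @ z @ t1 @ t2) =
      (\<Sum>u'\<in>words (q_out Q). \<Sum>t2'\<in>words T. amp Q w (u' @ t2') *
        ket (u' @ s' @ zeros (e + T) @ t1' @ t2') (u @ s @ z @ t1 @ t2))"
      unfolding rest[OF w] ne(3) sum_words_add by (intro sum.cong refl) simp
    also have "\<dots> = (\<Sum>u'\<in>words (q_out Q). \<Sum>t2'\<in>words T. if u' = u then if t2' = t2 then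
        (if s' = s then if t1' = t1 then if z = zeros (e + T) then amp Q w (u @ t2) else 0 else 0 else 0) else 0 else 0)"
      using w len lz by (intro sum.cong refl) (auto simp: ket_def n_def)
    also have "\<dots> = (if s' = s then if t1' = t1 then if z = zeros (e + T) then amp Q w (u @ t2) else 0 else 0 else 0)"
      using len unfolding T_def by (subst sum_delta2) auto
    finally show ?thesis .
  qed
  have "amp (then_circ k P Q m) x (u @ s @ z @ t1 @ t2) =
    (\<Sum>w\<in>words h. \<Sum>s'\<in>words m. \<Sum>t1'\<in>words (n - q_out P). if s' = s then if t1' = t1 then
      (if z = zeros (e + T) then amp P x (w @ s @ t1) * amp Q w (u @ t2) else 0) else 0 else 0)"
    unfolding amp by (intro sum.cong refl, subst inner) auto
  also have "\<dots> = (\<Sum>w\<in>words h. if z = zeros (e + T) then amp P x (w @ s @ t1) * amp Q w (u @ t2) else 0)"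
  proof (intro sum.cong refl)
    fix w
    let ?c = "if z = zeros (e + T) then amp P x (w @ s @ t1) * amp Q w (u @ t2) else 0"
    have "(\<Sum>t1'\<in>words (n - q_out P). if s' = s then if t1' = t1 then ?c else 0 else 0) = (if s' = s then ?c else 0)" for s'
      using len unfolding n_def by (cases "s' = s") (simp_all add: sum.delta)
    then show "(\<Sum>s'\<in>words m. \<Sum>t1'\<in>words (n - q_out P). if s' = s then if t1' = t1 then ?c else 0 else 0) = ?c"
      using len by (simp only: sum.delta finite_words) simp
  qed
  finally show ?thesis using lz by simp
qed

text \<open>Turns a partial trace over two independent trash registers into a product of two partial
  traces.\<close>

lemma sum_product_swap:
  fixes f f' :: "'a \<Rightarrow> 'b \<Rightarrow> complex" and q q' :: "'a \<Rightarrow> 'c \<Rightarrow> complex"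
  shows "(\<Sum>s\<in>S. \<Sum>t\<in>T. (\<Sum>w\<in>W. f w s * q w t) * cnj (\<Sum>w\<in>W. f' w s * q' w t)) =
    (\<Sum>w\<in>W. \<Sum>w'\<in>W. (\<Sum>s\<in>S. f w s * cnj (f' w' s)) * (\<Sum>t\<in>T. q w t * cnj (q' w' t)))"
proof -
  have "(\<Sum>s\<in>S. \<Sum>t\<in>T. (\<Sum>w\<in>W. f w s * q w t) * cnj (\<Sum>w\<in>W. f' w s * q' w t)) =
    (\<Sum>s\<in>S. \<Sum>t\<in>T. \<Sum>w\<in>W. \<Sum>w'\<in>W. (f w s * cnj (f' w' s)) * (q w t * cnj (q' w' t)))"
    unfolding cnj_sum sum_product complex_cnj_mult by (simp add: mult_ac)
  also have "\<dots> = (\<Sum>s\<in>S. \<Sum>w\<in>W. \<Sum>t\<in>T. \<Sum>w'\<in>W. (f w s * cnj (f' w' s)) * (q w t * cnj (q' w' t)))"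
    by (intro sum.cong refl sum.swap)
  also have "\<dots> = (\<Sum>w\<in>W. \<Sum>s\<in>S. \<Sum>t\<in>T. \<Sum>w'\<in>W. (f w s * cnj (f' w' s)) * (q w t * cnj (q' w' t)))"
    by (rule sum.swap)
  also have "\<dots> = (\<Sum>w\<in>W. \<Sum>s\<in>S. \<Sum>w'\<in>W. \<Sum>t\<in>T. (f w s * cnj (f' w' s)) * (q w t * cnj (q' w' t)))"
    by (intro sum.cong refl sum.swap)
  also have "\<dots> = (\<Sum>w\<in>W. \<Sum>w'\<in>W. \<Sum>s\<in>S. \<Sum>t\<in>T. (f w s * cnj (f' w' s)) * (q w t * cnj (q' w' t)))"
    by (intro sum.cong refl sum.swap)
  finally show ?thesis unfolding sum_product .
qed

text \<open>Composition law of superoperators, with the spectators passing through. The clean block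
  \<open>z\<close> contributes a single term, and the sums over the trash of \<open>P\<close> and of
  \<open>Q\<close> separate.\<close>

lemma sop_of_then_circ:
  assumes P: "qcirc_wf k P" and Q: "qcirc_wf h Q" and x: "length x = k" "length y = k"
    and h: "q_out P = h + m" and len: "length u = q_out Q" "length v = q_out Q" "length s = m" "length s' = m"
  shows "sop_of (then_circ k P Q m) x y (u @ s) (v @ s') =
    (\<Sum>w\<in>words h. \<Sum>w'\<in>words h. sop_of P x y (w @ s) (w' @ s') * sop_of Q w w' u v)"
proof -
  define Z where "Z = k + q_anc P - h + (h + q_anc Q - q_out Q)"
  define n1 where "n1 = k + q_anc P - q_out P"
  define n2 where "n2 = h + q_anc Q - q_out Q"
  have "q_out P \<le> k + q_anc P" "q_out Q \<le> h + q_anc Q" using P Q unfolding qcirc_wf_iff by auto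
  then have "k + q_anc (then_circ k P Q m) - q_out (then_circ k P Q m) = Z + (n1 + n2)"
    using h unfolding then_circ_def Let_def Z_def n1_def n2_def by simp
  then have "sop_of (then_circ k P Q m) x y (u @ s) (v @ s') =
    (\<Sum>z\<in>words Z. \<Sum>t1\<in>words n1. \<Sum>t2\<in>words n2.
      amp (then_circ k P Q m) x (u @ s @ z @ t1 @ t2) * cnj (amp (then_circ k P Q m) y (v @ s' @ z @ t1 @ t2)))"
    unfolding sop_of_def x by (simp add: sum_words_add)
  also have "\<dots> = (\<Sum>z\<in>words Z. if z = zeros Z then \<Sum>t1\<in>words n1. \<Sum>t2\<in>words n2.
      (\<Sum>w\<in>words h. amp P x (w @ s @ t1) * amp Q w (u @ t2)) *
      cnj (\<Sum>w\<in>words h. amp P y (w @ s' @ t1) * amp Q w (v @ t2)) else 0)"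
  proof (intro sum.cong refl)
    fix z assume z: "z \<in> words Z"
    have amp: "amp (then_circ k P Q m) x (u @ s @ z @ t1 @ t2) =
        (if z = zeros Z then \<Sum>w\<in>words h. amp P x (w @ s @ t1) * amp Q w (u @ t2) else 0)"
      "amp (then_circ k P Q m) y (v @ s' @ z @ t1 @ t2) =
        (if z = zeros Z then \<Sum>w\<in>words h. amp P y (w @ s' @ t1) * amp Q w (v @ t2) else 0)"
      if "t1 \<in> words n1" "t2 \<in> words n2" for t1 t2
      using amp_then_circ[OF P Q x(1) h len(1,3), of t1 t2 z] amp_then_circ[OF P Q x(2) h len(2,4), of t1 t2 z] that z
      by (auto simp: Z_def n1_def n2_def)
    show "(\<Sum>t1\<in>words n1. \<Sum>t2\<in>words n2. amp (then_circ k P Q m) x (u @ s @ z @ t1 @ t2) *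
        cnj (amp (then_circ k P Q m) y (v @ s' @ z @ t1 @ t2))) =
      (if z = zeros Z then \<Sum>t1\<in>words n1. \<Sum>t2\<in>words n2.
        (\<Sum>w\<in>words h. amp P x (w @ s @ t1) * amp Q w (u @ t2)) *
        cnj (\<Sum>w\<in>words h. amp P y (w @ s' @ t1) * amp Q w (v @ t2)) else 0)"
      using amp by (cases "z = zeros Z") (simp_all del: words_iff)
  qed
  also have "\<dots> = (\<Sum>t1\<in>words n1. \<Sum>t2\<in>words n2.
      (\<Sum>w\<in>words h. amp P x (w @ s @ t1) * amp Q w (u @ t2)) *
      cnj (\<Sum>w\<in>words h. amp P y (w @ s' @ t1) * amp Q w (v @ t2)))"
    by (simp add: sum.delta)
  also have "\<dots> = (\<Sum>w\<in>words h. \<Sum>w'\<in>words h. sop_of P x y (w @ s) (w' @ s') * sop_of Q w w' u v)"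
    unfolding sum_product_swap by (intro sum.cong refl) (use x in \<open>simp add: sop_of_def n1_def n2_def\<close>)
  finally show ?thesis .
qed

text \<open>Exchanges adjacent blocks of lengths \<open>a\<close> and \<open>b\<close> behind the
  first \<open>o'\<close> wires: both are moved out together and return in the opposite order. The
  \<open>o' + a + b\<close> padding wires before the parking place keep the circuit well-formed for
  every \<open>k\<close>, even if the blocks exceed the input.\<close>

definition rot_circ :: "nat \<Rightarrow> nat \<Rightarrow> nat \<Rightarrow> nat \<Rightarrow> qcirc" where
  "rot_circ k o' a b =
    (let K = k + (o' + a + b) in
     \<lparr>q_anc = o' + a + b + (a + b), q_gates = moves o' K (a + b) @ moves K (o' + b) a @ moves (K + a) o' b, q_out = k\<rparr>)"

definition rot :: "nat \<Rightarrow> nat \<Rightarrow> nat \<Rightarrow> bits \<Rightarrow> bits" where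
  "rot o' a b w = take o' w @ take b (drop (o' + a) w) @ take a (drop o' w) @ drop (o' + a + b) w"

lemma rot_append:
  "length p = o' \<Longrightarrow> length x = a \<Longrightarrow> length y = b \<Longrightarrow> rot o' a b (p @ x @ y @ z) = p @ y @ x @ z"
  unfolding rot_def by simp

lemma split3:
  assumes "o' + a + b \<le> length w"
  obtains p x y z where "w = p @ x @ y @ z" "length p = o'" "length x = a" "length y = b"
proof -
  have "w = take o' w @ take a (drop o' w) @ take b (drop (o' + a) w) @ drop (o' + a + b) w"
    by (metis append_take_drop_id drop_drop add.commute)
  with assms that show ?thesis by fastforce
qed

lemma length_rot: "o' + a + b \<le> length w \<Longrightarrow> length (rot o' a b w) = length w"
  and rot_rot: "o' + a + b \<le> length w \<Longrightarrow> rot o' b a (rot o' a b w) = w"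
  by (elim split3; simp add: rot_append)+

lemma q_out_rot_circ [simp]: "q_out (rot_circ k o' a b) = k"
  unfolding rot_circ_def Let_def by simp

lemma qcirc_wf_rot_circ: "qcirc_wf k (rot_circ k o' a b)"
  unfolding qcirc_wf_iff rot_circ_def Let_def by (auto intro!: gates_wf_moves)

lemma sop_of_rot_circ:
  assumes "o' + a + b \<le> k" "length x = k" "length y = k" "length u = k" "length v = k"
  shows "sop_of (rot_circ k o' a b) x y u v = (if u = rot o' a b x \<and> v = rot o' a b y then 1 else 0)"
proof -
  let ?Q = "rot_circ k o' a b"
  have act: "fold act (q_gates ?Q) (w @ zeros (q_anc ?Q)) = rot o' a b w @ zeros (q_anc ?Q)" if lw: "length w = k" for w
  proof -
    obtain p x y z where w: "w = p @ x @ y @ z" "length p = o'" "length x = a" "length y = b"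
      by (rule split3[of o' a b w]) (use lw assms(1) in auto)
    let ?K = "k + (o' + a + b)"
    have lz: "length z + (o' + a + b) = k" using w lw by simp
    have l1: "w @ zeros (q_anc ?Q) = p @ (x @ y) @ (z @ zeros (o' + a + b)) @ zeros (a + b) @ []"
      unfolding w(1) rot_circ_def Let_def qcirc.simps by (simp only: replicate_add append_assoc append_Nil2)
    have 1: "fold act (moves o' ?K (a + b)) (p @ (x @ y) @ (z @ zeros (o' + a + b)) @ zeros (a + b) @ [])
       = p @ zeros (a + b) @ (z @ zeros (o' + a + b)) @ (x @ y) @ []"
      by (rule act_moves_up) (use w lz in auto)
    have l2: "p @ zeros (a + b) @ (z @ zeros (o' + a + b)) @ (x @ y) @ [] =
       (p @ zeros b) @ zeros a @ (z @ zeros (o' + a + b)) @ x @ y"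
      by (simp add: zeros_append add.commute)
    have 2: "fold act (moves ?K (o' + b) a) ((p @ zeros b) @ zeros a @ (z @ zeros (o' + a + b)) @ x @ y) =
       (p @ zeros b) @ x @ (z @ zeros (o' + a + b)) @ zeros a @ y"
      by (rule act_moves_down) (use w lz in auto)
    have l3: "(p @ zeros b) @ x @ (z @ zeros (o' + a + b)) @ zeros a @ y =
       p @ zeros b @ (x @ z @ zeros (o' + a + b) @ zeros a) @ y @ []" by simp
    have 3: "fold act (moves (?K + a) o' b) (p @ zeros b @ (x @ z @ zeros (o' + a + b) @ zeros a) @ y @ []) =
       p @ y @ (x @ z @ zeros (o' + a + b) @ zeros a) @ zeros b @ []"
      by (rule act_moves_down) (use w lz in auto)
    have "fold act (q_gates ?Q) (w @ zeros (q_anc ?Q)) =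
       p @ y @ (x @ z @ zeros (o' + a + b) @ zeros a) @ zeros b @ []"
      unfolding l1 by (simp only: rot_circ_def Let_def qcirc.simps fold_append comp_apply 1 l2 2 l3 3)
    then show ?thesis
      unfolding w(1) using w(2-) by (simp add: rot_append rot_circ_def Let_def replicate_add)
  qed
  show ?thesis
    by (subst sop_of_classical[OF qcirc_wf_rot_circ _ assms(2,3) act act])
      (use assms in \<open>auto simp: length_rot rot_circ_def Let_def\<close>)
qed

text \<open>Copies in the computational basis, meant for classical registers. The minimum keeps the
  circuit well-formed when the block would exceed the input.\<close>

definition dup_circ :: "nat \<Rightarrow> nat \<Rightarrow> nat \<Rightarrow> qcirc" where
  "dup_circ k s a = (let a' = min a (k - s) in \<lparr>q_anc = a', q_gates = cxs 1 s k a', q_out = k + a'\<rparr>)"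

lemma q_out_dup_circ: "q_out (dup_circ k s a) = k + min a (k - s)"
  unfolding dup_circ_def Let_def by simp

lemma qcirc_wf_dup_circ: "qcirc_wf k (dup_circ k s a)"
proof (cases "s \<le> k")
  case True
  then show ?thesis unfolding qcirc_wf_iff dup_circ_def Let_def by (auto intro!: gates_wf_cxs)
qed (simp add: qcirc_wf_iff dup_circ_def cxs_def)

lemma sop_of_dup_circ:
  assumes "s + a \<le> k" "length x = k" "length y = k" "length u = k + a" "length v = k + a"
  shows "sop_of (dup_circ k s a) x y u v =
    (if u = x @ take a (drop s x) \<and> v = y @ take a (drop s y) then 1 else 0)"
proof -
  have a: "min a (k - s) = a" using assms(1) by simp
  have act: "fold act (q_gates (dup_circ k s a)) (w @ zeros (q_anc (dup_circ k s a))) = (w @ take a (drop s w)) @ []"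
    if "length w = k" for w
  proof -
    have w: "w = take s w @ take a (drop s w) @ drop (s + a) w"
      by (metis append_take_drop_id drop_drop add.commute)
    have "fold act (cxs 1 s k a) (take s w @ take a (drop s w) @ drop (s + a) w @ zeros a @ []) =
        take s w @ take a (drop s w) @ drop (s + a) w @ xor (zeros a) (take a (drop s w)) @ []"
      by (rule act_cxs_up) (use that assms(1) in auto)
    also have "xor (zeros a) (take a (drop s w)) = take a (drop s w)"
      using that assms(1) by simp
    finally have "fold act (cxs 1 s k a) (w @ zeros a) = w @ take a (drop s w)"
      using w by (metis append.assoc append_Nil2)
    then show ?thesis unfolding dup_circ_def Let_def a by simp
  qed
  show ?thesis
    by (subst sop_of_classical[OF qcirc_wf_dup_circ _ assms(2,3) act act])
      (use assms in \<open>auto simp: dup_circ_def Let_def\<close>)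
qed

text \<open>
  Here \<open>f\<close> is the description of the fixed part of a circuit; the gate \<open>Const b\<close> of a hard-wired key
  bit is encoded as \<open>[False, b]\<close>, so the key bits go to the odd wires.
\<close>

definition enc_circ :: "nat \<Rightarrow> bits \<Rightarrow> qcirc" where
  "enc_circ k f = (let S = 2 * k + length f in
    \<lparr>q_anc = S, q_gates = moves 0 S k @ cxs 2 S 1 k @ xors (2 * k) f, q_out = S\<rparr>)"

lemma q_out_enc_circ [simp]: "q_out (enc_circ k f) = 2 * k + length f"
  unfolding enc_circ_def Let_def by simp

lemma classical_xors: "list_all classical (xors a w)"
  unfolding xors_def list_all_iff by auto

lemma gates_wf_xors: "a + length w \<le> n \<Longrightarrow> gates_wf n (xors a w)"
  unfolding gates_wf_def xors_def by auto

lemma qcirc_wf_enc_circ: "qcirc_wf k (enc_circ k f)"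
  unfolding qcirc_wf_iff enc_circ_def Let_def
  by (auto intro!: gates_wf_moves gates_wf_xors gates_wf_cxs)

lemma xors_Cons: "xors a (b # w) = (if b then [GX a] else []) @ xors (Suc a) w"
  unfolding xors_def length_Cons map_upt_Suc concat.simps
  by (simp only: nth_Cons_0 nth_Cons_Suc add_Suc add_Suc_right add_0_right)

lemma act_xors: "a = length p \<Longrightarrow> fold act (xors a w) (p @ zeros (length w) @ s) = p @ w @ s"
proof (induction w arbitrary: p a)
  case Nil then show ?case by (simp add: xors_def)
next
  case (Cons b w)
  have "fold act (if b then [GX a] else []) (p @ zeros (length (b # w)) @ s) = (p @ [b]) @ zeros (length w) @ s"
    using Cons.prems by (simp add: nth_append list_update_append)
  then show ?case using Cons.IH[of "Suc a" "p @ [b]"] Cons.prems by (cases b) (simp_all add: xors_Cons)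
qed

text \<open>The bit of a constant gate is the second bit of its encoding, hence targets start one
  wire behind \<open>p\<close>.\<close>

lemma act_cxs2:
  "b = Suc (length p) \<Longrightarrow> a = length p + 2 * length x + length m \<Longrightarrow> n = length x \<Longrightarrow>
    fold act (cxs 2 a b n) (p @ zeros (2 * n) @ m @ x @ s) = p @ enc_bcirc (map Const x) @ m @ x @ s"
proof (induction x arbitrary: p m a b n)
  case Nil then show ?case by (simp add: cxs_def)
next
  case (Cons x0 x)
  have "act (GCX a b) (p @ zeros (2 * n) @ m @ (x0 # x) @ s) =
      (p @ [False, x0]) @ zeros (2 * length x) @ (m @ [x0]) @ x @ s"
    using Cons.prems by (simp add: nth_append list_update_append)
  then show ?case
    using Cons.IH[of "b + 2" "p @ [False, x0]" "Suc a" "m @ [x0]" "length x"] Cons.prems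
    by (simp add: cxs_Suc)
qed

text \<open>Stated for a diagonal input: \<open>x\<close> itself stays behind as trash, so the
  circuit measures its input, which is a classical key wherever it is used.\<close>

lemma sop_of_enc_circ:
  assumes "length x = k" "length u = 2 * k + length f" "length v = 2 * k + length f"
    and f: "f = enc_bcirc F"
  shows "sop_of (enc_circ k f) x x u v =
    (if u = enc_bcirc (hardwire x F) \<and> v = enc_bcirc (hardwire x F) then 1 else 0)"
proof -
  let ?S = "2 * k + length f"
  have len: "length (enc_bcirc (map Const x)) = 2 * k"
    unfolding assms(1)[symmetric] by (induction x) auto
  have l0: "x @ zeros ?S = [] @ x @ zeros (k + length f) @ zeros k @ []"
  proof -
    have "zeros ?S = zeros ((k + length f) + k)" by (rule arg_cong[of _ _ zeros]) simp
    then show ?thesis by (simp only: replicate_add append_Nil append_Nil2)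
  qed
  have 1: "fold act (moves 0 ?S k) ([] @ x @ zeros (k + length f) @ zeros k @ []) =
      [] @ zeros k @ zeros (k + length f) @ x @ []"
    by (rule act_moves_up) (use assms in auto)
  have l1: "[] @ zeros k @ zeros (k + length f) @ x @ [] = [] @ zeros (2 * k) @ zeros (length f) @ x @ []"
    by (simp add: zeros_append mult_2 add.assoc)
  have 2: "fold act (cxs 2 ?S 1 k) ([] @ zeros (2 * k) @ zeros (length f) @ x @ []) =
      [] @ enc_bcirc (map Const x) @ zeros (length f) @ x @ []"
    by (rule act_cxs2) (use assms in auto)
  have 3: "fold act (xors (2 * k) f) (enc_bcirc (map Const x) @ zeros (length f) @ x) =
      enc_bcirc (map Const x) @ f @ x"
    by (rule act_xors) (simp add: len)
  have act: "fold act (q_gates (enc_circ k f)) (x @ zeros (q_anc (enc_circ k f))) = enc_bcirc (hardwire x F) @ x"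
    unfolding enc_circ_def Let_def qcirc.simps l0 fold_append comp_apply 1 l1 2
    using 3 by (simp add: hardwire_def f)
  show ?thesis
    by (subst sop_of_classical[OF qcirc_wf_enc_circ _ assms(1,1) act act])
      (use assms len in \<open>auto simp: classical_xors enc_circ_def Let_def hardwire_def\<close>)
qed

text \<open>The wires of \<open>C\<close>, and thus its input, stay in the traced out register: the circuit measures its input.\<close>

definition bool_circ :: "nat \<Rightarrow> nat \<Rightarrow> bcirc \<Rightarrow> qcirc" where
  "bool_circ inp out C = (let n = inp + length C in
    \<lparr>q_anc = Suc n + n, q_gates = codes inp n C @ moves 0 (Suc n) n @ cxs 1 (Suc n + n - out) 0 out, q_out = out\<rparr>)"

lemma q_out_bool_circ [simp]: "q_out (bool_circ inp out C) = out"
  unfolding bool_circ_def Let_def by simp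

lemma gates_wf_codes:
  "(\<forall>j < length C. gate_wf (p + j) (C ! j)) \<Longrightarrow> p + length C \<le> s \<Longrightarrow> s < N \<Longrightarrow> gates_wf N (codes p s C)"
proof (induction C arbitrary: p)
  case (Cons g C)
  have g: "gate_wf p g" using Cons.prems(1)[rule_format, of 0] by simp
  have "\<forall>j < length C. gate_wf (Suc p + j) (C ! j)" using Cons.prems(1) by force
  then have "gates_wf N (codes (Suc p) s C)" using Cons by simp
  moreover have "gates_wf N (gate_code p s g)" using g Cons.prems by (cases g) auto
  ultimately show ?case by simp
qed simp

lemma classical_codes: "list_all classical (codes p s C)"
proof (induction C arbitrary: p)
  case (Cons g C) then show ?case by (cases g) auto
qed simp

lemma bcirc_wf_le: "bcirc_wf inp out C \<Longrightarrow> out \<le> inp + length C"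
  unfolding bcirc_wf_def by simp

lemma qcirc_wf_bool_circ: "bcirc_wf inp out C \<Longrightarrow> qcirc_wf k (bool_circ inp out C)"
  unfolding qcirc_wf_iff bool_circ_def Let_def bcirc_wf_def
  by (auto intro!: gates_wf_moves gates_wf_codes gates_wf_cxs)

lemma length_wires: "length (wires C x) = length x + length C"
  unfolding wires_def by (induction C arbitrary: x) auto

lemma wires_Cons: "wires (g # C) x = wires C (x @ [gate_value x g])"
  unfolding wires_def by simp

lemma take_wires: "take (length x) (wires C x) = x"
proof (induction C arbitrary: x)
  case (Cons g C)
  have "take (length x) (wires (g # C) x) = take (length x) (take (length (x @ [gate_value x g])) (wires C (x @ [gate_value x g])))"
    unfolding wires_Cons by (simp add: min_def)
  also have "\<dots> = x" unfolding Cons.IH by simp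
  finally show ?case .
qed (simp add: wires_def)

lemma act_gate_code:
  assumes "gate_wf p g" "length w = p" "p < s" "s < Suc p + length r" "r ! (s - Suc p) = False"
  shows "fold act (gate_code p s g) (w @ False # r) = w @ gate_value w g # r"
proof (cases g)
  case (Const b)
  then show ?thesis using assms by (auto simp: list_update_append)
next
  case (Nand i j)
  define q where "q = s - Suc p"
  have s: "s = Suc (p + q)" "q < length r" using assms unfolding q_def by auto
  show ?thesis
    using assms s Nand
    by (auto simp: list_update_append nth_append nth_Cons' list_update_same_conv split: nat.splits)
qed

lemma act_codes:
  assumes "\<forall>j < length C. gate_wf (p + j) (C ! j)" "length w = p" "p + length C \<le> s"
    "s < p + length C + length r" "r ! (s - (p + length C)) = False"
  shows "fold act (codes p s C) (w @ zeros (length C) @ r) = wires C w @ r"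
  using assms
proof (induction C arbitrary: p w)
  case Nil then show ?case by (simp add: wires_def)
next
  case (Cons g C)
  have g: "gate_wf p g" using Cons.prems(1)[rule_format, of 0] by simp
  have "fold act (gate_code p s g) (w @ zeros (length (g # C)) @ r) = fold act (gate_code p s g) (w @ False # (zeros (length C) @ r))"
    by simp
  also have "\<dots> = w @ gate_value w g # (zeros (length C) @ r)"
    by (rule act_gate_code[OF g]) (use Cons.prems in \<open>auto simp: nth_append\<close>)
  also have "\<dots> = (w @ [gate_value w g]) @ zeros (length C) @ r" by simp
  finally have 1: "fold act (gate_code p s g) (w @ zeros (length (g # C)) @ r) = \<dots>" .
  have wf: "\<forall>j < length C. gate_wf (Suc p + j) (C ! j)" using Cons.prems(1) by force
  have 2: "fold act (codes (Suc p) s C) ((w @ [gate_value w g]) @ zeros (length C) @ r) = wires C (w @ [gate_value w g]) @ r"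
    by (rule Cons.IH[OF wf]) (use Cons.prems in auto)
  show ?case unfolding codes.simps fold_append comp_apply 1 2 wires_Cons ..
qed

text \<open>Wire \<open>?n\<close> is the scratch wire of the NAND codes. All wires of
  \<open>C\<close> are moved behind it, and the last \<open>out\<close> of them are copied to the
  front.\<close>

lemma sop_of_bool_circ:
  assumes C: "bcirc_wf inp out C" and "length x = inp" "length y = inp" "length u = out" "length v = out"
  shows "sop_of (bool_circ inp out C) x y u v =
    (if x = y \<and> u = beval out C x \<and> v = beval out C x then 1 else 0)"
proof -
  let ?n = "inp + length C" and ?Q = "bool_circ inp out C"
  have out: "out \<le> ?n" using C by (rule bcirc_wf_le)
  have act: "fold act (q_gates ?Q) (w @ zeros (q_anc ?Q)) =
      beval out C w @ zeros (Suc ?n - out) @ wires C w @ zeros inp" if w: "length w = inp" for w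
  proof -
    let ?W = "wires C w"
    have lW: "length ?W = ?n" using w by (simp add: length_wires)
    have l0: "w @ zeros (Suc ?n + ?n) = w @ zeros (length C) @ (zeros 1 @ zeros ?n @ zeros inp)"
    proof -
      have "zeros (Suc ?n + ?n) = zeros (length C + (1 + (?n + inp)))" by (rule arg_cong[of _ _ zeros]) simp
      then show ?thesis by (simp only: replicate_add)
    qed
    have 1: "fold act (codes inp ?n C) (w @ zeros (length C) @ (zeros 1 @ zeros ?n @ zeros inp)) =
        ?W @ (zeros 1 @ zeros ?n @ zeros inp)"
      by (rule act_codes) (use C w in \<open>auto simp: bcirc_wf_def\<close>)
    have 2: "fold act (moves 0 (Suc ?n) ?n) ([] @ ?W @ zeros 1 @ zeros ?n @ zeros inp) =
        [] @ zeros ?n @ zeros 1 @ ?W @ zeros inp"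
      by (rule act_moves_up) (use lW in auto)
    have l2: "zeros ?n @ zeros 1 @ ?W @ zeros inp =
        zeros out @ (zeros (Suc ?n - out) @ take (?n - out) ?W) @ drop (?n - out) ?W @ zeros inp"
      using out by (simp add: zeros_append del: replicate_Suc)
    have 3: "fold act (cxs 1 (Suc ?n + ?n - out) 0 out)
        ([] @ zeros out @ (zeros (Suc ?n - out) @ take (?n - out) ?W) @ drop (?n - out) ?W @ zeros inp) =
        [] @ xor (zeros out) (drop (?n - out) ?W) @ (zeros (Suc ?n - out) @ take (?n - out) ?W) @ drop (?n - out) ?W @ zeros inp"
      by (rule act_cxs_down) (use lW out in auto)
    have "xor (zeros out) (drop (?n - out) ?W) = beval out C w"
      using lW out unfolding beval_def by simp
    then have "fold act (q_gates ?Q) (w @ zeros (q_anc ?Q)) =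
        [] @ beval out C w @ (zeros (Suc ?n - out) @ take (?n - out) ?W) @ drop (?n - out) ?W @ zeros inp"
      by (simp only: bool_circ_def Let_def qcirc.simps fold_append comp_apply l0 1 2[unfolded append_Nil] l2 3[unfolded append_Nil])
        simp
    then show ?thesis by simp
  qed
  have len: "length (beval out C w) = out" if "length w = inp" for w
    using out that unfolding beval_def by (simp add: length_wires)
  \<comment> \<open>The input is a prefix of the trash, so equal trash forces equal inputs; this
    makes all off-diagonal entries vanish.\<close>
  have "wires C x = wires C y \<longleftrightarrow> x = y" using take_wires assms(2,3) by metis
  then show ?thesis
    by (subst sop_of_classical[OF qcirc_wf_bool_circ[OF C] _ assms(2,3) act act])
      (use assms len in \<open>auto simp: classical_codes bool_circ_def Let_def\<close>)
qed

text \<open>Formulated for words longer than \<open>n\<close>, because in the induction the first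
  gates act on amplitudes that also have wires not yet reached.\<close>

lemma run_hadamards:
  "n \<le> length w \<Longrightarrow> run (hadamards n) (ket (zeros (length w))) w =
    (if drop n w = zeros (length w - n) then (1 / complex_of_real (sqrt 2)) ^ n else 0)"
proof (induction n arbitrary: w)
  case 0 then show ?case by (simp add: hadamards_def ket_def)
next
  case (Suc n)
  then have n: "n < length w" by simp
  have e: "hadamards (Suc n) = hadamards n @ [GH n]" unfolding hadamards_def by simp
  have d: "drop n (w[n := b]) = b # drop (Suc n) w" for b
    using n by (metis Cons_nth_drop_Suc drop_update_cancel length_list_update lessI nth_list_update_eq)
  have z: "zeros (length w - n) = False # zeros (length w - Suc n)"
    using n by (metis Suc_diff_Suc replicate_Suc)
  have "run (hadamards n) (ket (zeros (length w))) (w[n := b]) =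
      (if b = False \<and> drop (Suc n) w = zeros (length w - Suc n) then (1 / complex_of_real (sqrt 2)) ^ n else 0)" for b
    using Suc.IH[of "w[n := b]"] n by (auto simp: d z)
  then show ?case unfolding e by simp
qed

definition had_circ :: "nat \<Rightarrow> qcirc" where
  "had_circ n = \<lparr>q_anc = n, q_gates = hadamards n, q_out = n\<rparr>"

lemma q_out_had_circ [simp]: "q_out (had_circ n) = n"
  unfolding had_circ_def by simp

lemma qcirc_wf_had_circ: "qcirc_wf k (had_circ n)"
  unfolding qcirc_wf_iff had_circ_def hadamards_def gates_wf_def by auto

text \<open>All entries are equal, also off the diagonal: this is a pure superposition, which turns
  into uniform coins only when \<open>bool_circ\<close> measures it.\<close>

lemma sop_of_had_circ:
  assumes "length u = n" "length v = n"
  shows "sop_of (had_circ n) [] [] u v = 1 / 2 ^ n"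
proof -
  have "amp (had_circ n) [] w = (1 / complex_of_real (sqrt 2)) ^ n" if "length w = n" for w
    using run_hadamards[of n w] that unfolding amp_run had_circ_def by simp
  moreover have "(1 / complex_of_real (sqrt 2)) ^ n * cnj ((1 / complex_of_real (sqrt 2)) ^ n) = 1 / 2 ^ n"
  proof -
    have "(1 / complex_of_real (sqrt 2)) * cnj (1 / complex_of_real (sqrt 2)) = 1 / 2"
      by (simp flip: of_real_mult)
    moreover have "(1 / complex_of_real (sqrt 2)) ^ n * cnj ((1 / complex_of_real (sqrt 2)) ^ n) =
        ((1 / complex_of_real (sqrt 2)) * cnj (1 / complex_of_real (sqrt 2))) ^ n"
      by (simp only: complex_cnj_power power_mult_distrib)
    ultimately have "(1 / complex_of_real (sqrt 2)) ^ n * cnj ((1 / complex_of_real (sqrt 2)) ^ n) = (1 / 2) ^ n"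
      by (simp only:)
    then show ?thesis by (simp only: power_divide power_one)
  qed
  ultimately show ?thesis
    unfolding sop_of_def using assms by (simp add: had_circ_def)
qed

text \<open>Declaring fewer outputs means tracing out the others.\<close>

lemma sop_of_trunc:
  assumes "o' \<le> q_out Q" "q_out Q \<le> length x + q_anc Q"
  shows "sop_of (Q\<lparr>q_out := o'\<rparr>) x y u v = (\<Sum>g\<in>words (q_out Q - o'). sop_of Q x y (u @ g) (v @ g))"
proof -
  have "length x + q_anc Q - o' = (q_out Q - o') + (length x + q_anc Q - q_out Q)" using assms by simp
  moreover have "amp (Q\<lparr>q_out := o'\<rparr>) = amp Q" unfolding amp_def by simp
  ultimately show ?thesis unfolding sop_of_def by (simp add: sum_words_add)
qed

section \<open>Uniform families and the circuits of the reduction\<close>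

abbreviation uniform_circ :: "(nat \<Rightarrow> nat \<Rightarrow> qcirc) \<Rightarrow> bool" where
  "uniform_circ Q \<equiv> polytime (\<lambda>l k. enc_qcirc (Q l k))"

lemma polytime_moves:
  assumes "pnat a" "pnat b" "pnat n"
  shows "polytime (\<lambda>l k. enc_gates (moves (a l k) (b l k) (n l k)))"
  unfolding moves_def enc_gates_append by (intro polytime_append polytime_cxs assms)

lemma uniform_then_circ:
  assumes P: "uniform_circ P" and Q: "uniform_circ Q" and w: "pnat w" and m: "pnat m"
  shows "uniform_circ (\<lambda>l k. then_circ (w l k) (P l k) (Q l k) (m l k))"
  unfolding then_circ_def Let_def
  by (rule polytime_enc_qcircI; simp only: qcirc.simps enc_gates_append)
    (intro pnat_add pnat_diff polytime_append polytime_moves w m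
      polytime_enc_qcirc_parts[OF P] polytime_enc_qcirc_parts[OF Q])+

lemma uniform_rot_circ:
  assumes "pnat w" "pnat o'" "pnat a" "pnat b"
  shows "uniform_circ (\<lambda>l k. rot_circ (w l k) (o' l k) (a l k) (b l k))"
  unfolding rot_circ_def Let_def
  by (rule polytime_enc_qcircI; simp only: qcirc.simps enc_gates_append)
    (intro pnat_add polytime_append polytime_moves assms)+

lemma uniform_dup_circ:
  assumes "pnat w" "pnat s" "pnat a"
  shows "uniform_circ (\<lambda>l k. dup_circ (w l k) (s l k) (a l k))"
  unfolding dup_circ_def Let_def
  by (rule polytime_enc_qcircI; simp only: qcirc.simps enc_gates_append)
    (intro pnat_add pnat_diff pnat_min polytime_cxs assms)+

lemma uniform_enc_circ:
  assumes "pnat w" "polytime f"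
  shows "uniform_circ (\<lambda>l k. enc_circ (w l k) (f l k))"
  unfolding enc_circ_def Let_def mult_2
  by (rule polytime_enc_qcircI; simp only: qcirc.simps enc_gates_append)
    (intro pnat_add pnat_length pnat_const polytime_append polytime_cxs polytime_moves polytime_xors assms)+

lemma uniform_bool_circ:
  assumes "pnat inp" "pnat out" "polytime (\<lambda>l k. enc_bcirc (C l k))"
  shows "uniform_circ (\<lambda>l k. bool_circ (inp l k) (out l k) (C l k))"
  unfolding bool_circ_def Let_def Suc_eq_plus1
  by (rule polytime_enc_qcircI; simp only: qcirc.simps enc_gates_append)
    (intro pnat_add pnat_diff pnat_const pnat_length_bcirc polytime_append polytime_cxs polytime_moves
      polytime_codes assms)+

lemma uniform_had_circ:
  assumes "pnat n" shows "uniform_circ (\<lambda>l k. had_circ (n l k))"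
  unfolding had_circ_def
  by (rule polytime_enc_qcircI; simp only: qcirc.simps) (intro polytime_hadamards assms)+

lemma uniform_trunc:
  assumes "uniform_circ Q" "pnat n" shows "uniform_circ (\<lambda>l k. (Q l k)\<lparr>q_out := n l k\<rparr>)"
  by (rule polytime_enc_qcircI) (simp_all add: polytime_enc_qcirc_parts[OF assms(1)] assms(2))

lemma uniform_subst:
  assumes "uniform_circ Q" "pnat w" shows "uniform_circ (\<lambda>l k. Q l (w l k))"
  using polytime_subst[OF assms(1) pnat_fst assms(2)] .

text \<open>The matrix unit \<open>|x><y|\<close> is sent to \<open>|x'><y'|\<close>. Pairs are
  followed instead of single basis states, because a quantum register next to the classical ones
  carries coherences between \<open>x\<close> and \<open>y\<close>.\<close>

definition maps_pair :: "qcirc \<Rightarrow> bits \<Rightarrow> bits \<Rightarrow> bits \<Rightarrow> bits \<Rightarrow> bool" where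
  "maps_pair Q x y x' y' \<longleftrightarrow> length y = length x \<and> length x' = q_out Q \<and> length y' = q_out Q \<and>
     (\<forall>u v. length u = q_out Q \<longrightarrow> length v = q_out Q \<longrightarrow>
        sop_of Q x y u v = (if u = x' \<and> v = y' then 1 else 0))"

lemma sum_words_delta_pair:
  assumes "length a = h" "length b = h"
  shows "(\<Sum>w\<in>words h. \<Sum>w'\<in>words h. (if w = a \<and> w' = b then 1 else 0) * f w w') = (f a b :: complex)"
proof -
  have "(\<Sum>w\<in>words h. \<Sum>w'\<in>words h. (if w = a \<and> w' = b then 1 else 0) * f w w') =
      (\<Sum>w\<in>words h. \<Sum>w'\<in>words h. if w = a then if w' = b then f a b else 0 else 0)"
    by (intro sum.cong refl) auto
  then show ?thesis using assms by (simp add: sum_delta2)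
qed

text \<open>Behind a circuit that merely relabels the matrix unit, composition degenerates to
  evaluating \<open>Q\<close> at the images, with the spectators pinned.\<close>

lemma sop_of_then_circ_maps_pair:
  assumes "qcirc_wf k P" "qcirc_wf h Q" "length x = k" "maps_pair P x y (w @ s) (w' @ s')"
    "q_out P = h + m" "length w = h" "length w' = h"
    "length u = q_out Q" "length v = q_out Q" "length t = m" "length t' = m"
  shows "sop_of (then_circ k P Q m) x y (u @ t) (v @ t') =
    (if t = s \<and> t' = s' then sop_of Q w w' u v else 0)"
proof -
  have y: "length y = k" using assms unfolding maps_pair_def by simp
  have "sop_of (then_circ k P Q m) x y (u @ t) (v @ t') =
    (\<Sum>a\<in>words h. \<Sum>b\<in>words h. sop_of P x y (a @ t) (b @ t') * sop_of Q a b u v)"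
    by (rule sop_of_then_circ) (use assms y in auto)
  also have "\<dots> = (\<Sum>a\<in>words h. \<Sum>b\<in>words h. (if a = w \<and> b = w' then 1 else 0) *
      (if t = s \<and> t' = s' then sop_of Q a b u v else 0))"
    using assms by (intro sum.cong refl) (auto simp: maps_pair_def)
  finally show ?thesis using assms by (simp add: sum_words_delta_pair)
qed

lemma maps_pair_then_circ:
  assumes "qcirc_wf k P" "qcirc_wf h Q" "length x = k" "maps_pair P x y (w @ s) (w' @ s')"
    "q_out P = h + m" "length w = h" "length w' = h" "maps_pair Q w w' w1 w1'" "length s = m" "length s' = m"
  shows "maps_pair (then_circ k P Q m) x y (w1 @ s) (w1' @ s')"
proof -
  have "sop_of (then_circ k P Q m) x y u v = (if u = w1 @ s \<and> v = w1' @ s' then 1 else 0)"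
    if "length u = q_out Q + m" "length v = q_out Q + m" for u v
  proof -
    define a t b t' where "a = take (q_out Q) u" and "t = drop (q_out Q) u"
      and "b = take (q_out Q) v" and "t' = drop (q_out Q) v"
    have uv: "u = a @ t" "v = b @ t'" "length a = q_out Q" "length b = q_out Q" "length t = m" "length t' = m"
      using that unfolding a_def b_def t_def t'_def by auto
    show ?thesis
      unfolding uv(1,2) by (subst sop_of_then_circ_maps_pair[OF assms(1-7)])
        (use uv assms in \<open>auto simp: maps_pair_def\<close>)
  qed
  then show ?thesis using assms unfolding maps_pair_def by simp
qed

lemma maps_pair_then_circ0:
  assumes "qcirc_wf k P" "qcirc_wf h Q" "length x = k" "maps_pair P x y w w'"
    "q_out P = h" "maps_pair Q w w' w1 w1'"
  shows "maps_pair (then_circ k P Q 0) x y w1 w1'"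
  using maps_pair_then_circ[of k P h Q x y w "[]" w' "[]" 0 w1 w1'] assms by (simp add: maps_pair_def)

lemma maps_pair_rot_circ:
  assumes "o' + a + b \<le> k" "length x = k" "length y = k"
  shows "maps_pair (rot_circ k o' a b) x y (rot o' a b x) (rot o' a b y)"
  using assms unfolding maps_pair_def by (simp add: sop_of_rot_circ length_rot)

lemma maps_pair_dup_circ:
  assumes "s + a \<le> k" "length x = k" "length y = k"
  shows "maps_pair (dup_circ k s a) x y (x @ take a (drop s x)) (y @ take a (drop s y))"
  using assms unfolding maps_pair_def by (auto simp: sop_of_dup_circ q_out_dup_circ min_absorb1)

lemma maps_pair_enc_circ:
  assumes "length x = k" "f = enc_bcirc F"
  shows "maps_pair (enc_circ k f) x x (enc_bcirc (hardwire x F)) (enc_bcirc (hardwire x F))"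
proof -
  have "length (enc_bcirc (map Const x)) = 2 * length x" by (induction x) auto
  then show ?thesis
    using assms unfolding maps_pair_def by (auto simp: sop_of_enc_circ hardwire_def)
qed

lemma sop_of_then_rot_circ:
  assumes "qcirc_wf k P" "length x = k" "length y = k" "q_out P = w" "o' + a + b \<le> w"
    "length u = w" "length v = w"
  shows "sop_of (then_circ k P (rot_circ w o' a b) 0) x y u v = sop_of P x y (rot o' b a u) (rot o' b a v)"
proof -
  have iff: "u = rot o' a b c \<longleftrightarrow> c = rot o' b a u" if "length c = w" "length u = w" for c u
    using rot_rot[of o' a b c] rot_rot[of o' b a u] that assms(5) by auto
  have "sop_of (then_circ k P (rot_circ w o' a b) 0) x y (u @ []) (v @ []) =
    (\<Sum>c\<in>words w. \<Sum>d\<in>words w. sop_of P x y (c @ []) (d @ []) * sop_of (rot_circ w o' a b) c d u v)"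
    by (rule sop_of_then_circ) (use assms in \<open>auto simp: qcirc_wf_rot_circ\<close>)
  also have "\<dots> = (\<Sum>c\<in>words w. \<Sum>d\<in>words w. (if c = rot o' b a u \<and> d = rot o' b a v then 1 else 0) * sop_of P x y c d)"
    using assms iff by (intro sum.cong refl) (auto simp: sop_of_rot_circ)
  finally show ?thesis using assms by (simp add: sum_words_delta_pair length_rot)
qed

text \<open>\<open>bool_circ\<close> measures, so only diagonal entries of the intermediate state
  survive.\<close>

lemma sop_of_then_bool_circ:
  assumes "qcirc_wf k P" "bcirc_wf w out C" "length x = k" "length y = k" "q_out P = w"
    "length u = out" "length v = out"
  shows "sop_of (then_circ k P (bool_circ w out C) 0) x y u v =
    (\<Sum>c\<in>words w. if u = beval out C c \<and> v = beval out C c then sop_of P x y c c else 0)"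
proof -
  have "sop_of (then_circ k P (bool_circ w out C) 0) x y (u @ []) (v @ []) =
    (\<Sum>c\<in>words w. \<Sum>d\<in>words w. sop_of P x y (c @ []) (d @ []) * sop_of (bool_circ w out C) c d u v)"
    by (rule sop_of_then_circ) (use assms in \<open>auto simp: qcirc_wf_bool_circ\<close>)
  also have "\<dots> = (\<Sum>c\<in>words w. \<Sum>d\<in>words w.
      if d = c then (if u = beval out C c \<and> v = beval out C c then sop_of P x y c c else 0) else 0)"
    using assms by (intro sum.cong refl) (auto simp: sop_of_bool_circ)
  finally show ?thesis by (simp add: sum.delta)
qed

section \<open>Circuits of the scheme and of the adversaries\<close>

definition qkeygen_circ :: "qalg \<Rightarrow> nat \<Rightarrow> nat \<Rightarrow> bits \<Rightarrow> qcirc" where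
  "qkeygen_circ Obf l k f = then_circ k (enc_circ k f) (Obf l (2 * k + length f)) 0"

definition gen_circ :: "nat \<Rightarrow> nat \<Rightarrow> bcirc \<Rightarrow> qcirc" where
  "gen_circ c out C = then_circ 0 (had_circ c) (bool_circ c out C) 0"

text \<open>
  With \<open>vk\<close> of length \<open>n\<close>, registers evolve as \<open>vk \<rho> \<rightarrow> \<rho> vk vk vk \<rightarrow> \<sigma>\<^sub>B \<sigma>\<^sub>C vk vk \<rightarrow> vk \<sigma>\<^sub>B vk \<sigma>\<^sub>C\<close>,
  where \<open>A\<close> turns \<open>\<rho> vk\<close> into \<open>\<sigma>\<^sub>B \<sigma>\<^sub>C\<close>.
\<close>

definition split_circ :: "nat \<Rightarrow> nat \<Rightarrow> nat \<Rightarrow> qcirc \<Rightarrow> qcirc" where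
  "split_circ k n a A = (let o' = q_out A in
     then_circ k
       (then_circ k
         (then_circ k
           (then_circ k (then_circ k (dup_circ k 0 n) (dup_circ (k + n) 0 n) 0)
             (rot_circ (k + n + n) 0 n (k - n)) 0)
           A (n + n))
         (rot_circ (o' + n + n) 0 o' n) 0)
       (rot_circ (o' + n + n) (n + a) (o' - a) n) 0)"

text \<open>
  \<open>m vk \<sigma> \<rightarrow> m \<sigma> vk m \<rightarrow> sig vk m \<rightarrow> vk m sig\<close>; the final NAND negates the verdict, as an accepted
  signature indicates the challenge bit 0.
\<close>

definition verify_circ :: "nat \<Rightarrow> nat \<Rightarrow> nat \<Rightarrow> nat \<Rightarrow> bcirc \<Rightarrow> qcirc \<Rightarrow> qcirc" where
  "verify_circ k mu n w V B = (let s = q_out B in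
     then_circ k
       (then_circ k
         (then_circ k
           (then_circ k (rot_circ k mu n (k - mu - n)) (dup_circ k 0 mu) 0)
           B (n + mu))
         (rot_circ (s + (n + mu)) 0 s (n + mu)) 0)
       (bool_circ w 1 (V @ [Nand (w + length V - 1) (w + length V - 1)])) 0)"

text \<open>
  \<open>m vk pk \<rightarrow> pk vk m \<rightarrow> \<rho> vk m \<rightarrow> \<sigma>\<^sub>B \<sigma>\<^sub>C m\<close>, where \<open>\<rho>\<close> is the obfuscation of the punctured circuit; the
  forger below continues with \<open>m \<sigma>\<^sub>B\<close>.
\<close>

definition pirate_circ :: "nat \<Rightarrow> nat \<Rightarrow> nat \<Rightarrow> bits \<Rightarrow> qcirc \<Rightarrow> qcirc \<Rightarrow> qcirc" where
  "pirate_circ k mu n f O' A = (let p = k - mu - n in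
     then_circ k
       (then_circ k
         (then_circ k
           (then_circ k (rot_circ k 0 mu (n + p)) (rot_circ k 0 n p) 0)
           (enc_circ p f) (n + mu))
         O' (n + mu))
       A mu)"

definition forge_circ :: "nat \<Rightarrow> nat \<Rightarrow> nat \<Rightarrow> bits \<Rightarrow> qcirc \<Rightarrow> qcirc \<Rightarrow> nat \<Rightarrow> qcirc \<Rightarrow> qcirc" where
  "forge_circ k mu n f O' A a B = (let w = q_out A in
     (then_circ k
       (then_circ k (pirate_circ k mu n f O' A) (rot_circ (w + mu) 0 w mu) 0)
       B (w - a))\<lparr>q_out := q_out B\<rparr>)"

lemma sop_of_qkeygen_circ:
  assumes O: "qcirc_wf (2 * k + length f) (Obf l (2 * k + length f))" and f: "f = enc_bcirc F"
    and x: "length x = k"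
  shows "sop_of (qkeygen_circ Obf l k f) x x =
    sop_of (Obf l (2 * k + length f)) (enc_bcirc (hardwire x F)) (enc_bcirc (hardwire x F))"
    (is "_ = sop_of ?O ?e ?e")
proof (intro ext)
  fix u v
  have q: "q_out (qkeygen_circ Obf l k f) = q_out ?O" unfolding qkeygen_circ_def by simp
  have m: "maps_pair (enc_circ k f) x x (?e @ []) (?e @ [])" using maps_pair_enc_circ[OF x f] by simp
  then have le: "length ?e = 2 * k + length f" unfolding maps_pair_def by simp
  have wf: "qcirc_wf k (qkeygen_circ Obf l k f)"
    unfolding qkeygen_circ_def by (rule qcirc_wf_then_circ) (use O in \<open>auto simp: qcirc_wf_enc_circ\<close>)
  show "sop_of (qkeygen_circ Obf l k f) x x u v = sop_of ?O ?e ?e u v"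
  proof (cases "length u = q_out ?O \<and> length v = q_out ?O")
    case True
    then show ?thesis
      using sop_of_then_circ_maps_pair[OF qcirc_wf_enc_circ O x m _ le le, of 0 u v "[]" "[]"]
      unfolding qkeygen_circ_def by simp
  next
    \<comment> \<open>At words of the wrong length both superoperators vanish, so the equation holds
      between functions and not only on valid arguments.\<close>
    case False
    then show ?thesis
      using sop_of_length[of x "qkeygen_circ Obf l k f" x u v] sop_of_length[of ?e ?O ?e u v] wf O x le
      by (simp add: q)
  qed
qed

lemma sop_of_gen_circ:
  assumes C: "bcirc_wf c out C" and "length u = out" "length v = out"
  shows "sop_of (gen_circ c out C) [] [] u v =
    (if u = v then (\<Sum>r\<in>words c. if u = beval out C r then 1 / 2 ^ c else 0) else 0)"
  unfolding gen_circ_def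
  by (subst sop_of_then_bool_circ[OF qcirc_wf_had_circ C])
    (use assms in \<open>auto simp: sop_of_had_circ intro!: sum.cong sum.neutral\<close>)

lemma qcirc_wf_rot_circ': "k = w \<Longrightarrow> qcirc_wf k (rot_circ w o' a b)"
  and qcirc_wf_enc_circ': "k = w \<Longrightarrow> qcirc_wf k (enc_circ w f)"
  by (simp_all add: qcirc_wf_rot_circ qcirc_wf_enc_circ)

lemma sum_if_const: "(\<Sum>x\<in>A. if P then f x else 0) = (if P then sum f A else (0::complex))"
  by simp

lemma qcirc_wf_split_circ:
  assumes "n \<le> k" "qcirc_wf k A" "a \<le> q_out A"
  shows "qcirc_wf k (split_circ k n a A)"
  unfolding split_circ_def Let_def
  by (intro qcirc_wf_then_circ)
    (use assms in \<open>auto intro!: qcirc_wf_rot_circ' simp: qcirc_wf_dup_circ q_out_dup_circ min_absorb1\<close>)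

lemma q_out_split_circ: "q_out (split_circ k n a A) = q_out A + n + n"
  unfolding split_circ_def Let_def by simp

lemma qcirc_wf_verify_circ:
  assumes "mu + n \<le> k" "qcirc_wf (k - n) B" "bcirc_wf w 1 V" "1 \<le> w + length V"
  shows "qcirc_wf k (verify_circ k mu n w V B)"
proof -
  have "bcirc_wf w 1 (V @ [Nand (w + length V - 1) (w + length V - 1)])"
    using assms(3,4) unfolding bcirc_wf_def by (auto simp: nth_append less_Suc_eq)
  then show ?thesis
    unfolding verify_circ_def Let_def
    by (intro qcirc_wf_then_circ)
      (use assms in \<open>auto simp: qcirc_wf_dup_circ qcirc_wf_rot_circ qcirc_wf_bool_circ q_out_dup_circ min_absorb1\<close>)
qed

lemma q_out_verify_circ: "q_out (verify_circ k mu n w V B) = 1"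
  unfolding verify_circ_def Let_def by simp

lemma qcirc_wf_pirate_circ:
  assumes "mu + n \<le> k" "qcirc_wf (2 * (k - mu - n) + length f) O'" "qcirc_wf (q_out O' + n) A"
  shows "qcirc_wf k (pirate_circ k mu n f O' A)"
  unfolding pirate_circ_def Let_def
  by (intro qcirc_wf_then_circ)
    (use assms in \<open>auto intro!: qcirc_wf_rot_circ' qcirc_wf_enc_circ'\<close>)

lemma q_out_pirate_circ [simp]: "q_out (pirate_circ k mu n f O' A) = q_out A + mu"
  unfolding pirate_circ_def Let_def by simp

lemma qcirc_wf_trunc: "qcirc_wf k Q \<Longrightarrow> n \<le> q_out Q \<Longrightarrow> qcirc_wf k (Q\<lparr>q_out := n\<rparr>)"
  unfolding qcirc_wf_def by simp

lemma qcirc_wf_forge_circ: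
  assumes "qcirc_wf k (pirate_circ k mu n f O' A)" "a \<le> q_out A" "qcirc_wf (mu + a) B"
  shows "qcirc_wf k (forge_circ k mu n f O' A a B)"
  unfolding forge_circ_def Let_def
  by (intro qcirc_wf_trunc qcirc_wf_then_circ)
    (use assms in \<open>auto simp: qcirc_wf_rot_circ add.commute\<close>)

lemma q_out_forge_circ [simp]: "q_out (forge_circ k mu n f O' A a B) = q_out B"
  unfolding forge_circ_def Let_def by simp

lemma rot_append0: "length x = a \<Longrightarrow> length y = b \<Longrightarrow> rot 0 a b (x @ y @ z) = y @ x @ z"
  using rot_append[of "[]" 0] by simp

lemma rot_append0': "length x = a \<Longrightarrow> length y = b \<Longrightarrow> rot 0 a b (x @ y) = y @ x"
  using rot_append0[of x a y b "[]"] by simp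

text \<open>\<open>A\<close> consumes one copy of \<open>vk\<close>, the other two are its
  spectators and end up in front of the two registers. Only \<open>vk\<close> is classical here, so
  row and column index carry different \<open>x\<close> and \<open>y\<close>.\<close>

lemma sop_of_split_circ:
  assumes n: "n \<le> k" and A: "qcirc_wf k A" "a \<le> q_out A" and vk: "length vk = n"
    and x: "length x = k - n" "length y = k - n"
    and v: "length v1 = n" "length v2 = n" "length v3 = n" "length v4 = n"
    and u: "length uB = a" "length vB = a" "length uC = q_out A - a" "length vC = q_out A - a"
  shows "sop_of (split_circ k n a A) (vk @ x) (vk @ y) (v1 @ uB @ v2 @ uC) (v3 @ vB @ v4 @ vC) =
    (if v1 = vk \<and> v2 = vk \<and> v3 = vk \<and> v4 = vk then sop_of A (x @ vk) (y @ vk) (uB @ uC) (vB @ vC) else 0)"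
proof -
  let ?o = "q_out A"
  define P1 where "P1 = then_circ k (dup_circ k 0 n) (dup_circ (k + n) 0 n) 0"
  define P2 where "P2 = then_circ k P1 (rot_circ (k + n + n) 0 n (k - n)) 0"
  define P3 where "P3 = then_circ k P2 A (n + n)"
  define P4 where "P4 = then_circ k P3 (rot_circ (?o + n + n) 0 ?o n) 0"
  have qd: "q_out (dup_circ k 0 n) = k + n" "q_out (dup_circ (k + n) 0 n) = k + n + n"
    using n by (auto simp: q_out_dup_circ min_absorb1)
  have q: "q_out P1 = k + n + n" "q_out P2 = k + n + n" "q_out P3 = ?o + n + n" "q_out P4 = ?o + n + n"
    unfolding P1_def P2_def P3_def P4_def by (simp_all add: qd)
  have wf1: "qcirc_wf k P1" unfolding P1_def by (rule qcirc_wf_then_circ) (auto simp: qcirc_wf_dup_circ qd)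
  have wf2: "qcirc_wf k P2" unfolding P2_def by (rule qcirc_wf_then_circ) (auto simp: wf1 q qcirc_wf_rot_circ)
  have wf3: "qcirc_wf k P3" unfolding P3_def by (rule qcirc_wf_then_circ) (auto simp: wf2 q A)
  have wf4: "qcirc_wf k P4" unfolding P4_def by (rule qcirc_wf_then_circ) (auto simp: wf3 q qcirc_wf_rot_circ)
  have m1: "maps_pair (dup_circ k 0 n) (vk @ x) (vk @ y) (vk @ x @ vk) (vk @ y @ vk)"
    using maps_pair_dup_circ[of 0 n k "vk @ x" "vk @ y"] n vk x by simp
  have m2: "maps_pair (dup_circ (k + n) 0 n) (vk @ x @ vk) (vk @ y @ vk) (vk @ x @ vk @ vk) (vk @ y @ vk @ vk)"
    using maps_pair_dup_circ[of 0 n "k + n" "vk @ x @ vk" "vk @ y @ vk"] n vk x by simp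
  have m3: "maps_pair P1 (vk @ x) (vk @ y) (vk @ x @ vk @ vk) (vk @ y @ vk @ vk)"
    unfolding P1_def
    by (rule maps_pair_then_circ0[OF qcirc_wf_dup_circ qcirc_wf_dup_circ _ m1 _ m2]) (use n vk x qd in auto)
  have m4: "maps_pair (rot_circ (k + n + n) 0 n (k - n)) (vk @ x @ vk @ vk) (vk @ y @ vk @ vk)
      (x @ vk @ vk @ vk) (y @ vk @ vk @ vk)"
    using maps_pair_rot_circ[of 0 n "k - n" "k + n + n" "vk @ x @ vk @ vk" "vk @ y @ vk @ vk"] n vk x
    by (simp add: rot_append0)
  have m5: "maps_pair P2 (vk @ x) (vk @ y) ((x @ vk) @ (vk @ vk)) ((y @ vk) @ (vk @ vk))"
    unfolding P2_def append_assoc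
    by (rule maps_pair_then_circ0[OF wf1 qcirc_wf_rot_circ _ m3 _ m4]) (use n vk x q in auto)
  have s3: "sop_of P3 (vk @ x) (vk @ y) (u @ t) (v @ t') =
      (if t = vk @ vk \<and> t' = vk @ vk then sop_of A (x @ vk) (y @ vk) u v else 0)"
    if "length u = ?o" "length v = ?o" "length t = n + n" "length t' = n + n" for u v t t'
    unfolding P3_def
    by (rule sop_of_then_circ_maps_pair[OF wf2 A(1) _ m5]) (use n vk x q that in auto)
  have s4: "sop_of P4 (vk @ x) (vk @ y) (v1 @ u @ v2) (v3 @ w @ v4) =
      sop_of P3 (vk @ x) (vk @ y) (u @ v1 @ v2) (w @ v3 @ v4)"
    if "length u = ?o" "length w = ?o" for u w
    unfolding P4_def
    by (subst sop_of_then_rot_circ[OF wf3]) (use n vk x q v that in \<open>auto simp: rot_append0\<close>)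
  have "sop_of (split_circ k n a A) (vk @ x) (vk @ y) (v1 @ uB @ v2 @ uC) (v3 @ vB @ v4 @ vC) =
      sop_of P4 (vk @ x) (vk @ y) (rot (n + a) n (?o - a) ((v1 @ uB) @ v2 @ uC @ []))
        (rot (n + a) n (?o - a) ((v3 @ vB) @ v4 @ vC @ []))"
    unfolding split_circ_def Let_def P1_def[symmetric] P2_def[symmetric] P3_def[symmetric] P4_def[symmetric]
    by (subst sop_of_then_rot_circ[OF wf4]) (use n vk x q v u A in auto)
  also have "\<dots> = sop_of P4 (vk @ x) (vk @ y) (v1 @ (uB @ uC) @ v2) (v3 @ (vB @ vC) @ v4)"
    by (subst (1 2) rot_append) (use u v in auto)
  also have "\<dots> = sop_of P3 (vk @ x) (vk @ y) ((uB @ uC) @ v1 @ v2) ((vB @ vC) @ v3 @ v4)"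
    by (rule s4) (use u A in auto)
  also have "\<dots> = (if v1 @ v2 = vk @ vk \<and> v3 @ v4 = vk @ vk then sop_of A (x @ vk) (y @ vk) (uB @ uC) (vB @ vC) else 0)"
    by (rule s3) (use u v A in auto)
  finally show ?thesis using v vk by simp
qed

lemma length_beval: "bcirc_wf inp out C \<Longrightarrow> length w = inp \<Longrightarrow> length (beval out C w) = out"
  unfolding beval_def bcirc_wf_def by (simp add: length_wires)

text \<open>NAND of a wire with itself is negation, and a one-bit output is the last wire.\<close>

lemma beval_not:
  assumes "bcirc_wf w 1 V" "length c = w"
  shows "beval 1 (V @ [Nand (w + length V - 1) (w + length V - 1)]) c = [beval 1 V c \<noteq> [True]]"
proof -
  let ?W = "wires V c"
  have l: "length ?W = w + length V" using assms(2) by (simp add: length_wires)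
  have "1 \<le> w + length V" using assms(1) unfolding bcirc_wf_def by simp
  then have "beval 1 V c = [?W ! (w + length V - 1)]"
    using Cons_nth_drop_Suc[of "w + length V - 1" ?W] l unfolding beval_def by simp
  moreover have "wires (V @ [Nand (w + length V - 1) (w + length V - 1)]) c =
      ?W @ [\<not> ?W ! (w + length V - 1)]" unfolding wires_def by simp
  ultimately show ?thesis unfolding beval_def by simp
qed

text \<open>\<open>B\<close> consumes its message while verification needs it again, hence the
  duplicate kept as a spectator. Measuring the verdict sums over all signatures that lead to
  it.\<close>

lemma sop_of_verify_circ:
  assumes k: "k = mu + n + p" and B: "qcirc_wf (mu + p) B" and V: "bcirc_wf (n + mu + q_out B) 1 V"
    and x: "length m = mu" "length vk = n" "length x = p" "length y = p"
  shows "sop_of (verify_circ k mu n (n + mu + q_out B) V B) (m @ vk @ x) (m @ vk @ y) [b] [b] =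
    (\<Sum>\<sigma>\<in>{\<sigma> \<in> words (q_out B). (beval 1 V (vk @ m @ \<sigma>) = [True]) = (\<not> b)}. sop_of B (m @ x) (m @ y) \<sigma> \<sigma>)"
proof -
  let ?s = "q_out B" and ?w = "n + mu + q_out B"
  define P1 where "P1 = then_circ k (rot_circ k mu n (k - mu - n)) (dup_circ k 0 mu) 0"
  define P2 where "P2 = then_circ k P1 B (n + mu)"
  define P3 where "P3 = then_circ k P2 (rot_circ (?s + (n + mu)) 0 ?s (n + mu)) 0"
  have qd: "q_out (dup_circ k 0 mu) = k + mu" using k by (auto simp: q_out_dup_circ min_absorb1)
  have q: "q_out P1 = k + mu" "q_out P2 = ?s + (n + mu)" "q_out P3 = ?s + (n + mu)"
    unfolding P1_def P2_def P3_def by (simp_all add: qd)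
  have wf1: "qcirc_wf k P1" unfolding P1_def by (rule qcirc_wf_then_circ) (auto simp: qcirc_wf_dup_circ qcirc_wf_rot_circ)
  have wf2: "qcirc_wf k P2" 
  proof -
    have "k + mu - (n + mu) = mu + p" using k by simp
    with B k show ?thesis unfolding P2_def by (intro qcirc_wf_then_circ wf1) (simp_all add: q)
  qed
  have wf3: "qcirc_wf k P3" unfolding P3_def by (rule qcirc_wf_then_circ) (auto simp: wf2 q qcirc_wf_rot_circ)
  have m1: "maps_pair (rot_circ k mu n (k - mu - n)) (m @ vk @ x) (m @ vk @ y) (m @ x @ vk) (m @ y @ vk)"
    using maps_pair_rot_circ[of mu n p k "m @ vk @ x" "m @ vk @ y"] x k
      rot_append[of m mu vk n x p "[]"] rot_append[of m mu vk n y p "[]"] by simp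
  have m2: "maps_pair (dup_circ k 0 mu) (m @ x @ vk) (m @ y @ vk) (m @ x @ vk @ m) (m @ y @ vk @ m)"
    using maps_pair_dup_circ[of 0 mu k "m @ x @ vk" "m @ y @ vk"] x k by simp
  have m3: "maps_pair P1 (m @ vk @ x) (m @ vk @ y) ((m @ x) @ (vk @ m)) ((m @ y) @ (vk @ m))"
    unfolding P1_def append_assoc
    by (rule maps_pair_then_circ0[OF qcirc_wf_rot_circ qcirc_wf_dup_circ _ m1 _ m2]) (use x k in auto)
  have s2: "sop_of P2 (m @ vk @ x) (m @ vk @ y) (u @ t) (v @ t') =
      (if t = vk @ m \<and> t' = vk @ m then sop_of B (m @ x) (m @ y) u v else 0)"
    if "length u = ?s" "length v = ?s" "length t = n + mu" "length t' = n + mu" for u v t t'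
    unfolding P2_def
    by (rule sop_of_then_circ_maps_pair[OF wf1 B _ m3]) (use x k q that in auto)
  have s3: "sop_of P3 (m @ vk @ x) (m @ vk @ y) (t @ u) (t @ u) =
      (if t = vk @ m then sop_of B (m @ x) (m @ y) u u else 0)"
    if "length u = ?s" "length t = n + mu" for u t
    unfolding P3_def
    by (subst sop_of_then_rot_circ[OF wf2]) (use x k q that in \<open>auto simp: rot_append0' s2\<close>)
  have s3': "sop_of P3 (m @ vk @ x) (m @ vk @ y) (vk @ m @ u) (vk @ m @ u) = sop_of B (m @ x) (m @ y) u u"
    if "length u = ?s" for u
    using s3[of u "vk @ m"] x that by simp
  let ?V = "V @ [Nand (?w + length V - 1) (?w + length V - 1)]"
  have V': "bcirc_wf ?w 1 ?V"
    using V unfolding bcirc_wf_def by (auto simp: nth_append less_Suc_eq)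
  have "sop_of (verify_circ k mu n ?w V B) (m @ vk @ x) (m @ vk @ y) [b] [b] =
    (\<Sum>c\<in>words ?w. if [b] = beval 1 ?V c \<and> [b] = beval 1 ?V c then sop_of P3 (m @ vk @ x) (m @ vk @ y) c c else 0)"
    unfolding verify_circ_def Let_def P1_def[symmetric] P2_def[symmetric] P3_def[symmetric]
    by (rule sop_of_then_bool_circ[OF wf3 V']) (use x k q in auto)
  also have "\<dots> = (\<Sum>t\<in>words (n + mu). \<Sum>u\<in>words ?s. if (beval 1 V (t @ u) = [True]) = (\<not> b)
      then sop_of P3 (m @ vk @ x) (m @ vk @ y) (t @ u) (t @ u) else 0)"
    unfolding sum_words_add[where m = "n + mu"]
    by (intro sum.cong refl, subst (1 2) beval_not[OF V]) auto
  \<comment> \<open>The spectators still hold \<open>vk\<close> and \<open>m\<close>, so other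
    prefixes contribute 0.\<close>
  also have "\<dots> = (\<Sum>t\<in>words (n + mu). if t = vk @ m then \<Sum>u\<in>words ?s. if (beval 1 V (vk @ m @ u) = [True]) = (\<not> b)
      then sop_of B (m @ x) (m @ y) u u else 0 else 0)"
    by (intro sum.cong refl) (auto simp: s3 s3' intro!: sum.cong sum.neutral)
  also have "\<dots> = (\<Sum>u\<in>words ?s. if (beval 1 V (vk @ m @ u) = [True]) = (\<not> b) then sop_of B (m @ x) (m @ y) u u else 0)"
    using x by (simp add: sum.delta)
  finally show ?thesis unfolding sum.inter_filter[OF finite_words] .
qed

lemma sop_of_pirate_circ:
  assumes k: "k = mu + n + p" and O: "qcirc_wf (2 * p + length f) O'" and A: "qcirc_wf (q_out O' + n) A"
    and f: "f = enc_bcirc F" and x: "length m = mu" "length vk = n" "length pk = p"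
    and u: "length u = q_out A" "length v = q_out A" "length t = mu" "length t' = mu"
  shows "sop_of (pirate_circ k mu n f O' A) (m @ vk @ pk) (m @ vk @ pk) (u @ t) (v @ t') =
    (if t = m \<and> t' = m then
       sop_apply (q_out O' + n) (sop_of A) (qop_tensor (q_out O')
         (sop_of O' (enc_bcirc (hardwire pk F)) (enc_bcirc (hardwire pk F))) (basis_state vk)) u v
     else 0)"
proof -
  let ?e = "enc_bcirc (hardwire pk F)" and ?q = "q_out O'"
  define P1 where "P1 = then_circ k (rot_circ k 0 mu (n + p)) (rot_circ k 0 n p) 0"
  define P2 where "P2 = then_circ k P1 (enc_circ p f) (n + mu)"
  define P3 where "P3 = then_circ k P2 O' (n + mu)"
  have p: "k - mu - n = p" using k by simp
  have q: "q_out P1 = k" "q_out P2 = 2 * p + length f + (n + mu)" "q_out P3 = ?q + (n + mu)"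
    unfolding P1_def P2_def P3_def by simp_all
  have wf1: "qcirc_wf k P1" unfolding P1_def by (rule qcirc_wf_then_circ) (auto simp: qcirc_wf_rot_circ)
  have wf2: "qcirc_wf k P2" 
  proof -
    have "k - (n + mu) = p" using k by simp
    with k show ?thesis unfolding P2_def by (intro qcirc_wf_then_circ wf1) (simp_all add: q qcirc_wf_enc_circ)
  qed
  have wf3: "qcirc_wf k P3" unfolding P3_def by (rule qcirc_wf_then_circ) (auto simp: wf2 q O)
  let ?X = "m @ vk @ pk"
  have m1: "maps_pair (rot_circ k 0 mu (n + p)) ?X ?X ((vk @ pk) @ m) ((vk @ pk) @ m)"
    using maps_pair_rot_circ[of 0 mu "n + p" k ?X ?X] x k rot_append0'[of m mu "vk @ pk" "n + p"] by simp
  have m2: "maps_pair (rot_circ k 0 n p) ((vk @ pk) @ m) ((vk @ pk) @ m) (pk @ vk @ m) (pk @ vk @ m)"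
    using maps_pair_rot_circ[of 0 n p k "(vk @ pk) @ m" "(vk @ pk) @ m"] x k by (simp add: rot_append0)
  have m3: "maps_pair P1 ?X ?X (pk @ (vk @ m)) (pk @ (vk @ m))"
    unfolding P1_def
    by (rule maps_pair_then_circ0[OF qcirc_wf_rot_circ qcirc_wf_rot_circ _ m1 _ m2]) (use x k in auto)
  have m4: "maps_pair (enc_circ p f) pk pk ?e ?e" by (rule maps_pair_enc_circ[OF x(3) f])
  then have le: "length ?e = 2 * p + length f" unfolding maps_pair_def by simp
  have m5: "maps_pair P2 ?X ?X (?e @ (vk @ m)) (?e @ (vk @ m))"
    unfolding P2_def
    by (rule maps_pair_then_circ[OF wf1 qcirc_wf_enc_circ _ m3 _ _ _ m4]) (use x k q in auto)
  have s3: "sop_of P3 ?X ?X (u @ t) (v @ t') = (if t = vk @ m \<and> t' = vk @ m then sop_of O' ?e ?e u v else 0)"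
    if "length u = ?q" "length v = ?q" "length t = n + mu" "length t' = n + mu" for u v t t'
    unfolding P3_def
    by (rule sop_of_then_circ_maps_pair[OF wf2 O _ m5]) (use x k q le that in auto)
  have "sop_of (pirate_circ k mu n f O' A) ?X ?X (u @ t) (v @ t') =
      (\<Sum>w\<in>words (?q + n). \<Sum>w'\<in>words (?q + n). sop_of P3 ?X ?X (w @ t) (w' @ t') * sop_of A w w' u v)"
    unfolding pirate_circ_def Let_def p P1_def[symmetric] P2_def[symmetric] P3_def[symmetric]
    by (rule sop_of_then_circ[OF wf3 A]) (use x k u q in auto)
  also have "\<dots> = (\<Sum>w\<in>words (?q + n). \<Sum>w'\<in>words (?q + n). if t = m \<and> t' = m then
      sop_of A w w' u v * qop_tensor ?q (sop_of O' ?e ?e) (basis_state vk) w w' else 0)"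
  proof (intro sum.cong refl)
    fix w w' :: bits assume w: "w \<in> words (?q + n)" "w' \<in> words (?q + n)"
    define a c a' c' where "a = take ?q w" and "c = drop ?q w" and "a' = take ?q w'" and "c' = drop ?q w'"
    have e: "w = a @ c" "w' = a' @ c'" "length a = ?q" "length a' = ?q" "length c = n" "length c' = n"
      using w unfolding a_def a'_def c_def c'_def by auto
    have "sop_of P3 ?X ?X (a @ (c @ t)) (a' @ (c' @ t')) = (if c @ t = vk @ m \<and> c' @ t' = vk @ m then sop_of O' ?e ?e a a' else 0)"
      by (rule s3) (use e u in auto)
    then show "sop_of P3 ?X ?X (w @ t) (w' @ t') * sop_of A w w' u v = (if t = m \<and> t' = m then
      sop_of A w w' u v * qop_tensor ?q (sop_of O' ?e ?e) (basis_state vk) w w' else 0)"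
      using e u x by (auto simp: qop_tensor_def basis_state_def)
  qed
  finally show ?thesis unfolding sop_apply_def by auto
qed

text \<open>Keeping only the output of \<open>B\<close> traces out the second register of the pirate
  state, visible as the common suffix \<open>c\<close>.\<close>

lemma sop_of_forge_circ:
  assumes k: "k = mu + n + p" and O: "qcirc_wf (2 * p + length f) O'" and A: "qcirc_wf (q_out O' + n) A" "a \<le> q_out A"
    and B: "qcirc_wf (mu + a) B"
    and f: "f = enc_bcirc F" and x: "length m = mu" "length vk = n" "length pk = p" and s: "length s = q_out B"
    and \<sigma>: "\<sigma> = sop_apply (q_out O' + n) (sop_of A) (qop_tensor (q_out O')
         (sop_of O' (enc_bcirc (hardwire pk F)) (enc_bcirc (hardwire pk F))) (basis_state vk))"
  shows "sop_of (forge_circ k mu n f O' A a B) (m @ vk @ pk) (m @ vk @ pk) s s =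
    (\<Sum>c\<in>words (q_out A - a). \<Sum>z\<in>words a. \<Sum>z'\<in>words a. \<sigma> (z @ c) (z' @ c) * sop_of B (m @ z) (m @ z') s s)"
proof -
  let ?o = "q_out A" and ?X = "m @ vk @ pk"
  define P1 where "P1 = pirate_circ k mu n f O' A"
  define P2 where "P2 = then_circ k P1 (rot_circ (?o + mu) 0 ?o mu) 0"
  have q: "q_out P1 = ?o + mu" "q_out P2 = ?o + mu" unfolding P1_def P2_def by simp_all
  have wf1: "qcirc_wf k P1" unfolding P1_def by (rule qcirc_wf_pirate_circ) (use k O A in auto)
  have wf2: "qcirc_wf k P2" unfolding P2_def by (rule qcirc_wf_then_circ) (auto simp: wf1 q qcirc_wf_rot_circ)
  let ?Q = "then_circ k P2 B (?o - a)"
  have wfQ: "qcirc_wf k ?Q" by (rule qcirc_wf_then_circ) (use A B in \<open>auto simp: wf2 q add.commute\<close>)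
  have s1: "sop_of P1 ?X ?X (u @ t) (v @ t') = (if t = m \<and> t' = m then \<sigma> u v else 0)"
    if "length u = ?o" "length v = ?o" "length t = mu" "length t' = mu" for u v t t'
    unfolding P1_def \<sigma> by (rule sop_of_pirate_circ[OF k O A(1) f x that])
  have s2: "sop_of P2 ?X ?X (t @ u) (t' @ v) = (if t = m \<and> t' = m then \<sigma> u v else 0)"
    if "length u = ?o" "length v = ?o" "length t = mu" "length t' = mu" for u v t t'
    unfolding P2_def
    by (subst sop_of_then_rot_circ[OF wf1]) (use x k q that in \<open>auto simp: rot_append0' s1\<close>)
  have "sop_of (forge_circ k mu n f O' A a B) ?X ?X s s =
      (\<Sum>c\<in>words (?o - a). sop_of ?Q ?X ?X (s @ c) (s @ c))"
    unfolding forge_circ_def Let_def P1_def[symmetric] P2_def[symmetric]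
    by (subst sop_of_trunc) (use wfQ x k in \<open>auto simp: qcirc_wf_iff\<close>)
  also have "\<dots> = (\<Sum>c\<in>words (?o - a). \<Sum>t\<in>words mu. \<Sum>z\<in>words a. \<Sum>t'\<in>words mu. \<Sum>z'\<in>words a.
      sop_of P2 ?X ?X (t @ z @ c) (t' @ z' @ c) * sop_of B (t @ z) (t' @ z') s s)"
  proof (intro sum.cong refl)
    fix c assume "c \<in> words (?o - a)"
    then have "sop_of ?Q ?X ?X (s @ c) (s @ c) = (\<Sum>w\<in>words (mu + a). \<Sum>w'\<in>words (mu + a).
        sop_of P2 ?X ?X (w @ c) (w' @ c) * sop_of B w w' s s)"
      by (intro sop_of_then_circ[OF wf2 B]) (use x k q s A in auto)
    then show "sop_of ?Q ?X ?X (s @ c) (s @ c) = (\<Sum>t\<in>words mu. \<Sum>z\<in>words a. \<Sum>t'\<in>words mu. \<Sum>z'\<in>words a.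
      sop_of P2 ?X ?X (t @ z @ c) (t' @ z' @ c) * sop_of B (t @ z) (t' @ z') s s)"
      by (simp only: sum_words_add append_assoc)
  qed
  also have "\<dots> = (\<Sum>c\<in>words (?o - a). \<Sum>t\<in>words mu. \<Sum>z\<in>words a. \<Sum>t'\<in>words mu. \<Sum>z'\<in>words a.
      if t = m then if t' = m then \<sigma> (z @ c) (z' @ c) * sop_of B (m @ z) (m @ z') s s else 0 else 0)"
    using A(2) by (intro sum.cong refl) (auto simp: s2)
  finally show ?thesis using x by (simp only: sum_if_const sum.delta finite_words words_iff simp_thms if_True)
qed

section \<open>Traces and positivity\<close>

definition trace_words :: "nat \<Rightarrow> qop \<Rightarrow> complex" where
  "trace_words k \<rho> = (\<Sum>x\<in>words k. \<rho> x x)"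

text \<open>The real part of the quadratic form is constrained, matching \<open>meas\<close>, which
  takes real parts of diagonal entries.\<close>

definition psd :: "nat \<Rightarrow> qop \<Rightarrow> bool" where
  "psd k \<rho> \<longleftrightarrow> (\<forall>c. 0 \<le> Re (\<Sum>x\<in>words k. \<Sum>y\<in>words k. cnj (c x) * \<rho> x y * c y))"

text \<open>Outputs and trash together are all wires, so the sum is the inner product of two evolved
  basis states; unitarity reduces it to that of the initial ones.\<close>

lemma trace_sop_of:
  assumes "qcirc_wf k Q" "length x = k" "length y = k"
  shows "(\<Sum>u\<in>words (q_out Q). sop_of Q x y u u) = (if x = y then 1 else 0)"
proof -
  let ?z = "zeros (q_anc Q)"
  have wf: "q_out Q \<le> k + q_anc Q" "gates_wf (k + q_anc Q) (q_gates Q)"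
    using assms(1) unfolding qcirc_wf_iff by auto
  have "(\<Sum>u\<in>words (q_out Q). sop_of Q x y u u) =
      (\<Sum>w\<in>words (q_out Q + (k + q_anc Q - q_out Q)). amp Q x w * cnj (amp Q y w))"
    unfolding sop_of_def sum_words_add by (simp add: assms)
  also have "\<dots> = inner_words (k + q_anc Q) (ket (x @ ?z)) (ket (y @ ?z))"
    using inner_words_run[OF wf(2), of "ket (x @ ?z)" "ket (y @ ?z)"] wf(1)
    by (simp add: inner_words_def amp_run)
  also have "\<dots> = (\<Sum>w\<in>words (k + q_anc Q). if w = x @ ?z then if x = y then 1 else 0 else 0)"
    unfolding inner_words_def by (intro sum.cong) (auto simp: ket_def)
  finally show ?thesis using assms by (simp add: sum.delta)
qed

lemma trace_sop_apply:
  assumes "qcirc_wf k Q"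
  shows "trace_words (q_out Q) (sop_apply k (sop_of Q) \<rho>) = trace_words k \<rho>"
proof -
  have "trace_words (q_out Q) (sop_apply k (sop_of Q) \<rho>) =
      (\<Sum>x\<in>words k. \<Sum>u\<in>words (q_out Q). \<Sum>y\<in>words k. sop_of Q x y u u * \<rho> x y)"
    unfolding trace_words_def sop_apply_def by (rule sum.swap)
  also have "\<dots> = (\<Sum>x\<in>words k. \<Sum>y\<in>words k. \<Sum>u\<in>words (q_out Q). sop_of Q x y u u * \<rho> x y)"
    by (intro sum.cong refl sum.swap)
  also have "\<dots> = (\<Sum>x\<in>words k. \<Sum>y\<in>words k. if y = x then \<rho> x x else 0)"
    unfolding sum_distrib_right[symmetric]
    by (intro sum.cong refl) (auto simp: trace_sop_of[OF assms])
  finally show ?thesis by (simp add: trace_words_def sum.delta)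
qed

lemma sum_rotate3:
  "(\<Sum>x\<in>A. \<Sum>y\<in>B. \<Sum>i\<in>I. f x y i) = (\<Sum>i\<in>I. \<Sum>x\<in>A. \<Sum>y\<in>B. (f x y i :: complex))"
proof -
  have "(\<Sum>x\<in>A. \<Sum>y\<in>B. \<Sum>i\<in>I. f x y i) = (\<Sum>x\<in>A. \<Sum>i\<in>I. \<Sum>y\<in>B. f x y i)"
    by (intro sum.cong refl sum.swap)
  also have "\<dots> = (\<Sum>i\<in>I. \<Sum>x\<in>A. \<Sum>y\<in>B. f x y i)" by (rule sum.swap)
  finally show ?thesis .
qed

lemma sum_swap_pairs:
  "(\<Sum>u\<in>A. \<Sum>v\<in>B. \<Sum>x\<in>C. \<Sum>y\<in>D. \<Sum>i\<in>I. f u v x y i) =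
    (\<Sum>i\<in>I. \<Sum>x\<in>C. \<Sum>y\<in>D. \<Sum>u\<in>A. \<Sum>v\<in>B. (f u v x y i :: complex))"
proof -
  have "(\<Sum>u\<in>A. \<Sum>v\<in>B. \<Sum>x\<in>C. \<Sum>y\<in>D. \<Sum>i\<in>I. f u v x y i) =
      (\<Sum>u\<in>A. \<Sum>v\<in>B. \<Sum>i\<in>I. \<Sum>x\<in>C. \<Sum>y\<in>D. f u v x y i)"
    by (rule sum.cong[OF refl], rule sum.cong[OF refl]) (rule sum_rotate3)
  also have "\<dots> = (\<Sum>i\<in>I. \<Sum>u\<in>A. \<Sum>v\<in>B. \<Sum>x\<in>C. \<Sum>y\<in>D. f u v x y i)"
    by (rule sum_rotate3)
  also have "\<dots> = (\<Sum>i\<in>I. \<Sum>x\<in>C. \<Sum>u\<in>A. \<Sum>v\<in>B. \<Sum>y\<in>D. f u v x y i)"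
    by (rule sum.cong[OF refl]) (rule sum_rotate3)
  also have "\<dots> = (\<Sum>i\<in>I. \<Sum>x\<in>C. \<Sum>y\<in>D. \<Sum>u\<in>A. \<Sum>v\<in>B. f u v x y i)"
    by (rule sum.cong[OF refl], rule sum.cong[OF refl]) (rule sum_rotate3)
  finally show ?thesis .
qed

lemma sum_push4:
  "(\<Sum>i\<in>I. \<Sum>x\<in>A. \<Sum>c\<in>B. \<Sum>y\<in>C. \<Sum>d\<in>D. f i x c y d) =
    (\<Sum>x\<in>A. \<Sum>c\<in>B. \<Sum>y\<in>C. \<Sum>d\<in>D. \<Sum>i\<in>I. (f i x c y d :: complex))"
proof -
  have "(\<Sum>i\<in>I. \<Sum>x\<in>A. \<Sum>c\<in>B. \<Sum>y\<in>C. \<Sum>d\<in>D. f i x c y d) =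
      (\<Sum>x\<in>A. \<Sum>c\<in>B. \<Sum>i\<in>I. \<Sum>y\<in>C. \<Sum>d\<in>D. f i x c y d)"
    by (rule sum_rotate3[symmetric])
  also have "\<dots> = (\<Sum>x\<in>A. \<Sum>c\<in>B. \<Sum>y\<in>C. \<Sum>d\<in>D. \<Sum>i\<in>I. f i x c y d)"
    by (rule sum.cong[OF refl], rule sum.cong[OF refl]) (rule sum_rotate3[symmetric])
  finally show ?thesis .
qed

text \<open>\<open>\<Phi>\<close> is given in Kraus form. The quadratic form of the image at
  \<open>c\<close> is the sum over \<open>i\<close> of the quadratic forms of \<open>\<rho>\<close>
  at the vectors that the adjoints of the Kraus operators make of \<open>c\<close>.\<close>

lemma psd_sop_apply:
  assumes \<rho>: "psd k \<rho>"
    and \<Phi>: "\<And>x y u v. length x = k \<Longrightarrow> length y = k \<Longrightarrow> \<Phi> x y u v = (\<Sum>i\<in>I. K i x u * cnj (K i y v))"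
  shows "psd n (sop_apply k \<Phi> \<rho>)"
  unfolding psd_def
proof
  fix c :: "bits \<Rightarrow> complex"
  let ?c = "\<lambda>i y. \<Sum>v\<in>words n. cnj (K i y v) * c v"
  have "(\<Sum>u\<in>words n. \<Sum>v\<in>words n. cnj (c u) * sop_apply k \<Phi> \<rho> u v * c v) =
    (\<Sum>u\<in>words n. \<Sum>v\<in>words n. \<Sum>x\<in>words k. \<Sum>y\<in>words k. \<Sum>i\<in>I.
      (K i x u * cnj (c u)) * \<rho> x y * (cnj (K i y v) * c v))"
  proof (rule sum.cong[OF refl], rule sum.cong[OF refl])
    fix u v
    have "cnj (c u) * sop_apply k \<Phi> \<rho> u v * c v =
        (\<Sum>x\<in>words k. \<Sum>y\<in>words k. cnj (c u) * (\<Phi> x y u v * \<rho> x y) * c v)"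
      unfolding sop_apply_def sum_distrib_left sum_distrib_right ..
    also have "\<dots> = (\<Sum>x\<in>words k. \<Sum>y\<in>words k. \<Sum>i\<in>I.
        (K i x u * cnj (c u)) * \<rho> x y * (cnj (K i y v) * c v))"
    proof (rule sum.cong[OF refl], rule sum.cong[OF refl])
      fix x y assume "x \<in> words k" "y \<in> words k"
      then have "cnj (c u) * (\<Phi> x y u v * \<rho> x y) * c v =
          (\<Sum>i\<in>I. cnj (c u) * (K i x u * cnj (K i y v) * \<rho> x y) * c v)"
        by (simp add: \<Phi> sum_distrib_left sum_distrib_right)
      then show "cnj (c u) * (\<Phi> x y u v * \<rho> x y) * c v =
          (\<Sum>i\<in>I. (K i x u * cnj (c u)) * \<rho> x y * (cnj (K i y v) * c v))"
        by (simp only: mult_ac)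
    qed
    finally show "cnj (c u) * sop_apply k \<Phi> \<rho> u v * c v = (\<Sum>x\<in>words k. \<Sum>y\<in>words k. \<Sum>i\<in>I.
        (K i x u * cnj (c u)) * \<rho> x y * (cnj (K i y v) * c v))" .
  qed
  also have "\<dots> = (\<Sum>i\<in>I. \<Sum>x\<in>words k. \<Sum>y\<in>words k. \<Sum>u\<in>words n. \<Sum>v\<in>words n.
      (K i x u * cnj (c u)) * \<rho> x y * (cnj (K i y v) * c v))"
    by (rule sum_swap_pairs)
  also have "\<dots> = (\<Sum>i\<in>I. \<Sum>x\<in>words k. \<Sum>y\<in>words k. cnj (?c i x) * \<rho> x y * ?c i y)"
  proof -
    have "(\<Sum>u\<in>words n. \<Sum>v\<in>words n. f u * r * g v) = (\<Sum>u\<in>words n. f u) * r * (\<Sum>v\<in>words n. g v)"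
      for f g :: "bits \<Rightarrow> complex" and r
      unfolding sum_distrib_right unfolding sum_distrib_left ..
    then show ?thesis unfolding cnj_sum complex_cnj_mult complex_cnj_cnj
      by (intro sum.cong refl)
  qed
  finally have "Re (\<Sum>u\<in>words n. \<Sum>v\<in>words n. cnj (c u) * sop_apply k \<Phi> \<rho> u v * c v) =
      (\<Sum>i\<in>I. Re (\<Sum>x\<in>words k. \<Sum>y\<in>words k. cnj (?c i x) * \<rho> x y * ?c i y))"
    by (simp only: Re_sum)
  also have "\<dots> \<ge> 0" by (intro sum_nonneg \<rho>[unfolded psd_def, rule_format])
  finally show "0 \<le> Re (\<Sum>u\<in>words n. \<Sum>v\<in>words n. cnj (c u) * sop_apply k \<Phi> \<rho> u v * c v)" .
qed

lemma psd_sop_of: "psd k \<rho> \<Longrightarrow> psd n (sop_apply k (sop_of Q) \<rho>)"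
  by (rule psd_sop_apply[where K = "\<lambda>g x u. amp Q x (u @ g)" and I = "words (k + q_anc Q - q_out Q)"])
    (auto simp: sop_of_def)

lemma psd_diag:
  assumes "psd k \<rho>" "length z = k" shows "0 \<le> Re (\<rho> z z)"
proof -
  have "(\<Sum>x\<in>words k. \<Sum>y\<in>words k. cnj (ket z x) * \<rho> x y * ket z y) =
    (\<Sum>x\<in>words k. \<Sum>y\<in>words k. if x = z then if y = z then \<rho> z z else 0 else 0)"
    by (intro sum.cong refl) (auto simp: ket_def)
  also have "\<dots> = \<rho> z z" using assms(2) by (intro sum_delta2) auto
  finally show ?thesis using assms(1)[unfolded psd_def, rule_format, of "ket z"] by (simp only:)
qed

lemma psd_basis_state: "length z = k \<Longrightarrow> psd k (basis_state z)"
  unfolding psd_def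
proof
  fix c :: "bits \<Rightarrow> complex" assume z: "length z = k"
  have "(\<Sum>x\<in>words k. \<Sum>y\<in>words k. cnj (c x) * basis_state z x y * c y) =
    (\<Sum>x\<in>words k. \<Sum>y\<in>words k. if x = z then if y = z then cnj (c z) * c z else 0 else 0)"
    by (intro sum.cong refl) (auto simp: basis_state_def)
  also have "\<dots> = cnj (c z) * c z" using z by (intro sum_delta2) auto
  finally show "0 \<le> Re (\<Sum>x\<in>words k. \<Sum>y\<in>words k. cnj (c x) * basis_state z x y * c y)" by simp
qed

text \<open>A classical register pins the last \<open>n\<close> wires of row and column to
  \<open>z\<close>.\<close>

lemma sum_qop_tensor_basis:
  assumes "length z = n"
  shows "(\<Sum>x\<in>words (q + n). \<Sum>y\<in>words (q + n). f x y * qop_tensor q \<rho> (basis_state z) x y) =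
    (\<Sum>x\<in>words q. \<Sum>y\<in>words q. f (x @ z) (y @ z) * \<rho> x y)"
proof -
  have "(\<Sum>x\<in>words (q + n). \<Sum>y\<in>words (q + n). f x y * qop_tensor q \<rho> (basis_state z) x y) =
    (\<Sum>x\<in>words q. \<Sum>t\<in>words n. \<Sum>y\<in>words q. \<Sum>t'\<in>words n. if t = z then if t' = z then
      f (x @ z) (y @ z) * \<rho> x y else 0 else 0)"
    unfolding sum_words_add by (intro sum.cong refl) (auto simp: qop_tensor_def basis_state_def)
  then show ?thesis
    using assms by (simp only: sum_if_const sum.delta finite_words words_iff simp_thms if_True)
qed

lemma psd_qop_tensor:
  assumes "psd q \<rho>" "length z = n" shows "psd (q + n) (qop_tensor q \<rho> (basis_state z))"
  unfolding psd_def
proof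
  fix c :: "bits \<Rightarrow> complex"
  have "(\<Sum>x\<in>words (q + n). \<Sum>y\<in>words (q + n). cnj (c x) * qop_tensor q \<rho> (basis_state z) x y * c y) =
    (\<Sum>x\<in>words (q + n). \<Sum>y\<in>words (q + n). (cnj (c x) * c y) * qop_tensor q \<rho> (basis_state z) x y)"
    by (simp add: mult_ac)
  also have "\<dots> = (\<Sum>x\<in>words q. \<Sum>y\<in>words q. cnj (c (x @ z)) * \<rho> x y * c (y @ z))"
    unfolding sum_qop_tensor_basis[OF assms(2)] by (simp add: mult_ac)
  finally show "0 \<le> Re (\<Sum>x\<in>words (q + n). \<Sum>y\<in>words (q + n). cnj (c x) * qop_tensor q \<rho> (basis_state z) x y * c y)"
    using assms(1)[unfolded psd_def, rule_format, of "\<lambda>x. c (x @ z)"] by simp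
qed

lemma trace_qop_tensor:
  assumes "length z = n" shows "trace_words (q + n) (qop_tensor q \<rho> (basis_state z)) = trace_words q \<rho>"
proof -
  have "trace_words (q + n) (qop_tensor q \<rho> (basis_state z)) = (\<Sum>x\<in>words q. \<Sum>t\<in>words n. if t = z then \<rho> x x else 0)"
    unfolding trace_words_def sum_words_add by (intro sum.cong refl) (auto simp: qop_tensor_def basis_state_def)
  then show ?thesis using assms by (simp add: trace_words_def sum.delta)
qed

lemma trace_basis_state: "length z = k \<Longrightarrow> trace_words k (basis_state z) = 1"
  unfolding trace_words_def basis_state_def by (simp add: sum.delta)

lemma sop_apply_basis_state:
  assumes "length z = k" shows "sop_apply k \<Phi> (basis_state z) u v = \<Phi> z z u v"
proof -
  have "sop_apply k \<Phi> (basis_state z) u v =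
      (\<Sum>x\<in>words k. \<Sum>y\<in>words k. if x = z then if y = z then \<Phi> z z u v else 0 else 0)"
    unfolding sop_apply_def by (intro sum.cong refl) (auto simp: basis_state_def)
  then show ?thesis using assms by (simp add: sum_delta2)
qed

section \<open>Joint outcomes of two parties on a bipartite state\<close>

lemma split_prob_eq:
  assumes "q_out (B l (length m + a)) = length u"
  shows "split_prob B C l a b m m' \<sigma> u v =
    Re (\<Sum>x\<in>words a. \<Sum>c\<in>words b. \<Sum>y\<in>words a. \<Sum>d\<in>words b.
      sop_of (B l (length m + a)) (m @ x) (m @ y) u u * sop_of (C l (length m' + b)) (m' @ c) (m' @ d) v v
        * \<sigma> (x @ c) (y @ d))"
  unfolding split_prob_def Let_def meas_def sop_apply_def sum_words_add
  by (intro arg_cong[of _ _ Re] sum.cong refl) (simp add: sop_tensor_def sop_fix_def assms)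

text \<open>The Kraus operators of a tensor product are the products of those of the factors,
  indexed by pairs of traced out words.\<close>

lemma split_prob_nonneg:
  assumes "psd (a + b) \<sigma>"
  shows "0 \<le> split_prob B C l a b m m' \<sigma> u v"
proof -
  let ?B = "B l (length m + a)" and ?C = "C l (length m' + b)" and ?p = "q_out (B l (length m + a))"
  let ?GB = "words (length m + a + q_anc ?B - q_out ?B)" and ?GC = "words (length m' + b + q_anc ?C - q_out ?C)"
  define K where "K = (\<lambda>(g, g') x u. amp ?B (m @ take a x) (take ?p u @ g) * amp ?C (m' @ drop a x) (drop ?p u @ g'))"
  have "sop_tensor a ?p (sop_fix m (sop_of ?B)) (sop_fix m' (sop_of ?C)) x y w w' =
      (\<Sum>i\<in>?GB \<times> ?GC. K i x w * cnj (K i y w'))"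
    if "length x = a + b" "length y = a + b" for x y w w'
  proof -
    have l: "length (m @ take a x) = length m + a" "length (m' @ drop a x) = length m' + b" using that by auto
    show ?thesis
      unfolding sop_tensor_def sop_fix_def sop_of_def l sum_product sum.cartesian_product K_def
      by (rule sum.cong) (auto simp: split_def mult_ac)
  qed
  then have "psd (length u + length v) (sop_apply (a + b) (sop_tensor a ?p (sop_fix m (sop_of ?B)) (sop_fix m' (sop_of ?C))) \<sigma>)"
    by (rule psd_sop_apply[OF assms])
  then show ?thesis unfolding split_prob_def Let_def meas_def by (rule psd_diag) simp
qed

text \<open>No-signalling: summing over all outcomes of \<open>C\<close> replaces it by the trace
  over its register, so neither \<open>m'\<close> nor \<open>C\<close> is left on the right-hand
  side.\<close>

lemma sum_split_prob_right:
  assumes C: "qcirc_wf (length m' + b) (C l (length m' + b))" and u: "q_out (B l (length m + a)) = length u"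
  shows "(\<Sum>v\<in>words (q_out (C l (length m' + b))). split_prob B C l a b m m' \<sigma> u v) =
    Re (\<Sum>c\<in>words b. \<Sum>z\<in>words a. \<Sum>z'\<in>words a. \<sigma> (z @ c) (z' @ c) * sop_of (B l (length m + a)) (m @ z) (m @ z') u u)"
proof -
  let ?B = "B l (length m + a)" and ?C = "C l (length m' + b)"
  have "(\<Sum>v\<in>words (q_out ?C). split_prob B C l a b m m' \<sigma> u v) =
    Re (\<Sum>v\<in>words (q_out ?C). \<Sum>x\<in>words a. \<Sum>c\<in>words b. \<Sum>y\<in>words a. \<Sum>d\<in>words b.
      sop_of ?B (m @ x) (m @ y) u u * sop_of ?C (m' @ c) (m' @ d) v v * \<sigma> (x @ c) (y @ d))"
    unfolding split_prob_eq[where B = B and l = l and m = m and a = a, OF u] by simp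
  also have "(\<Sum>v\<in>words (q_out ?C). \<Sum>x\<in>words a. \<Sum>c\<in>words b. \<Sum>y\<in>words a. \<Sum>d\<in>words b.
      sop_of ?B (m @ x) (m @ y) u u * sop_of ?C (m' @ c) (m' @ d) v v * \<sigma> (x @ c) (y @ d)) =
    (\<Sum>x\<in>words a. \<Sum>c\<in>words b. \<Sum>y\<in>words a. \<Sum>d\<in>words b. \<Sum>v\<in>words (q_out ?C).
      sop_of ?B (m @ x) (m @ y) u u * sop_of ?C (m' @ c) (m' @ d) v v * \<sigma> (x @ c) (y @ d))"
    by (rule sum_push4)
  also have "\<dots> = (\<Sum>x\<in>words a. \<Sum>c\<in>words b. \<Sum>y\<in>words a. \<Sum>d\<in>words b.
      (\<Sum>v\<in>words (q_out ?C). sop_of ?C (m' @ c) (m' @ d) v v) * (\<sigma> (x @ c) (y @ d) * sop_of ?B (m @ x) (m @ y) u u))"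
    unfolding sum_distrib_right by (intro sum.cong refl) (simp only: mult_ac)
  also have "\<dots> = (\<Sum>x\<in>words a. \<Sum>c\<in>words b. \<Sum>y\<in>words a. \<Sum>d\<in>words b.
      if d = c then \<sigma> (x @ c) (y @ c) * sop_of ?B (m @ x) (m @ y) u u else 0)"
    by (intro sum.cong refl, subst trace_sop_of[OF C]) auto
  also have "\<dots> = (\<Sum>x\<in>words a. \<Sum>c\<in>words b. \<Sum>y\<in>words a. \<sigma> (x @ c) (y @ c) * sop_of ?B (m @ x) (m @ y) u u)"
    by (simp add: sum.delta)
  also have "\<dots> = (\<Sum>c\<in>words b. \<Sum>x\<in>words a. \<Sum>y\<in>words a. \<sigma> (x @ c) (y @ c) * sop_of ?B (m @ x) (m @ y) u u)"
    by (rule sum.swap)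
  finally show ?thesis .
qed

lemma split_prob_swap:
  assumes "q_out (B l (length m + a)) = length u" "q_out (C l (length m' + b)) = length v"
    and "\<And>x y c d. length x = a \<Longrightarrow> length y = a \<Longrightarrow> length c = b \<Longrightarrow> length d = b \<Longrightarrow> \<sigma>' (c @ x) (d @ y) = \<sigma> (x @ c) (y @ d)"
  shows "split_prob C B l b a m' m \<sigma>' v u = split_prob B C l a b m m' \<sigma> u v"
proof -
  let ?f = "\<lambda>x c y d. sop_of (B l (length m + a)) (m @ x) (m @ y) u u *
      sop_of (C l (length m' + b)) (m' @ c) (m' @ d) v v * \<sigma> (x @ c) (y @ d)"
  have "split_prob C B l b a m' m \<sigma>' v u = Re (\<Sum>c\<in>words b. \<Sum>x\<in>words a. \<Sum>d\<in>words b. \<Sum>y\<in>words a. ?f x c y d)"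
    unfolding split_prob_eq[where B = C and l = l and m = m' and a = b, OF assms(2)]
    by (intro arg_cong[of _ _ Re] sum.cong refl) (simp add: assms(3) mult.commute)
  also have "(\<Sum>c\<in>words b. \<Sum>x\<in>words a. \<Sum>d\<in>words b. \<Sum>y\<in>words a. ?f x c y d) =
      (\<Sum>c\<in>words b. \<Sum>x\<in>words a. \<Sum>y\<in>words a. \<Sum>d\<in>words b. ?f x c y d)"
    by (rule sum.cong[OF refl], rule sum.cong[OF refl], rule sum.swap)
  also have "\<dots> = (\<Sum>x\<in>words a. \<Sum>c\<in>words b. \<Sum>y\<in>words a. \<Sum>d\<in>words b. ?f x c y d)"
    by (rule sum.swap)
  finally show ?thesis
    unfolding split_prob_eq[where B = B and l = l and m = m and a = a, OF assms(1)] .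
qed

text \<open>Trace preservation, first of \<open>C\<close> and then of \<open>B\<close>.\<close>

lemma sum_split_prob:
  assumes B: "qcirc_wf (length m + a) (B l (length m + a))"
    and C: "qcirc_wf (length m' + b) (C l (length m' + b))"
  shows "(\<Sum>u\<in>words (q_out (B l (length m + a))). \<Sum>v\<in>words (q_out (C l (length m' + b))).
      split_prob B C l a b m m' \<sigma> u v) = Re (trace_words (a + b) \<sigma>)"
proof -
  let ?B = "B l (length m + a)" and ?C = "C l (length m' + b)"
  have "(\<Sum>u\<in>words (q_out ?B). \<Sum>v\<in>words (q_out ?C). split_prob B C l a b m m' \<sigma> u v) =
    Re (\<Sum>u\<in>words (q_out ?B). \<Sum>c\<in>words b. \<Sum>z\<in>words a. \<Sum>z'\<in>words a. \<sigma> (z @ c) (z' @ c) * sop_of ?B (m @ z) (m @ z') u u)"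
    by (simp add: sum_split_prob_right[where C = C and l = l and m' = m' and b = b, OF C])
  also have "(\<Sum>u\<in>words (q_out ?B). \<Sum>c\<in>words b. \<Sum>z\<in>words a. \<Sum>z'\<in>words a. \<sigma> (z @ c) (z' @ c) * sop_of ?B (m @ z) (m @ z') u u)
    = (\<Sum>c\<in>words b. \<Sum>z\<in>words a. \<Sum>z'\<in>words a. \<sigma> (z @ c) (z' @ c) * (\<Sum>u\<in>words (q_out ?B). sop_of ?B (m @ z) (m @ z') u u))"
  proof -
    have "(\<Sum>u\<in>words (q_out ?B). \<Sum>c\<in>words b. \<Sum>z\<in>words a. \<Sum>z'\<in>words a. f u c z z') =
      (\<Sum>c\<in>words b. \<Sum>z\<in>words a. \<Sum>z'\<in>words a. \<Sum>u\<in>words (q_out ?B). f u c z z')" for f :: "_ \<Rightarrow> _ \<Rightarrow> _ \<Rightarrow> _ \<Rightarrow> complex"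
      by (subst sum_rotate3[symmetric], rule sum.cong[OF refl], rule sum.cong[OF refl], rule sum.swap)
    then show ?thesis by (simp only: sum_distrib_left)
  qed
  also have "\<dots> = (\<Sum>c\<in>words b. \<Sum>z\<in>words a. \<Sum>z'\<in>words a. if z' = z then \<sigma> (z @ c) (z @ c) else 0)"
    by (intro sum.cong refl, subst trace_sop_of[OF B]) auto
  also have "\<dots> = (\<Sum>c\<in>words b. \<Sum>z\<in>words a. \<sigma> (z @ c) (z @ c))"
    by (simp add: sum.delta)
  also have "\<dots> = trace_words (a + b) \<sigma>"
    unfolding trace_words_def sum_words_add by (rule sum.swap)
  finally show ?thesis .
qed

section \<open>Negligible functions and finite expectations\<close>

lemma negligible_mono:
  assumes "negligible g" "\<And>l. \<bar>f l\<bar> \<le> g l" shows "negligible f"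
  unfolding negligible_def
proof
  fix c
  from assms(1) obtain N where "\<forall>l\<ge>N. \<bar>g l\<bar> < 1 / real l ^ c" unfolding negligible_def by blast
  then have "\<forall>l\<ge>N. \<bar>f l\<bar> < 1 / real l ^ c"
    using assms(2) by (meson abs_ge_self le_less_trans order_trans)
  then show "\<exists>N. \<forall>l\<ge>N. \<bar>f l\<bar> < 1 / real l ^ c" by blast
qed

lemma negligible_add:
  assumes "negligible f" "negligible g" shows "negligible (\<lambda>l. f l + g l)"
  unfolding negligible_def
proof
  fix c
  from assms obtain M N where M: "\<And>l. l \<ge> M \<Longrightarrow> \<bar>f l\<bar> < 1 / real l ^ Suc c"
    and N: "\<And>l. l \<ge> N \<Longrightarrow> \<bar>g l\<bar> < 1 / real l ^ Suc c"
    unfolding negligible_def by blast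
  \<comment> \<open>Both summands are below the next inverse power; from \<open>l \<ge> 2\<close>
    on, the spare factor \<open>1 / l\<close> pays for the doubling.\<close>
  have "\<bar>f l + g l\<bar> < 1 / real l ^ c" if "l \<ge> M + N + 2" for l
  proof -
    have l: "real l \<ge> 2" using that by simp
    have "\<bar>f l + g l\<bar> < 2 / real l ^ Suc c" using M[of l] N[of l] that by simp
    also have "\<dots> = (2 / real l) * (1 / real l ^ c)" using l by (simp add: field_simps)
    also have "\<dots> \<le> 1 * (1 / real l ^ c)" using l by (intro mult_right_mono) auto
    finally show ?thesis by simp
  qed
  then show "\<exists>N. \<forall>l\<ge>N. \<bar>f l + g l\<bar> < 1 / real l ^ c" by blast
qed

lemma negligible_abs: "negligible f \<Longrightarrow> negligible (\<lambda>l. \<bar>f l\<bar>)"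
  unfolding negligible_def by simp

lemma integrable_finite_pmf: "finite (set_pmf M) \<Longrightarrow> integrable (measure_pmf M) (f :: _ \<Rightarrow> real)"
  by (rule integrable_measure_pmf_finite)

lemma expectation_sum:
  assumes "finite (set_pmf M)"
  shows "measure_pmf.expectation M (\<lambda>x. \<Sum>i\<in>I. c i * f i x :: real) = (\<Sum>i\<in>I. c i * measure_pmf.expectation M (f i))"
  by (subst Bochner_Integration.integral_sum) (auto intro: integrable_finite_pmf assms)

lemma expectation_mono:
  assumes "finite (set_pmf M)" "\<And>x. x \<in> set_pmf M \<Longrightarrow> f x \<le> (g x :: real)"
  shows "measure_pmf.expectation M f \<le> measure_pmf.expectation M g"
  by (intro integral_mono_AE integrable_finite_pmf assms(1)) (use assms(2) in \<open>simp add: AE_measure_pmf_iff\<close>)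

lemma expectation_cong:
  assumes "\<And>x. x \<in> set_pmf M \<Longrightarrow> f x = (g x :: real)"
  shows "measure_pmf.expectation M f = measure_pmf.expectation M g"
  using assms by (intro integral_cong_AE) (auto simp: AE_measure_pmf_iff)

lemma expectation_nonneg:
  assumes "\<And>x. x \<in> set_pmf M \<Longrightarrow> 0 \<le> (f x :: real)"
  shows "0 \<le> measure_pmf.expectation M f"
  using assms by (intro integral_nonneg_AE) (auto simp: AE_measure_pmf_iff)

lemma expectation_finite:
  assumes "finite A" "set_pmf M \<subseteq> A"
  shows "measure_pmf.expectation M f = (\<Sum>a\<in>A. pmf M a * (f a :: real))"
  by (subst integral_measure_pmf_real[of A]) (use assms in \<open>auto simp: mult.commute\<close>)

lemma set_pmf_uniform [simp]: "set_pmf (uniform n) = words n"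
  unfolding uniform_def by simp

lemma pmf_map_uniform:
  "pmf (map_pmf f (uniform n)) y = (\<Sum>r\<in>words n. if y = f r then 1 / 2 ^ n else 0)"
proof -
  have "pmf (map_pmf f (uniform n)) y = real (card (words n \<inter> f -` {y})) / 2 ^ n"
    unfolding pmf_map uniform_def by (simp add: measure_pmf_of_set card_words)
  moreover have "(\<Sum>r\<in>words n. if y = f r then 1 / 2 ^ n else 0 :: real) = (\<Sum>r\<in>words n \<inter> f -` {y}. 1 / 2 ^ n)"
    by (subst sum.inter_restrict) (auto intro!: sum.cong simp: vimage_def)
  ultimately show ?thesis by simp
qed

lemma finite_set_prun: "finite (set_pmf (prun out P l x))"
  unfolding prun_def by simp

section \<open>Uniformity of the circuits of the reduction, and the adversaries as
  algorithms\<close>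

lemma polytime_Cons: "polytime f \<Longrightarrow> polytime (\<lambda>l k. b # f l k)"
  unfolding polytime_iff by (rule ptime_Cons)

lemma uniform_split_circ:
  assumes "pnat K" "pnat n" "pnat a" and A: "uniform_circ A"
  shows "uniform_circ (\<lambda>l k. split_circ (K l k) (n l k) (a l k) (A l k))"
  unfolding split_circ_def Let_def
  by (intro uniform_then_circ uniform_rot_circ uniform_dup_circ assms pnat_add pnat_diff pnat_const
      polytime_enc_qcirc_parts(2)[OF A])

lemma uniform_verify_circ:
  assumes "pnat K" "pnat mu" "pnat n" "pnat w" "polytime (\<lambda>l k. enc_bcirc (V l k))" and B: "uniform_circ B"
  shows "uniform_circ (\<lambda>l k. verify_circ (K l k) (mu l k) (n l k) (w l k) (V l k) (B l k))"
  unfolding verify_circ_def Let_def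
proof (intro uniform_then_circ uniform_rot_circ uniform_dup_circ uniform_bool_circ assms pnat_add pnat_diff pnat_const
      polytime_enc_qcirc_parts(2)[OF B])
  show "polytime (\<lambda>l k. enc_bcirc (V l k @ [Nand (w l k + length (V l k) - 1) (w l k + length (V l k) - 1)]))"
    unfolding enc_bcirc_append enc_bcirc_Cons enc_bcirc_Nil enc_bgate.simps enc_nat.simps append_Nil2 append_Cons
    by (intro polytime_Cons polytime_append polytime_const pnat_add pnat_diff pnat_const pnat_length_bcirc assms)
qed

lemma uniform_pirate_circ:
  assumes "pnat K" "pnat mu" "pnat n" "polytime f" "uniform_circ O'" "uniform_circ A"
  shows "uniform_circ (\<lambda>l k. pirate_circ (K l k) (mu l k) (n l k) (f l k) (O' l k) (A l k))"
  unfolding pirate_circ_def Let_def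
  by (intro uniform_then_circ uniform_rot_circ uniform_enc_circ assms pnat_add pnat_diff pnat_const)

lemma uniform_forge_circ:
  assumes "pnat K" "pnat mu" "pnat n" "polytime f" "uniform_circ O'" and A: "uniform_circ A" and "pnat a"
    and B: "uniform_circ B"
  shows "uniform_circ (\<lambda>l k. forge_circ (K l k) (mu l k) (n l k) (f l k) (O' l k) (A l k) (a l k) (B l k))"
  unfolding forge_circ_def Let_def
  by (intro uniform_trunc uniform_then_circ uniform_rot_circ uniform_pirate_circ assms pnat_add pnat_diff pnat_const
      polytime_enc_qcirc_parts(2)[OF A] polytime_enc_qcirc_parts(2)[OF B])

locale signature_scheme =
  fixes DS :: pds
  assumes efficient: "ds_efficient DS"
begin

abbreviation "\<mu> \<equiv> ds_msglen DS"
abbreviation "vkl \<equiv> ds_vklen DS"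
abbreviation "skl \<equiv> ds_sklen DS"
abbreviation "sgl \<equiv> ds_siglen DS"

lemma lengths: "poly_length \<mu>" "poly_length sgl" "poly_length skl" "poly_length vkl"
  using efficient unfolding ds_efficient_def by auto

lemmas pnat_lengths = lengths[THEN poly_length_pnat, OF pnat_fst]

lemma gen_wf: "bcirc_wf (coins (ds_gen DS) l) (skl l + vkl l) (pcirc (ds_gen DS) l)"
  and sign_wf: "bcirc_wf (\<mu> l + skl l) (sgl l) (ds_sign DS l)"
  and verify_wf: "bcirc_wf (vkl l + \<mu> l + sgl l) 1 (ds_verify DS l)"
  and puncture_wf: "bcirc_wf (skl l + 2 * \<mu> l + coins (ds_puncture DS) l) (ds_pklen DS l) (pcirc (ds_puncture DS) l)"
  using efficient unfolding ds_efficient_def prob_poly_def det_poly_def by auto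

lemma polytime_circuits:
  "polytime (\<lambda>l _. enc_bcirc (pcirc (ds_gen DS) l))" "poly_length (coins (ds_gen DS))"
  "polytime (\<lambda>l _. enc_bcirc (ds_sign DS l))" "polytime (\<lambda>l _. enc_bcirc (ds_verify DS l))"
  "polytime (\<lambda>l _. enc_bcirc (ds_sign_star DS l))"
  using efficient unfolding ds_efficient_def prob_poly_def det_poly_def by auto

lemma ds_keys_eq: "ds_keys DS l = map_pmf (\<lambda>r. (take (skl l) (beval (skl l + vkl l) (pcirc (ds_gen DS) l) r),
    drop (skl l) (beval (skl l + vkl l) (pcirc (ds_gen DS) l) r))) (uniform (coins (ds_gen DS) l))"
  unfolding gen_keys_def prun_def by (simp add: map_pmf_comp)

lemma ds_keys_lengths:
  assumes "(sk, vk) \<in> set_pmf (ds_keys DS l)" shows "length sk = skl l" "length vk = vkl l"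
  using assms length_beval[OF gen_wf] unfolding ds_keys_eq by auto

lemma finite_ds_keys: "finite (set_pmf (ds_keys DS l))"
  unfolding ds_keys_eq by simp

lemma length_ds_support: "sk \<in> ds_support DS l \<Longrightarrow> length sk = skl l"
  unfolding ds_support_def using ds_keys_lengths by force

lemma length_puncture_key:
  assumes "length sk = skl l" "length m1 = \<mu> l" "length m2 = \<mu> l" "pk \<in> set_pmf (puncture_key DS l sk m1 m2)"
  shows "length pk = ds_pklen DS l"
proof -
  have "length (concat (sort [m1, m2])) = 2 * \<mu> l" using assms by simp
  then show ?thesis
    using assms length_beval[OF puncture_wf] unfolding puncture_key_def prun_def by auto
qed

lemma finite_puncture_key: "finite (set_pmf (puncture_key DS l sk m1 m2))"
  unfolding puncture_key_def by (rule finite_set_prun)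

text \<open>The messages are sorted before puncturing. This symmetry lets the second forger take the
  second message as its own challenge.\<close>

lemma puncture_key_commute: "puncture_key DS l sk m1 m2 = puncture_key DS l sk m2 m1"
  unfolding puncture_key_def by (cases m1 m2 rule: linorder_cases) auto

definition gen_alg :: qalg where
  "gen_alg l k = gen_circ (coins (ds_gen DS) l) (skl l + vkl l) (pcirc (ds_gen DS) l)"

lemma q_out_gen_alg: "q_out (gen_alg l k) = skl l + vkl l"
  unfolding gen_alg_def gen_circ_def by simp

lemma qpt_gen_alg: "qpt gen_alg"
  unfolding qpt_def
proof (intro conjI allI)
  show "uniform_circ gen_alg"
    unfolding gen_alg_def gen_circ_def
    by (intro uniform_then_circ uniform_had_circ uniform_bool_circ pnat_add pnat_const pnat_lengths
        polytime_circuits poly_length_pnat[OF polytime_circuits(2) pnat_fst])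
  fix l k
  have "qcirc_wf 0 (gen_alg l k)"
    unfolding gen_alg_def gen_circ_def
    by (rule qcirc_wf_then_circ) (auto simp: qcirc_wf_had_circ qcirc_wf_bool_circ[OF gen_wf])
  then show "qcirc_wf k (gen_alg l k)"
    unfolding qcirc_wf_iff by (auto elim: gates_wf_mono)
qed

text \<open>The coins are traced out, so for fixed \<open>sk\<close> the remaining register is a
  classical mixture of verification keys, weighted by their joint probability with
  \<open>sk\<close>.\<close>

lemma sop_of_gen_alg:
  assumes "length sk = skl l" "length vk = vkl l" "length vk' = vkl l"
  shows "sop_of (gen_alg l 0) [] [] (sk @ vk) (sk @ vk') =
    (if vk = vk' then complex_of_real (pmf (ds_keys DS l) (sk, vk)) else 0)"
proof -
  let ?f = "beval (skl l + vkl l) (pcirc (ds_gen DS) l)" and ?c = "coins (ds_gen DS) l"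
  have iff: "(sk, vk) = (take (skl l) (?f r), drop (skl l) (?f r)) \<longleftrightarrow> sk @ vk = ?f r" if "length r = ?c" for r
    using assms length_beval[OF gen_wf that] by (metis append_eq_conv_conj append_take_drop_id prod.inject)
  have "pmf (ds_keys DS l) (sk, vk) = (\<Sum>r\<in>words ?c. if sk @ vk = ?f r then 1 / 2 ^ ?c else 0)"
    unfolding ds_keys_eq pmf_map_uniform by (rule sum.cong[OF refl]) (simp only: words_iff iff)
  then have "complex_of_real (pmf (ds_keys DS l) (sk, vk)) = (\<Sum>r\<in>words ?c. if sk @ vk = ?f r then 1 / 2 ^ ?c else 0)"
    by (simp add: if_distrib[of complex_of_real] cong: if_cong)
  then show ?thesis
    unfolding gen_alg_def by (subst sop_of_gen_circ[OF gen_wf]) (use assms in auto)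
qed

text \<open>
  Algorithms must be well-formed for every input size; the minima take care of inputs that are shorter
  than their classical part.
\<close>

definition split_alg :: "(nat \<Rightarrow> nat \<Rightarrow> nat) \<Rightarrow> qalg \<Rightarrow> qalg" where
  "split_alg split A l k = split_circ k (min (vkl l) k) (split l k) (A l k)"

definition split_pos :: "(nat \<Rightarrow> nat \<Rightarrow> nat) \<Rightarrow> nat \<Rightarrow> nat \<Rightarrow> nat" where
  "split_pos split l k = min (vkl l) k + split l k"

lemma qpt_split_alg:
  assumes "qpt_bipartite A split" shows "qpt_bipartite (split_alg split A) (split_pos split)"
proof -
  from assms have A: "uniform_circ A" "\<And>l k. qcirc_wf k (A l k)" and s: "pnat split" "\<And>l k. split l k \<le> q_out (A l k)"
    unfolding qpt_bipartite_def qpt_def by auto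
  have n: "pnat (\<lambda>l k. min (vkl l) k)" by (intro pnat_min pnat_lengths pnat_snd)
  have "uniform_circ (split_alg split A)"
    unfolding split_alg_def by (rule uniform_split_circ[OF pnat_snd n s(1) A(1)])
  moreover have "qcirc_wf k (split_alg split A l k)" for l k
    unfolding split_alg_def by (rule qcirc_wf_split_circ) (auto simp: A s)
  moreover have "pnat (split_pos split)" unfolding split_pos_def by (intro pnat_add n s)
  moreover have "split_pos split l k \<le> q_out (split_alg split A l k)" for l k
    unfolding split_pos_def split_alg_def q_out_split_circ using s(2)[of l k] by simp
  ultimately show ?thesis unfolding qpt_bipartite_def qpt_def by blast
qed

definition verify_alg :: "qalg \<Rightarrow> qalg" where
  "verify_alg B l k = (let m = min (\<mu> l) k; n = min (vkl l) (k - m) in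
     verify_circ k m n (vkl l + \<mu> l + sgl l) (ds_verify DS l) (B l (k - n)))"

lemma qpt_verify_alg:
  assumes "qpt B" shows "qpt (verify_alg B)" "q_out (verify_alg B l k) = 1"
proof -
  from assms have B: "uniform_circ B" "\<And>l k. qcirc_wf k (B l k)" unfolding qpt_def by auto
  have m: "pnat (\<lambda>l k. min (\<mu> l) k)" by (intro pnat_min pnat_lengths pnat_snd)
  then have n: "pnat (\<lambda>l k. min (vkl l) (k - min (\<mu> l) k))"
    by (intro pnat_min pnat_diff pnat_lengths pnat_snd)
  have "uniform_circ (verify_alg B)"
    unfolding verify_alg_def Let_def
    by (rule uniform_verify_circ[OF pnat_snd m n _ polytime_circuits(4) uniform_subst[OF B(1)]])
      (intro pnat_add pnat_lengths pnat_diff n pnat_snd)+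
  moreover have "qcirc_wf k (verify_alg B l k)" for l k
    unfolding verify_alg_def Let_def
    by (rule qcirc_wf_verify_circ) (use verify_wf[of l] in \<open>auto simp: B bcirc_wf_def\<close>)
  ultimately show "qpt (verify_alg B)" unfolding qpt_def by blast
  show "q_out (verify_alg B l k) = 1" unfolding verify_alg_def Let_def by (rule q_out_verify_circ)
qed

text \<open>Exchanging the registers makes a forger that uses \<open>C\<close> an instance of the one that uses \<open>B\<close>.\<close>

definition swap_alg :: "(nat \<Rightarrow> nat \<Rightarrow> nat) \<Rightarrow> qalg \<Rightarrow> qalg" where
  "swap_alg split A l k =
    then_circ k (A l k) (rot_circ (q_out (A l k)) 0 (split l k) (q_out (A l k) - split l k)) 0"

definition swap_pos :: "(nat \<Rightarrow> nat \<Rightarrow> nat) \<Rightarrow> qalg \<Rightarrow> nat \<Rightarrow> nat \<Rightarrow> nat" where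
  "swap_pos split A l k = q_out (A l k) - split l k"

lemma q_out_swap_alg [simp]: "q_out (swap_alg split A l k) = q_out (A l k)"
  unfolding swap_alg_def by simp

lemma qpt_swap_alg:
  assumes "qpt_bipartite A split" shows "qpt_bipartite (swap_alg split A) (swap_pos split A)"
proof -
  from assms have A: "uniform_circ A" "\<And>l k. qcirc_wf k (A l k)" and s: "pnat split"
    unfolding qpt_bipartite_def qpt_def by auto
  note q = polytime_enc_qcirc_parts(2)[OF A(1)]
  have "uniform_circ (swap_alg split A)"
    unfolding swap_alg_def
    by (intro uniform_then_circ uniform_rot_circ A q s pnat_diff pnat_snd pnat_const)
  moreover have "qcirc_wf k (swap_alg split A l k)" for l k
    unfolding swap_alg_def by (rule qcirc_wf_then_circ) (simp_all add: A qcirc_wf_rot_circ)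
  moreover have "pnat (swap_pos split A)" unfolding swap_pos_def by (intro pnat_diff q s)
  moreover have "swap_pos split A l k \<le> q_out (swap_alg split A l k)" for l k
    by (simp add: swap_pos_def)
  ultimately show ?thesis unfolding qpt_bipartite_def qpt_def by blast
qed

text \<open>All register sizes can be computed from \<open>l\<close> and \<open>k\<close>: what the
  message and \<open>vk\<close> leave of the input is the punctured key, and its length determines
  the length of the circuit description.\<close>

definition forge_alg :: "qalg \<Rightarrow> qalg \<Rightarrow> (nat \<Rightarrow> nat \<Rightarrow> nat) \<Rightarrow> qalg \<Rightarrow> qalg" where
  "forge_alg Obf A split B l k =
    (let m = min (\<mu> l) k; n = min (vkl l) (k - m); f = enc_bcirc (ds_sign_star DS l);
         O' = Obf l (2 * (k - m - n) + length f); w = q_out O' + n in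
     forge_circ k m n f O' (A l w) (split l w) (B l (m + split l w)))"

lemma qpt_forge_alg:
  assumes "qpt Obf" "qpt_bipartite A split" "qpt B" "\<And>l k. q_out (B l k) = sgl l"
  shows "qpt (forge_alg Obf A split B)" "q_out (forge_alg Obf A split B l k) = sgl l"
proof -
  from assms have A: "uniform_circ A" "\<And>l k. qcirc_wf k (A l k)" and s: "pnat split" "\<And>l k. split l k \<le> q_out (A l k)"
    and O: "uniform_circ Obf" "\<And>l k. qcirc_wf k (Obf l k)" and B: "uniform_circ B" "\<And>l k. qcirc_wf k (B l k)"
    unfolding qpt_bipartite_def qpt_def by auto
  define m where "m = (\<lambda>l k. min (\<mu> l) k)"
  define n where "n = (\<lambda>l k. min (vkl l) (k - m l k))"
  define f where "f = (\<lambda>l (_::nat). enc_bcirc (ds_sign_star DS l))"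
  define O' where "O' = (\<lambda>l k. Obf l (2 * (k - m l k - n l k) + length (f l k)))"
  define w where "w = (\<lambda>l k. q_out (O' l k) + n l k)"
  have m: "pnat m" unfolding m_def by (intro pnat_min pnat_lengths pnat_snd)
  then have n: "pnat n" unfolding n_def by (intro pnat_min pnat_diff pnat_lengths pnat_snd)
  have f: "polytime f" unfolding f_def by (rule polytime_circuits)
  have O': "uniform_circ O'"
    unfolding O'_def mult_2
    by (rule uniform_subst[OF O(1)]) (intro pnat_add pnat_diff pnat_length f m n pnat_snd)
  have w: "pnat w" unfolding w_def by (intro pnat_add polytime_enc_qcirc_parts(2)[OF O'] n)
  have A': "uniform_circ (\<lambda>l k. A l (w l k))" by (rule uniform_subst[OF A(1) w])
  have s': "pnat (\<lambda>l k. split l (w l k))" by (rule polytime_subst[OF s(1) pnat_fst w])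
  have B1: "uniform_circ (\<lambda>l k. B l (m l k + split l (w l k)))"
    by (rule uniform_subst[OF B(1)]) (intro pnat_add m s')
  have e1: "forge_alg Obf A split B = (\<lambda>l k. forge_circ k (m l k) (n l k) (f l k) (O' l k) (A l (w l k))
      (split l (w l k)) (B l (m l k + split l (w l k))))"
    unfolding forge_alg_def Let_def w_def O'_def f_def n_def m_def by (intro ext) simp
  have wfP: "qcirc_wf k (pirate_circ k (m l k) (n l k) (f l k) (O' l k) (A l (w l k)))" for l k
    by (rule qcirc_wf_pirate_circ) (auto simp: m_def n_def w_def A O'_def O)
  show "qpt (forge_alg Obf A split B)"
    unfolding qpt_def e1 using uniform_forge_circ[OF pnat_snd m n f O' A' s' B1]
    by (auto intro!: qcirc_wf_forge_circ wfP s B)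
  show "q_out (forge_alg Obf A split B l k) = sgl l" unfolding e1 by (simp add: assms)
qed

end

section \<open>The scheme and its pirates\<close>

text \<open>The key enters only through its length, so one and the same circuit of
  \<open>Obf\<close> serves all keys.\<close>

lemma length_enc_hardwire: "length (enc_bcirc (hardwire x F)) = 2 * length x + length (enc_bcirc F)"
proof -
  have "length (enc_bcirc (map Const x)) = 2 * length x" by (induction x) auto
  then show ?thesis by (simp add: hardwire_def)
qed

lemma obf_state_eq:
  "obf_state Obf l G = sop_of (Obf l (length (enc_bcirc G))) (enc_bcirc G) (enc_bcirc G)"
  unfolding obf_state_def qrun_def by (intro ext sop_apply_basis_state) simp

lemma psd_obf_state: "psd n (obf_state Obf l G)"
  unfolding obf_state_def qrun_def by (rule psd_sop_of) (rule psd_basis_state, simp)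

text \<open>Linearity in the state, used for the mixture over \<open>vk\<close>.\<close>

lemma split_prob_sum:
  assumes "\<And>x y. length x = a + b \<Longrightarrow> length y = a + b \<Longrightarrow> \<sigma> x y = (\<Sum>i\<in>I. complex_of_real (c i) * \<tau> i x y)"
  shows "split_prob B C l a b m m' \<sigma> u v = (\<Sum>i\<in>I. c i * split_prob B C l a b m m' (\<tau> i) u v)"
proof -
  have "sop_apply (a + b) \<Phi> \<sigma> z z = (\<Sum>i\<in>I. complex_of_real (c i) * sop_apply (a + b) \<Phi> (\<tau> i) z z)" for \<Phi> z
  proof -
    have "sop_apply (a + b) \<Phi> \<sigma> z z =
        (\<Sum>x\<in>words (a + b). \<Sum>y\<in>words (a + b). \<Sum>i\<in>I. complex_of_real (c i) * (\<Phi> x y z z * \<tau> i x y))"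
      unfolding sop_apply_def
      by (intro sum.cong refl) (simp add: assms sum_distrib_left mult.left_commute)
    also have "\<dots> = (\<Sum>i\<in>I. \<Sum>x\<in>words (a + b). \<Sum>y\<in>words (a + b). complex_of_real (c i) * (\<Phi> x y z z * \<tau> i x y))"
      by (rule sum_rotate3)
    finally show ?thesis unfolding sop_apply_def sum_distrib_left .
  qed
  then show ?thesis unfolding split_prob_def Let_def meas_def by (simp add: Re_sum)
qed

context signature_scheme
begin

text \<open>Key generation is a circuit with input \<open>sk\<close>, whereas \<open>Obf\<close>
  expects the description of a circuit; \<open>qkeygen_circ\<close> writes this description
  first.\<close>

definition cp_scheme :: "qalg \<Rightarrow> qalg \<Rightarrow> cpds" where
  "cp_scheme Obf Eval = \<lparr>cp_msglen = \<mu>, cp_siglen = sgl, cp_sklen = skl, cp_vklen = vkl, cp_gen = ds_gen DS,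
     cp_qkeygen = (\<lambda>l k. qkeygen_circ Obf l k (enc_bcirc (ds_sign DS l))), cp_sign = Eval,
     cp_verify = ds_verify DS\<rparr>"

lemma cp_scheme_simps [simp]:
  "cp_msglen (cp_scheme Obf Eval) = \<mu>" "cp_siglen (cp_scheme Obf Eval) = sgl"
  "cp_sklen (cp_scheme Obf Eval) = skl" "cp_vklen (cp_scheme Obf Eval) = vkl"
  "cp_gen (cp_scheme Obf Eval) = ds_gen DS" "cp_sign (cp_scheme Obf Eval) = Eval"
  "cp_verify (cp_scheme Obf Eval) = ds_verify DS"
  unfolding cp_scheme_def by simp_all

lemma cp_key_qubits_eq:
  assumes "length sk = skl l"
  shows "cp_key_qubits (cp_scheme Obf Eval) l = obf_qubits Obf l (sign_circ DS l sk)"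
  using assms unfolding cp_key_qubits_def obf_qubits_def sign_circ_def length_enc_hardwire
  by (simp add: cp_scheme_def qkeygen_circ_def)

lemma cp_key_state_eq:
  assumes "qpt Obf" "length sk = skl l"
  shows "cp_key_state (cp_scheme Obf Eval) l sk = obf_state Obf l (sign_circ DS l sk)"
proof -
  let ?f = "enc_bcirc (ds_sign DS l)"
  have "cp_key_state (cp_scheme Obf Eval) l sk = sop_of (qkeygen_circ Obf l (length sk) ?f) sk sk"
    unfolding cp_key_state_def qrun_def cp_scheme_def by (intro ext) (simp add: sop_apply_basis_state)
  also have "\<dots> = sop_of (Obf l (2 * length sk + length ?f)) (enc_bcirc (hardwire sk (ds_sign DS l)))
      (enc_bcirc (hardwire sk (ds_sign DS l)))"
    by (rule sop_of_qkeygen_circ) (use assms in \<open>auto simp: qpt_def\<close>)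
  finally show ?thesis unfolding obf_state_eq sign_circ_def length_enc_hardwire .
qed

lemma cp_efficient_cp_scheme:
  assumes O: "qpt Obf" and E: "qpt Eval" "\<And>l k. sgl l \<le> q_out (Eval l k)"
  shows "cp_efficient (cp_scheme Obf Eval)"
proof -
  have O: "uniform_circ Obf" "\<And>l k. qcirc_wf k (Obf l k)" using assms unfolding qpt_def by auto
  have f: "polytime (\<lambda>l _. enc_bcirc (ds_sign DS l))" by (rule polytime_circuits)
  have 1: "uniform_circ (\<lambda>l k. Obf l (k + k + length (enc_bcirc (ds_sign DS l))))"
    by (rule uniform_subst[OF O(1)]) (intro pnat_add pnat_snd pnat_length f)
  have "uniform_circ (\<lambda>l k. qkeygen_circ Obf l k (enc_bcirc (ds_sign DS l)))"
    unfolding qkeygen_circ_def mult_2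
    by (intro uniform_then_circ uniform_enc_circ 1 pnat_snd pnat_const f)
  moreover have "qcirc_wf k (qkeygen_circ Obf l k (enc_bcirc (ds_sign DS l)))" for l k
    unfolding qkeygen_circ_def by (rule qcirc_wf_then_circ) (simp_all add: qcirc_wf_enc_circ O)
  ultimately have "qpt (cp_qkeygen (cp_scheme Obf Eval))" unfolding qpt_def cp_scheme_def by simp
  then show ?thesis
    using assms efficient unfolding cp_efficient_def ds_efficient_def by simp
qed

end

locale piracy = signature_scheme +
  fixes Obf A :: qalg and split :: "nat \<Rightarrow> nat \<Rightarrow> nat" and B C :: qalg
  assumes Obf: "qpt Obf" and A: "qpt_bipartite A split"
    and B: "qpt B" "\<And>l k. q_out (B l k) = ds_siglen DS l"
    and C: "qpt C" "\<And>l k. q_out (C l k) = ds_siglen DS l"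
begin

definition width :: "nat \<Rightarrow> bcirc \<Rightarrow> nat" where
  "width l G = obf_qubits Obf l G + vkl l"

definition left :: "nat \<Rightarrow> bcirc \<Rightarrow> nat" where
  "left l G = split l (width l G)"

definition right :: "nat \<Rightarrow> bcirc \<Rightarrow> nat" where
  "right l G = q_out (A l (width l G)) - left l G"

definition pirate_state :: "nat \<Rightarrow> bcirc \<Rightarrow> bits \<Rightarrow> qop" where
  "pirate_state l G vk = sop_apply (width l G) (sop_of (A l (width l G)))
     (qop_tensor (obf_qubits Obf l G) (obf_state Obf l G) (basis_state vk))"

text \<open>Joint distribution of the two outputs of the pirates that are given the obfuscation of \<open>G\<close>\<close>

definition forged :: "nat \<Rightarrow> bcirc \<Rightarrow> bits \<Rightarrow> bits \<Rightarrow> bits \<Rightarrow> bits \<Rightarrow> bits \<Rightarrow> real" where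
  "forged l G vk m m' s s' = split_prob B C l (left l G) (right l G) m m' (pirate_state l G vk) s s'"

text \<open>\<open>b\<close> is the bit that a verifying party answers, so \<open>b = False\<close>
  collects the accepted signatures.\<close>

definition verdict :: "nat \<Rightarrow> bool \<Rightarrow> bits \<Rightarrow> bits \<Rightarrow> bits set" where
  "verdict l b vk m = {s \<in> words (sgl l). accepts (ds_verify DS) l vk m s = (\<not> b)}"

lemma wf: "qcirc_wf k (Obf l k)" "qcirc_wf k (A l k)" "qcirc_wf k (B l k)" "qcirc_wf k (C l k)"
  "split l k \<le> q_out (A l k)"
  using Obf A B C unfolding qpt_bipartite_def qpt_def by auto

lemma left_right: "left l G \<le> q_out (A l (width l G))" "left l G + right l G = q_out (A l (width l G))"
  unfolding left_def right_def using wf(5) by simp_all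

lemma finite_verdict [simp]: "finite (verdict l b vk m)"
  by (rule finite_subset[of _ "words (sgl l)"]) (auto simp: verdict_def)

lemma sum_verdict: "(\<Sum>s\<in>words (sgl l). f s) = (\<Sum>s\<in>verdict l False vk m. f s) + (\<Sum>s\<in>verdict l True vk m. f s)"
proof -
  have "words (sgl l) = verdict l False vk m \<union> verdict l True vk m"
    "verdict l False vk m \<inter> verdict l True vk m = {}"
    unfolding verdict_def by auto
  then show ?thesis by (simp add: sum.union_disjoint)
qed

lemma forged_nonneg: "length vk = vkl l \<Longrightarrow> 0 \<le> forged l G vk m m' s s'"
  unfolding forged_def pirate_state_def width_def
  by (intro split_prob_nonneg psd_sop_of psd_qop_tensor psd_obf_state)

text \<open>Trace 1 passes from the description of \<open>G\<close> through \<open>Obf\<close>, the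
  adjoined \<open>vk\<close> and \<open>A\<close> to the pirate state, and both parties preserve
  it.\<close>

lemma sum_forged:
  assumes "length vk = vkl l" "length m = \<mu> l" "length m' = \<mu> l"
  shows "(\<Sum>s\<in>words (sgl l). \<Sum>s'\<in>words (sgl l). forged l G vk m m' s s') = 1"
proof -
  have "(\<Sum>s\<in>words (sgl l). \<Sum>s'\<in>words (sgl l). forged l G vk m m' s s') =
      Re (trace_words (left l G + right l G) (pirate_state l G vk))"
    unfolding forged_def
    using sum_split_prob[where B = B and C = C and l = l and m = m and m' = m' and a = "left l G" and b = "right l G", OF wf(3,4)] B(2) C(2)
    by simp
  also have "trace_words (left l G + right l G) (pirate_state l G vk) = trace_words (width l G)
      (qop_tensor (obf_qubits Obf l G) (obf_state Obf l G) (basis_state vk))"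
    unfolding left_right pirate_state_def by (rule trace_sop_apply[OF wf(2)])
  also have "\<dots> = trace_words (obf_qubits Obf l G) (obf_state Obf l G)"
    unfolding width_def by (rule trace_qop_tensor) (use assms in simp)
  also have "\<dots> = trace_words (length (enc_bcirc G)) (basis_state (enc_bcirc G))"
    unfolding obf_qubits_def obf_state_def qrun_def by (rule trace_sop_apply[OF wf(1)])
  finally show ?thesis by (simp add: trace_basis_state)
qed

lemma piracy_prob_eq:
  "piracy_prob (cp_scheme Obf Eval) A split B C l =
    measure_pmf.expectation (ds_keys DS l) (\<lambda>(sk, vk).
      measure_pmf.expectation (uniform_pair \<mu> l) (\<lambda>(m, m').
        \<Sum>s\<in>verdict l False vk m. \<Sum>s'\<in>verdict l False vk m'. forged l (sign_circ DS l sk) vk m m' s s'))"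
  unfolding piracy_prob_def cp_scheme_simps
proof (intro expectation_cong, clarsimp simp only: prod.case Let_def)
  fix sk vk assume keys: "(sk, vk) \<in> set_pmf (ds_keys DS l)"
  then have sk: "length sk = skl l" and vk: "length vk = vkl l" using ds_keys_lengths by auto
  show "measure_pmf.expectation (uniform_pair \<mu> l) (\<lambda>(mB, mC).
      \<Sum>sB\<in>{s \<in> words (sgl l). accepts (ds_verify DS) l vk mB s}. \<Sum>sC\<in>{s \<in> words (sgl l). accepts (ds_verify DS) l vk mC s}.
        split_prob B C l (split l (cp_key_qubits (cp_scheme Obf Eval) l + length vk))
          (q_out (A l (cp_key_qubits (cp_scheme Obf Eval) l + length vk)) - split l (cp_key_qubits (cp_scheme Obf Eval) l + length vk)) mB mC
          (qrun A l (cp_key_qubits (cp_scheme Obf Eval) l + length vk)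
            (qop_tensor (cp_key_qubits (cp_scheme Obf Eval) l) (cp_key_state (cp_scheme Obf Eval) l sk) (basis_state vk))) sB sC) =
    measure_pmf.expectation (uniform_pair \<mu> l) (\<lambda>(m, m').
        \<Sum>s\<in>verdict l False vk m. \<Sum>s'\<in>verdict l False vk m'. forged l (sign_circ DS l sk) vk m m' s s')"
    unfolding cp_key_qubits_eq[OF sk] cp_key_state_eq[OF Obf sk] vk verdict_def forged_def pirate_state_def
      right_def left_def width_def qrun_def by simp
qed

lemma sop_of_verify_alg:
  assumes X: "qpt X" "\<And>l k. q_out (X l k) = sgl l"
    and len: "length m = \<mu> l" "length vk = vkl l" "length x = a" "length y = a"
  shows "sop_of (verify_alg X l (\<mu> l + (vkl l + a))) (m @ vk @ x) (m @ vk @ y) [b] [b] =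
    (\<Sum>s\<in>verdict l b vk m. sop_of (X l (\<mu> l + a)) (m @ x) (m @ y) s s)"
proof -
  \<comment> \<open>At the intended input size the minima in \<open>verify_alg\<close> are the true
    lengths.\<close>
  have e: "verify_alg X l (\<mu> l + (vkl l + a)) =
      verify_circ (\<mu> l + (vkl l + a)) (\<mu> l) (vkl l) (vkl l + \<mu> l + q_out (X l (\<mu> l + a))) (ds_verify DS l) (X l (\<mu> l + a))"
    unfolding verify_alg_def Let_def X(2) by (simp add: min_absorb1)
  have "sop_of (verify_alg X l (\<mu> l + (vkl l + a))) (m @ vk @ x) (m @ vk @ y) [b] [b] =
    (\<Sum>\<sigma>\<in>{\<sigma> \<in> words (q_out (X l (\<mu> l + a))). (beval 1 (ds_verify DS l) (vk @ m @ \<sigma>) = [True]) = (\<not> b)}.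
      sop_of (X l (\<mu> l + a)) (m @ x) (m @ y) \<sigma> \<sigma>)"
    unfolding e
    by (rule sop_of_verify_circ) (use X len verify_wf in \<open>auto simp: qpt_def\<close>)
  then show ?thesis unfolding verdict_def accepts_def X(2) .
qed

text \<open>The state handed over after the outcome \<open>sk\<close> is diagonal in
  \<open>vk\<close>, so the bipartite state is a mixture of pirate states, each with its
  \<open>vk\<close> copied in front of both registers.\<close>

lemma split_state_eq:
  assumes sk: "length sk = skl l"
    and len: "length v1 = vkl l" "length v2 = vkl l" "length v3 = vkl l" "length v4 = vkl l"
      "length uB = left l G" "length vB = left l G" "length uC = right l G" "length vC = right l G"
  shows "qrun (split_alg split A) l (width l G)
      (qop_tensor (vkl l) (post sk (qrun gen_alg l 0 (basis_state []))) (obf_state Obf l G))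
      (v1 @ uB @ v2 @ uC) (v3 @ vB @ v4 @ vC) =
    (\<Sum>vk\<in>words (vkl l). complex_of_real (pmf (ds_keys DS l) (sk, vk)) *
      (if v1 = vk \<and> v2 = vk \<and> v3 = vk \<and> v4 = vk then pirate_state l G vk (uB @ uC) (vB @ vC) else 0))"
proof -
  let ?n = "vkl l" and ?q = "obf_qubits Obf l G" and ?\<rho> = "obf_state Obf l G"
  let ?st = "post sk (qrun gen_alg l 0 (basis_state []))"
  let ?U = "v1 @ uB @ v2 @ uC" and ?V = "v3 @ vB @ v4 @ vC"
  let ?p = "\<lambda>vk. complex_of_real (pmf (ds_keys DS l) (sk, vk))"
  let ?A = "A l (width l G)"
  have W: "width l G = ?n + ?q" unfolding width_def by simp
  have st: "?st v v' = (if v' = v then ?p v else 0)" if "length v = ?n" "length v' = ?n" for v v'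
    unfolding post_def qrun_def using sop_of_gen_alg[OF sk that] by (simp add: sop_apply_basis_state)
  have S: "split_alg split A l (width l G) = split_circ (width l G) ?n (left l G) ?A"
    unfolding split_alg_def left_def by (simp add: W min_absorb1)
  have sop: "sop_of (split_alg split A l (width l G)) (v @ x) (v @ y) ?U ?V =
      (if v1 = v \<and> v2 = v \<and> v3 = v \<and> v4 = v then sop_of ?A (x @ v) (y @ v) (uB @ uC) (vB @ vC) else 0)"
    if "length v = ?n" "length x = ?q" "length y = ?q" for v x y
    unfolding S by (rule sop_of_split_circ) (use that len left_right[of l G] W in \<open>auto simp: wf right_def\<close>)
  have "qrun (split_alg split A) l (width l G) (qop_tensor ?n ?st ?\<rho>) ?U ?V =
    (\<Sum>v\<in>words ?n. \<Sum>x\<in>words ?q. \<Sum>v'\<in>words ?n. \<Sum>y\<in>words ?q.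
      if v' = v then sop_of (split_alg split A l (width l G)) (v @ x) (v @ y) ?U ?V * (?p v * ?\<rho> x y) else 0)"
    unfolding qrun_def[of "split_alg split A"] sop_apply_def W sum_words_add
    by (intro sum.cong refl) (auto simp: qop_tensor_def st)
  also have "\<dots> = (\<Sum>v\<in>words ?n. \<Sum>x\<in>words ?q. \<Sum>y\<in>words ?q.
      sop_of (split_alg split A l (width l G)) (v @ x) (v @ y) ?U ?V * (?p v * ?\<rho> x y))"
    by (rule sum.cong[OF refl], rule sum.cong[OF refl]) (simp add: sum_if_const sum.delta)
  also have "\<dots> = (\<Sum>v\<in>words ?n. ?p v *
      (if v1 = v \<and> v2 = v \<and> v3 = v \<and> v4 = v then pirate_state l G v (uB @ uC) (vB @ vC) else 0))"
  proof (intro sum.cong refl)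
    fix v assume v: "v \<in> words ?n"
    have "(\<Sum>x\<in>words ?q. \<Sum>y\<in>words ?q. sop_of (split_alg split A l (width l G)) (v @ x) (v @ y) ?U ?V * (?p v * ?\<rho> x y)) =
      (\<Sum>x\<in>words ?q. \<Sum>y\<in>words ?q. ?p v * (if v1 = v \<and> v2 = v \<and> v3 = v \<and> v4 = v
        then sop_of ?A (x @ v) (y @ v) (uB @ uC) (vB @ vC) * ?\<rho> x y else 0))"
      using v by (intro sum.cong refl) (auto simp: sop)
    also have "\<dots> = ?p v * (if v1 = v \<and> v2 = v \<and> v3 = v \<and> v4 = v
        then \<Sum>x\<in>words ?q. \<Sum>y\<in>words ?q. sop_of ?A (x @ v) (y @ v) (uB @ uC) (vB @ vC) * ?\<rho> x y else 0)"
      unfolding sum_distrib_left[symmetric] sum_if_const ..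
    also have "(\<Sum>x\<in>words ?q. \<Sum>y\<in>words ?q. sop_of ?A (x @ v) (y @ v) (uB @ uC) (vB @ vC) * ?\<rho> x y) =
        pirate_state l G v (uB @ uC) (vB @ vC)"
      unfolding pirate_state_def sop_apply_def width_def
      by (rule sum_qop_tensor_basis[symmetric]) (use v in simp)
    finally show "(\<Sum>x\<in>words ?q. \<Sum>y\<in>words ?q. sop_of (split_alg split A l (width l G)) (v @ x) (v @ y) ?U ?V * (?p v * ?\<rho> x y)) =
      ?p v * (if v1 = v \<and> v2 = v \<and> v3 = v \<and> v4 = v then pirate_state l G v (uB @ uC) (vB @ vC) else 0)" .
  qed
  finally show ?thesis .
qed

text \<open>\<open>\<tau>\<close> is one component of that mixture. Its four copies of
  \<open>vk\<close> are pinned, after which the answer \<open>b\<close> of each party becomes a sum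
  over the signatures with that verdict.\<close>

lemma split_prob_verify:
  assumes len: "length m = \<mu> l" "length m' = \<mu> l" "length vk = vkl l"
    and \<tau>: "\<And>v1 v2 v3 v4 uB uC vB vC. length v1 = vkl l \<Longrightarrow> length v2 = vkl l \<Longrightarrow> length v3 = vkl l \<Longrightarrow> length v4 = vkl l \<Longrightarrow>
      length uB = left l G \<Longrightarrow> length vB = left l G \<Longrightarrow>
      \<tau> (v1 @ uB @ v2 @ uC) (v3 @ vB @ v4 @ vC) =
      (if v1 = vk \<and> v2 = vk \<and> v3 = vk \<and> v4 = vk then pirate_state l G vk (uB @ uC) (vB @ vC) else 0)"
  shows "split_prob (verify_alg B) (verify_alg C) l (vkl l + left l G) (vkl l + right l G) m m' \<tau> [b] [b] =
    (\<Sum>s\<in>verdict l b vk m. \<Sum>s'\<in>verdict l b vk m'. forged l G vk m m' s s')"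
proof -
  let ?n = "vkl l" and ?a = "left l G" and ?b = "right l G"
  let ?VB = "verify_alg B l (\<mu> l + (?n + ?a))" and ?VC = "verify_alg C l (\<mu> l + (?n + ?b))"
  let ?B = "B l (\<mu> l + ?a)" and ?C = "C l (\<mu> l + ?b)"
  let ?P = "pirate_state l G vk"
  have "split_prob (verify_alg B) (verify_alg C) l (?n + ?a) (?n + ?b) m m' \<tau> [b] [b] =
    Re (\<Sum>x\<in>words (?n + ?a). \<Sum>c\<in>words (?n + ?b). \<Sum>y\<in>words (?n + ?a). \<Sum>d\<in>words (?n + ?b).
      sop_of ?VB (m @ x) (m @ y) [b] [b] * sop_of ?VC (m' @ c) (m' @ d) [b] [b] * \<tau> (x @ c) (y @ d))"
    by (subst split_prob_eq) (simp_all add: qpt_verify_alg[OF B(1)] len)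
  also have "(\<Sum>x\<in>words (?n + ?a). \<Sum>c\<in>words (?n + ?b). \<Sum>y\<in>words (?n + ?a). \<Sum>d\<in>words (?n + ?b).
      sop_of ?VB (m @ x) (m @ y) [b] [b] * sop_of ?VC (m' @ c) (m' @ d) [b] [b] * \<tau> (x @ c) (y @ d)) =
    (\<Sum>v1\<in>words ?n. \<Sum>uB\<in>words ?a. \<Sum>v2\<in>words ?n. \<Sum>uC\<in>words ?b. \<Sum>v3\<in>words ?n. \<Sum>vB\<in>words ?a. \<Sum>v4\<in>words ?n. \<Sum>vC\<in>words ?b.
      if v1 = vk then if v2 = vk then if v3 = vk then if v4 = vk then
        sop_of ?VB (m @ vk @ uB) (m @ vk @ vB) [b] [b] * sop_of ?VC (m' @ vk @ uC) (m' @ vk @ vC) [b] [b] * ?P (uB @ uC) (vB @ vC)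
      else 0 else 0 else 0 else 0)"
    unfolding sum_words_add by (intro sum.cong refl) (auto simp: \<tau>)
  also have "\<dots> = (\<Sum>uB\<in>words ?a. \<Sum>uC\<in>words ?b. \<Sum>vB\<in>words ?a. \<Sum>vC\<in>words ?b.
        sop_of ?VB (m @ vk @ uB) (m @ vk @ vB) [b] [b] * sop_of ?VC (m' @ vk @ uC) (m' @ vk @ vC) [b] [b] * ?P (uB @ uC) (vB @ vC))"
    using len(3) by (simp only: sum_if_const sum.delta finite_words words_iff simp_thms if_True)
  also have "\<dots> = (\<Sum>uB\<in>words ?a. \<Sum>uC\<in>words ?b. \<Sum>vB\<in>words ?a. \<Sum>vC\<in>words ?b.
        \<Sum>s\<in>verdict l b vk m. \<Sum>s'\<in>verdict l b vk m'.
          sop_of ?B (m @ uB) (m @ vB) s s * sop_of ?C (m' @ uC) (m' @ vC) s' s' * ?P (uB @ uC) (vB @ vC))"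
  proof (intro sum.cong refl)
    fix uB uC vB vC assume "uB \<in> words ?a" "uC \<in> words ?b" "vB \<in> words ?a" "vC \<in> words ?b"
    then have 1: "sop_of ?VB (m @ vk @ uB) (m @ vk @ vB) [b] [b] = (\<Sum>s\<in>verdict l b vk m. sop_of ?B (m @ uB) (m @ vB) s s)"
      and 2: "sop_of ?VC (m' @ vk @ uC) (m' @ vk @ vC) [b] [b] = (\<Sum>s\<in>verdict l b vk m'. sop_of ?C (m' @ uC) (m' @ vC) s s)"
      by (simp_all add: sop_of_verify_alg[OF B] sop_of_verify_alg[OF C] len)
    show "sop_of ?VB (m @ vk @ uB) (m @ vk @ vB) [b] [b] * sop_of ?VC (m' @ vk @ uC) (m' @ vk @ vC) [b] [b] * ?P (uB @ uC) (vB @ vC) =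
        (\<Sum>s\<in>verdict l b vk m. \<Sum>s'\<in>verdict l b vk m'.
          sop_of ?B (m @ uB) (m @ vB) s s * sop_of ?C (m' @ uC) (m' @ vC) s' s' * ?P (uB @ uC) (vB @ vC))"
      unfolding 1 2 sum_product unfolding sum_distrib_right ..
  qed
  also have "\<dots> = (\<Sum>s\<in>verdict l b vk m. \<Sum>uB\<in>words ?a. \<Sum>uC\<in>words ?b. \<Sum>vB\<in>words ?a. \<Sum>vC\<in>words ?b.
        \<Sum>s'\<in>verdict l b vk m'.
          sop_of ?B (m @ uB) (m @ vB) s s * sop_of ?C (m' @ uC) (m' @ vC) s' s' * ?P (uB @ uC) (vB @ vC))"
    by (rule sum_push4[symmetric])
  also have "\<dots> = (\<Sum>s\<in>verdict l b vk m. \<Sum>s'\<in>verdict l b vk m'. \<Sum>uB\<in>words ?a. \<Sum>uC\<in>words ?b. \<Sum>vB\<in>words ?a. \<Sum>vC\<in>words ?b.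
          sop_of ?B (m @ uB) (m @ vB) s s * sop_of ?C (m' @ uC) (m' @ vC) s' s' * ?P (uB @ uC) (vB @ vC))"
    by (rule sum.cong[OF refl]) (rule sum_push4[symmetric])
  also have "Re \<dots> = (\<Sum>s\<in>verdict l b vk m. \<Sum>s'\<in>verdict l b vk m'. forged l G vk m m' s s')"
    unfolding Re_sum[of _ "verdict l b vk m"] Re_sum[of _ "verdict l b vk m'"] forged_def
    by (intro sum.cong refl, subst split_prob_eq) (auto simp: B(2) len verdict_def)
  finally show ?thesis .
qed

text \<open>The left-hand side repeats the inner round of \<open>upo_prob\<close> so that it can be
  rewritten there. The weights are joint probabilities, as the state after the outcome
  \<open>sk\<close> is not normalised.\<close>

lemma upo_round_eq:
  assumes sk: "length sk = skl l" and len: "length m = \<mu> l" "length m' = \<mu> l"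
  shows "(let r = q_out (gen_alg l 0) - kc_keylen (sign_class DS) l;
           st = post sk (qrun gen_alg l 0 (basis_state []));
           q = r + obf_qubits Obf l G;
           \<sigma> = qrun (split_alg split A) l q (qop_tensor r st (obf_state Obf l G))
       in split_prob (verify_alg B) (verify_alg C) l (split_pos split l q)
           (q_out (split_alg split A l q) - split_pos split l q) m m' \<sigma> [b] [b]) =
    (\<Sum>vk\<in>words (vkl l). pmf (ds_keys DS l) (sk, vk) *
      (\<Sum>s\<in>verdict l b vk m. \<Sum>s'\<in>verdict l b vk m'. forged l G vk m m' s s'))"
proof -
  let ?n = "vkl l" and ?a = "left l G" and ?b = "right l G"
  have r: "q_out (gen_alg l 0) - kc_keylen (sign_class DS) l = ?n"
    by (simp add: q_out_gen_alg sign_class_def)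
  have q: "?n + obf_qubits Obf l G = width l G" unfolding width_def by simp
  have pos: "split_pos split l (width l G) = ?n + ?a"
    unfolding split_pos_def left_def width_def by simp
  have rest: "q_out (split_alg split A l (width l G)) - (?n + ?a) = ?n + ?b"
    unfolding split_alg_def q_out_split_circ right_def using left_right[of l G]
    by (simp add: width_def)
  \<comment> \<open>\<open>split_prob_sum\<close> requires a function of undivided words, hence the
    cutting with \<open>take\<close> and \<open>drop\<close>.\<close>
  define \<tau> where "\<tau> = (\<lambda>vk x y.
    if take ?n x = vk \<and> take ?n (drop (?n + ?a) x) = vk \<and> take ?n y = vk \<and> take ?n (drop (?n + ?a) y) = vk
    then pirate_state l G vk (take ?a (drop ?n x) @ drop (?n + ?a + ?n) x) (take ?a (drop ?n y) @ drop (?n + ?a + ?n) y)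
    else 0)"
  have \<tau>: "\<tau> vk (v1 @ uB @ v2 @ uC) (v3 @ vB @ v4 @ vC) =
      (if v1 = vk \<and> v2 = vk \<and> v3 = vk \<and> v4 = vk then pirate_state l G vk (uB @ uC) (vB @ vC) else 0)"
    if "length v1 = ?n" "length v2 = ?n" "length v3 = ?n" "length v4 = ?n" "length uB = ?a" "length vB = ?a"
    for vk v1 v2 v3 v4 uB uC vB vC
    using that unfolding \<tau>_def by auto
  have "qrun (split_alg split A) l (width l G)
      (qop_tensor ?n (post sk (qrun gen_alg l 0 (basis_state []))) (obf_state Obf l G)) x y =
    (\<Sum>vk\<in>words ?n. complex_of_real (pmf (ds_keys DS l) (sk, vk)) * \<tau> vk x y)"
    if xy: "length x = (?n + ?a) + (?n + ?b)" "length y = (?n + ?a) + (?n + ?b)" for x y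
  proof -
    obtain v1 uB v2 uC where x: "x = v1 @ uB @ v2 @ uC" "length v1 = ?n" "length uB = ?a" "length v2 = ?n" "length uC = ?b"
      by (rule split3[of ?n ?a ?n x]) (use xy in auto)
    obtain v3 vB v4 vC where y: "y = v3 @ vB @ v4 @ vC" "length v3 = ?n" "length vB = ?a" "length v4 = ?n" "length vC = ?b"
      by (rule split3[of ?n ?a ?n y]) (use xy in auto)
    show ?thesis
      unfolding x(1) y(1) using x y by (subst split_state_eq[OF sk]) (simp_all add: \<tau>)
  qed
  note lin = split_prob_sum[OF this]
  show ?thesis
    unfolding Let_def r q pos rest
    by (subst lin) (use len \<tau> in \<open>auto intro!: sum.cong simp: split_prob_verify\<close>)
qed

end

section \<open>Forgers from pirates, and the accounting of probabilities\<close>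

lemma set_pmf_uniform_pair: "(m, m') \<in> set_pmf (uniform_pair n l) \<Longrightarrow> length m = n l \<and> length m' = n l"
  unfolding uniform_pair_def by simp

lemma finite_uniform_pair: "finite (set_pmf (uniform_pair n l))"
  unfolding uniform_pair_def by simp

lemma expectation_uniform_pair_swap:
  "measure_pmf.expectation (uniform_pair n l) (\<lambda>(x, y). f y x) = measure_pmf.expectation (uniform_pair n l) (\<lambda>(x, y). (f x y :: real))"
proof -
  have "uniform_pair n l = map_pmf (\<lambda>(x, y). (y, x)) (uniform_pair n l)"
    unfolding uniform_pair_def by (subst pair_commute_pmf) (simp add: split_def)
  then have "measure_pmf.expectation (uniform_pair n l) (\<lambda>(x, y). f x y) =
      measure_pmf.expectation (map_pmf (\<lambda>(x, y). (y, x)) (uniform_pair n l)) (\<lambda>(x, y). f x y)"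
    by (rule arg_cong)
  then show ?thesis by (simp add: split_def)
qed

context piracy
begin

text \<open>The forger runs the pirate on the obfuscated punctured circuit and discards the second
  register. By no-signalling its output has the left marginal of \<open>forged\<close>, whatever the
  second message \<open>m'\<close> is.\<close>

lemma meas_forge_alg:
  assumes len: "length m = \<mu> l" "length vk = vkl l" "length pk = ds_pklen DS l"
    and s: "length s = sgl l" and m': "length m' = \<mu> l"
  shows "meas (qrun (forge_alg Obf A split B) l (length (m @ vk @ pk)) (basis_state (m @ vk @ pk))) s =
      (\<Sum>s'\<in>words (sgl l). forged l (sign_star_circ DS l pk) vk m m' s s')"
proof -
  let ?F = "ds_sign_star DS l" and ?p = "ds_pklen DS l"
  define G where "G = sign_star_circ DS l pk"
  define k where "k = \<mu> l + vkl l + ?p"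
  let ?f = "enc_bcirc ?F" and ?a = "left l G" and ?b = "right l G"
  let ?O = "Obf l (2 * ?p + length ?f)" and ?A = "A l (width l G)" and ?X = "m @ vk @ pk"
  have lG: "length (enc_bcirc G) = 2 * ?p + length ?f"
    unfolding G_def sign_star_circ_def length_enc_hardwire len by simp
  have q: "q_out ?O = obf_qubits Obf l G" unfolding obf_qubits_def lG ..
  have \<rho>: "sop_of ?O (enc_bcirc (hardwire pk ?F)) (enc_bcirc (hardwire pk ?F)) = obf_state Obf l G"
    unfolding obf_state_eq lG unfolding G_def sign_star_circ_def ..
  have lX: "length ?X = k" unfolding k_def using len by simp
  have mins: "min (\<mu> l) k = \<mu> l" "min (vkl l) (k - \<mu> l) = vkl l" "k - \<mu> l - vkl l = ?p"
    "q_out ?O + vkl l = width l G"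
    unfolding k_def q width_def by auto
  have e1: "forge_alg Obf A split B l k = forge_circ k (\<mu> l) (vkl l) ?f ?O ?A ?a (B l (\<mu> l + ?a))"
    unfolding forge_alg_def Let_def mins left_def ..
  have \<sigma>: "pirate_state l G vk = sop_apply (q_out ?O + vkl l) (sop_of ?A) (qop_tensor (q_out ?O)
      (sop_of ?O (enc_bcirc (hardwire pk ?F)) (enc_bcirc (hardwire pk ?F))) (basis_state vk))"
    unfolding \<rho> pirate_state_def q width_def ..
  have qA: "q_out ?A - ?a = ?b" unfolding right_def ..
  have "sop_of (forge_alg Obf A split B l k) ?X ?X s s =
    (\<Sum>c\<in>words ?b. \<Sum>z\<in>words ?a. \<Sum>z'\<in>words ?a. pirate_state l G vk (z @ c) (z' @ c) * sop_of (B l (\<mu> l + ?a)) (m @ z) (m @ z') s s)"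
    unfolding e1 qA[symmetric]
    by (rule sop_of_forge_circ[OF k_def wf(1) _ left_right(1) wf(3) refl len _ \<sigma>]) (simp_all add: s B wf mins(4))
  then have "meas (qrun (forge_alg Obf A split B) l (length ?X) (basis_state ?X)) s =
    Re (\<Sum>c\<in>words ?b. \<Sum>z\<in>words ?a. \<Sum>z'\<in>words ?a. pirate_state l G vk (z @ c) (z' @ c) * sop_of (B l (\<mu> l + ?a)) (m @ z) (m @ z') s s)"
    unfolding meas_def qrun_def lX sop_apply_basis_state[OF lX] by (simp only:)
  also have "\<dots> = (\<Sum>s'\<in>words (sgl l). forged l G vk m m' s s')"
    unfolding forged_def
    using sum_split_prob_right[where B = B and C = C and l = l and m = m and m' = m' and a = ?a and b = ?b and u = s
        and \<sigma> = "pirate_state l G vk", OF wf(4)] len m' s B(2) C(2)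
    by simp
  finally show "meas (qrun (forge_alg Obf A split B) l (length ?X) (basis_state ?X)) s =
      (\<Sum>s'\<in>words (sgl l). forged l (sign_star_circ DS l pk) vk m m' s s')" unfolding G_def .
qed

definition accept_left :: "nat \<Rightarrow> bcirc \<Rightarrow> bits \<Rightarrow> bits \<Rightarrow> bits \<Rightarrow> real" where
  "accept_left l G vk m m' = (\<Sum>s\<in>verdict l False vk m. \<Sum>s'\<in>words (sgl l). forged l G vk m m' s s')"

definition accept_right :: "nat \<Rightarrow> bcirc \<Rightarrow> bits \<Rightarrow> bits \<Rightarrow> bits \<Rightarrow> real" where
  "accept_right l G vk m m' = (\<Sum>s'\<in>verdict l False vk m'. \<Sum>s\<in>words (sgl l). forged l G vk m m' s s')"

definition agree :: "bool \<Rightarrow> nat \<Rightarrow> bcirc \<Rightarrow> bits \<Rightarrow> bits \<Rightarrow> bits \<Rightarrow> real" where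
  "agree b l G vk m m' = (\<Sum>s\<in>verdict l b vk m. \<Sum>s'\<in>verdict l b vk m'. forged l G vk m m' s s')"

lemma agree_nonneg: "length vk = vkl l \<Longrightarrow> 0 \<le> agree b l G vk m m'"
  unfolding agree_def by (intro sum_nonneg forged_nonneg)

text \<open>Union bound: the joint distribution has total mass 1, and an outcome that is not
  rejected twice is accepted on the left or on the right.\<close>

lemma reject_ge:
  assumes "length vk = vkl l" "length m = \<mu> l" "length m' = \<mu> l"
  shows "1 - accept_left l G vk m m' - accept_right l G vk m m' \<le> agree True l G vk m m'"
proof -
  let ?f = "forged l G vk m m'" and ?V = "\<lambda>b. verdict l b vk m" and ?V' = "\<lambda>b. verdict l b vk m'"
  have "1 = (\<Sum>s\<in>words (sgl l). \<Sum>s'\<in>words (sgl l). ?f s s')"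
    using sum_forged[OF assms] by simp
  also have "\<dots> = accept_left l G vk m m' + (\<Sum>s\<in>?V True. \<Sum>s'\<in>words (sgl l). ?f s s')"
    unfolding accept_left_def by (rule sum_verdict)
  also have "(\<Sum>s\<in>?V True. \<Sum>s'\<in>words (sgl l). ?f s s') =
      (\<Sum>s\<in>?V True. \<Sum>s'\<in>?V' False. ?f s s') + agree True l G vk m m'"
    unfolding agree_def sum.distrib[symmetric] by (intro sum.cong refl sum_verdict)
  finally have 1: "1 = accept_left l G vk m m' + ((\<Sum>s\<in>?V True. \<Sum>s'\<in>?V' False. ?f s s') + agree True l G vk m m')" .
  have "(\<Sum>s\<in>?V True. \<Sum>s'\<in>?V' False. ?f s s') = (\<Sum>s'\<in>?V' False. \<Sum>s\<in>?V True. ?f s s')"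
    by (rule sum.swap)
  also have "\<dots> \<le> accept_right l G vk m m'"
    unfolding accept_right_def
    by (intro sum_mono sum_mono2) (auto simp: verdict_def intro: forged_nonneg assms)
  finally show ?thesis using 1 by linarith
qed

text \<open>The marginal may be taken with any second message, in particular with the one at which
  the key was punctured.\<close>

lemma forge_prob_eq1:
  "forge_prob DS (forge_alg Obf A split B) l =
    measure_pmf.expectation (ds_keys DS l) (\<lambda>(sk, vk).
      measure_pmf.expectation (uniform_pair \<mu> l) (\<lambda>(m, m').
        measure_pmf.expectation (puncture_key DS l sk m m') (\<lambda>pk. accept_left l (sign_star_circ DS l pk) vk m m')))"
  unfolding forge_prob_def uniform_pair_def[symmetric]
proof (rule expectation_cong, unfold split_paired_all prod.case, rule expectation_cong,
    unfold split_paired_all prod.case, rule expectation_cong)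
  fix sk vk m m' pk
  assume keys: "(sk, vk) \<in> set_pmf (ds_keys DS l)" and mm: "(m, m') \<in> set_pmf (uniform_pair \<mu> l)"
    and pk: "pk \<in> set_pmf (puncture_key DS l sk m m')"
  have len: "length sk = skl l" "length vk = vkl l" "length m = \<mu> l" "length m' = \<mu> l"
    using ds_keys_lengths[OF keys] set_pmf_uniform_pair[OF mm] by auto
  have lpk: "length pk = ds_pklen DS l" using length_puncture_key[OF len(1,3,4) pk] .
  show "(\<Sum>\<sigma> | \<sigma> \<in> words (sgl l) \<and> accepts (ds_verify DS) l vk m \<sigma>.
      meas (qrun (forge_alg Obf A split B) l (length (m @ vk @ pk)) (basis_state (m @ vk @ pk))) \<sigma>) =
      accept_left l (sign_star_circ DS l pk) vk m m'"
    unfolding accept_left_def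
    by (intro sum.cong meas_forge_alg) (use len lpk in \<open>auto simp: verdict_def\<close>)
qed

lemma piracy_swap: "piracy DS Obf (swap_alg split A) (swap_pos split A) C B"
  by unfold_locales (rule Obf qpt_swap_alg[OF A] B C)+

text \<open>Rotating the output of \<open>A\<close> only permutes the indices of its superoperator,
  so the pirate state has its registers exchanged.\<close>

lemma forged_swap:
  assumes "length m = \<mu> l" "length m' = \<mu> l" "length s = sgl l" "length s' = sgl l"
  shows "piracy.forged DS Obf (swap_alg split A) (swap_pos split A) C B l G vk m' m s' s = forged l G vk m m' s s'"
proof -
  interpret sw: piracy DS Obf "swap_alg split A" "swap_pos split A" C B by (rule piracy_swap)
  have lr: "sw.left l G = right l G" "sw.right l G = left l G"
    using left_right[of l G]
    unfolding sw.left_def sw.right_def sw.width_def left_def right_def width_def by (simp_all add: swap_pos_def)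
  have "sw.pirate_state l G vk (c @ x) (d @ y) = pirate_state l G vk (x @ c) (y @ d)"
    if "length x = left l G" "length y = left l G" "length c = right l G" "length d = right l G" for x y c d
    unfolding sw.pirate_state_def pirate_state_def sw.width_def width_def sop_apply_def
  proof (intro sum.cong refl arg_cong2[where f = times])
    fix w w' :: bits
    let ?k = "obf_qubits Obf l G + vkl l"
    assume "w \<in> words ?k" "w' \<in> words ?k"
    then show "sop_of (swap_alg split A l ?k) w w' (c @ x) (d @ y) = sop_of (A l ?k) w w' (x @ c) (y @ d)"
      using that wf left_right[of l G] unfolding swap_alg_def
      by (subst sop_of_then_rot_circ) (auto simp: left_def right_def width_def rot_append0')
  qed
  then show ?thesis
    unfolding sw.forged_def forged_def lr
    by (intro split_prob_swap) (simp_all add: assms B C)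
qed

text \<open>The left party of the swapped pirate is \<open>C\<close>, challenged on the first
  message. Exchanging the two uniform messages and the symmetry of puncturing turn this into
  acceptance on the right.\<close>

lemma forge_prob_eq2:
  "forge_prob DS (forge_alg Obf (swap_alg split A) (swap_pos split A) C) l =
    measure_pmf.expectation (ds_keys DS l) (\<lambda>(sk, vk).
      measure_pmf.expectation (uniform_pair \<mu> l) (\<lambda>(m, m').
        measure_pmf.expectation (puncture_key DS l sk m m') (\<lambda>pk. accept_right l (sign_star_circ DS l pk) vk m m')))"
proof -
  interpret sw: piracy DS Obf "swap_alg split A" "swap_pos split A" C B by (rule piracy_swap)
  have swap: "sw.accept_left l G vk m' m = accept_right l G vk m m'"
    if "length m = \<mu> l" "length m' = \<mu> l" for G vk m m'
    unfolding sw.accept_left_def accept_right_def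
    by (intro sum.cong forged_swap that) (auto simp: verdict_def sw.verdict_def)
  have "measure_pmf.expectation (uniform_pair \<mu> l) (\<lambda>(m', m).
        measure_pmf.expectation (puncture_key DS l sk m' m) (\<lambda>pk. sw.accept_left l (sign_star_circ DS l pk) vk m' m)) =
      measure_pmf.expectation (uniform_pair \<mu> l) (\<lambda>(m', m).
        measure_pmf.expectation (puncture_key DS l sk m m') (\<lambda>pk. accept_right l (sign_star_circ DS l pk) vk m m'))" for sk vk
    by (rule expectation_cong, unfold split_paired_all prod.case, subst puncture_key_commute)
      (auto simp: swap dest: set_pmf_uniform_pair)
  then show ?thesis
    unfolding sw.forge_prob_eq1
    by (simp only: expectation_uniform_pair_swap[of \<mu> l "\<lambda>m m'. measure_pmf.expectation (puncture_key DS l _ m m') (\<lambda>pk. accept_right l (sign_star_circ DS l pk) _ m m')"])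
qed

text \<open>Converts the bookkeeping of the UPO experiment, a sum over keys with unnormalised
  states, into an expectation over honestly generated pairs.\<close>

lemma sum_keys:
  "(\<Sum>sk\<in>ds_support DS l. \<Sum>vk\<in>words (vkl l). pmf (ds_keys DS l) (sk, vk) * h sk vk) =
    measure_pmf.expectation (ds_keys DS l) (\<lambda>(sk, vk). h sk vk)"
proof -
  have "set_pmf (ds_keys DS l) \<subseteq> ds_support DS l \<times> words (vkl l)"
  proof
    fix p assume p: "p \<in> set_pmf (ds_keys DS l)"
    then have "fst p \<in> ds_support DS l" unfolding ds_support_def by simp
    then show "p \<in> ds_support DS l \<times> words (vkl l)" using ds_keys_lengths[of "fst p" "snd p"] p by (cases p) auto
  qed
  moreover have "finite (ds_support DS l \<times> words (vkl l))"
    unfolding ds_support_def using finite_ds_keys by simp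
  ultimately show ?thesis
    by (simp add: expectation_finite[of "ds_support DS l \<times> words (vkl l)"] sum.cartesian_product split_def)
qed

text \<open>The experiment is won by two acceptances on the true circuit or by two rejections on the
  punctured one, and the challenge bit gives each case weight 1/2.\<close>

lemma upo_prob_eq:
  "upo_prob (sign_class DS) (uniform_pair \<mu>) Obf gen_alg (split_alg split A) (split_pos split) (verify_alg B) (verify_alg C) l =
    1 / 2 * measure_pmf.expectation (ds_keys DS l) (\<lambda>(sk, vk).
      measure_pmf.expectation (uniform_pair \<mu> l) (\<lambda>(m, m'). agree False l (sign_circ DS l sk) vk m m')) +
    1 / 2 * measure_pmf.expectation (ds_keys DS l) (\<lambda>(sk, vk).
      measure_pmf.expectation (uniform_pair \<mu> l) (\<lambda>(m, m').
        measure_pmf.expectation (puncture_key DS l sk m m') (\<lambda>pk. agree True l (sign_star_circ DS l pk) vk m m')))"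
proof -
  let ?E = "measure_pmf.expectation"
  define D where "D = (\<lambda>b sk m m'. if b then kc_punct (sign_class DS) l sk m m' else return_pmf (kc_circ (sign_class DS) l sk))"
  define W where "W = (\<lambda>b. \<Sum>sk\<in>ds_support DS l. ?E (uniform_pair \<mu> l) (\<lambda>(m, m'). ?E (D b sk m m') (\<lambda>G.
      \<Sum>vk\<in>words (vkl l). pmf (ds_keys DS l) (sk, vk) * agree b l G vk m m')))"
  have fD: "finite (set_pmf (D b sk m m'))" for b sk m m'
    unfolding D_def sign_class_def by (simp add: finite_puncture_key)
  \<comment> \<open>The sum over \<open>vk\<close> is pulled out of both expectations, so that
    \<open>sum_keys\<close> can merge it with the sum over \<open>sk\<close>.\<close>
  have W: "W b = ?E (ds_keys DS l) (\<lambda>(sk, vk). ?E (uniform_pair \<mu> l) (\<lambda>(m, m'). ?E (D b sk m m') (\<lambda>G. agree b l G vk m m')))" for b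
    unfolding W_def
    by (simp only: expectation_sum[OF fD] expectation_sum[OF finite_uniform_pair] split_def sum_keys)
  have "upo_prob (sign_class DS) (uniform_pair \<mu>) Obf gen_alg (split_alg split A) (split_pos split) (verify_alg B) (verify_alg C) l =
      ?E (pmf_of_set UNIV) W"
    unfolding upo_prob_def
  proof (rule expectation_cong)
    fix b :: bool
    have keys: "kc_keys (sign_class DS) l = ds_support DS l" unfolding sign_class_def by simp
    show "(\<Sum>k\<in>kc_keys (sign_class DS) l. ?E (uniform_pair \<mu> l) (\<lambda>(xB, xC).
        ?E (if b then kc_punct (sign_class DS) l k xB xC else return_pmf (kc_circ (sign_class DS) l k)) (\<lambda>G.
          let r = q_out (gen_alg l 0) - kc_keylen (sign_class DS) l;
              st = post k (qrun gen_alg l 0 (basis_state [])); q = r + obf_qubits Obf l G;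
              \<sigma> = qrun (split_alg split A) l q (qop_tensor r st (obf_state Obf l G))
          in split_prob (verify_alg B) (verify_alg C) l (split_pos split l q)
              (q_out (split_alg split A l q) - split_pos split l q) xB xC \<sigma> [b] [b]))) = W b"
      unfolding W_def keys
    proof (rule sum.cong[OF refl], rule expectation_cong, unfold split_paired_all prod.case)
      fix sk m m' assume "sk \<in> ds_support DS l" "(m, m') \<in> set_pmf (uniform_pair \<mu> l)"
      then have len: "length sk = skl l" "length m = \<mu> l" "length m' = \<mu> l"
        using length_ds_support set_pmf_uniform_pair by blast+
      show "?E (if b then kc_punct (sign_class DS) l sk m m' else return_pmf (kc_circ (sign_class DS) l sk)) (\<lambda>G.
          let r = q_out (gen_alg l 0) - kc_keylen (sign_class DS) l;
              st = post sk (qrun gen_alg l 0 (basis_state [])); q = r + obf_qubits Obf l G;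
              \<sigma> = qrun (split_alg split A) l q (qop_tensor r st (obf_state Obf l G))
          in split_prob (verify_alg B) (verify_alg C) l (split_pos split l q)
              (q_out (split_alg split A l q) - split_pos split l q) m m' \<sigma> [b] [b]) =
        ?E (D b sk m m') (\<lambda>G. \<Sum>vk\<in>words (vkl l). pmf (ds_keys DS l) (sk, vk) * agree b l G vk m m')"
        unfolding upo_round_eq[OF len] D_def agree_def ..
    qed
  qed
  also have "\<dots> = 1 / 2 * W False + 1 / 2 * W True"
    by (simp add: integral_pmf_of_set UNIV_bool)
  finally show ?thesis
    unfolding W D_def sign_class_def by (simp add: split_def)
qed

lemma piracy_prob_bound:
  "piracy_prob (cp_scheme Obf Eval) A split B C l + (1 - forge_prob DS (forge_alg Obf A split B) l
      - forge_prob DS (forge_alg Obf (swap_alg split A) (swap_pos split A) C) l) \<le>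
    2 * upo_prob (sign_class DS) (uniform_pair \<mu>) Obf gen_alg (split_alg split A) (split_pos split) (verify_alg B) (verify_alg C) l"
proof -
  let ?E = "measure_pmf.expectation"
  note fin = finite_ds_keys finite_uniform_pair finite_puncture_key
  note int = fin[THEN integrable_finite_pmf]
  let ?L = "\<lambda>f. ?E (ds_keys DS l) (\<lambda>(sk, vk). ?E (uniform_pair \<mu> l) (\<lambda>(m, m').
      ?E (puncture_key DS l sk m m') (\<lambda>pk. f vk m m' pk)))"
  have "1 - ?L (\<lambda>vk m m' pk. accept_left l (sign_star_circ DS l pk) vk m m')
      - ?L (\<lambda>vk m m' pk. accept_right l (sign_star_circ DS l pk) vk m m') =
    ?L (\<lambda>vk m m' pk. 1 - accept_left l (sign_star_circ DS l pk) vk m m' - accept_right l (sign_star_circ DS l pk) vk m m')"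
    by (simp add: split_def Bochner_Integration.integral_diff int)
  also have "\<dots> \<le> ?L (\<lambda>vk m m' pk. agree True l (sign_star_circ DS l pk) vk m m')"
  proof (rule expectation_mono[OF fin(1)], unfold split_paired_all prod.case,
      rule expectation_mono[OF fin(2)], unfold split_paired_all prod.case, rule expectation_mono[OF fin(3)])
    fix sk vk m m' pk
    assume "(sk, vk) \<in> set_pmf (ds_keys DS l)" "(m, m') \<in> set_pmf (uniform_pair \<mu> l)"
    then have "length vk = vkl l" "length m = \<mu> l" "length m' = \<mu> l"
      using ds_keys_lengths set_pmf_uniform_pair by blast+
    then show "1 - accept_left l (sign_star_circ DS l pk) vk m m' - accept_right l (sign_star_circ DS l pk) vk m m'
        \<le> agree True l (sign_star_circ DS l pk) vk m m'" by (rule reject_ge)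
  qed
  finally have "1 - forge_prob DS (forge_alg Obf A split B) l - forge_prob DS (forge_alg Obf (swap_alg split A) (swap_pos split A) C) l \<le>
      ?L (\<lambda>vk m m' pk. agree True l (sign_star_circ DS l pk) vk m m')"
    unfolding forge_prob_eq1 forge_prob_eq2 .
  then show ?thesis
    unfolding upo_prob_eq piracy_prob_eq agree_def[of False] by simp
qed

lemma piracy_prob_nonneg: "0 \<le> piracy_prob (cp_scheme Obf Eval) A split B C l"
  unfolding piracy_prob_eq agree_def[symmetric]
proof (rule expectation_nonneg, unfold split_paired_all prod.case, rule expectation_nonneg, unfold split_paired_all prod.case)
  fix sk vk m m' assume "(sk, vk) \<in> set_pmf (ds_keys DS l)"
  then show "0 \<le> agree False l (sign_circ DS l sk) vk m m'" by (intro agree_nonneg ds_keys_lengths)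
qed

lemma negligible_piracy_prob:
  assumes ps: "puncturable_secure DS" and upo: "upo_secure (sign_class DS) (uniform_pair \<mu>) Obf"
  shows "negligible (piracy_prob (cp_scheme Obf Eval) A split B C)"
proof -
  have "\<forall>l. kc_keylen (sign_class DS) l \<le> q_out (gen_alg l 0)"
    by (simp add: sign_class_def q_out_gen_alg)
  with upo[unfolded upo_secure_def, rule_format, of gen_alg "split_alg split A" "split_pos split" "verify_alg B" "verify_alg C"]
    qpt_gen_alg qpt_split_alg[OF A] qpt_verify_alg[OF B(1)] qpt_verify_alg[OF C(1)]
  obtain \<epsilon> where \<epsilon>: "negligible \<epsilon>" "\<And>l. upo_prob (sign_class DS) (uniform_pair \<mu>) Obf gen_alg
      (split_alg split A) (split_pos split) (verify_alg B) (verify_alg C) l \<le> 1 / 2 + \<epsilon> l"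
    by metis
  have f1: "negligible (forge_prob DS (forge_alg Obf A split B))"
    by (rule ps[unfolded puncturable_secure_def, rule_format]) (simp add: qpt_forge_alg[OF Obf A B])
  have f2: "negligible (forge_prob DS (forge_alg Obf (swap_alg split A) (swap_pos split A) C))"
    by (rule ps[unfolded puncturable_secure_def, rule_format]) (simp add: qpt_forge_alg[OF Obf qpt_swap_alg[OF A] C])
  \<comment> \<open>\<open>\<epsilon>\<close> may be negative and \<open>negligible_mono\<close>
    asks for a bound on a modulus, hence the absolute values. \<open>\<epsilon>\<close> occurs twice
    because the experiment averages over the challenge bit.\<close>
  let ?g = "\<lambda>l. (\<bar>\<epsilon> l\<bar> + \<bar>\<epsilon> l\<bar>) + (\<bar>forge_prob DS (forge_alg Obf A split B) l\<bar> + \<bar>forge_prob DS (forge_alg Obf (swap_alg split A) (swap_pos split A) C) l\<bar>)"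
  have "negligible ?g" by (intro negligible_add negligible_abs \<epsilon>(1) f1 f2)
  moreover have "\<bar>piracy_prob (cp_scheme Obf Eval) A split B C l\<bar> \<le> ?g l" for l
    using piracy_prob_bound[where l = l and Eval = Eval] \<epsilon>(2)[of l] piracy_prob_nonneg[where l = l and Eval = Eval] by linarith
  ultimately show ?thesis by (rule negligible_mono)
qed

end

section \<open>Anti-piracy and correctness of the scheme\<close>

context signature_scheme
begin

lemma cp_anti_piracy_cp_scheme:
  assumes "puncturable_secure DS" "upo_secure (sign_class DS) (uniform_pair \<mu>) Obf" "qpt Obf"
  shows "cp_anti_piracy (cp_scheme Obf Eval)"
  unfolding cp_anti_piracy_def
proof (intro allI impI)
  fix A split B C
  assume *: "qpt_bipartite A split \<and> qpt B \<and> (\<forall>l k. q_out (B l k) = cp_siglen (cp_scheme Obf Eval) l) \<and>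
      qpt C \<and> (\<forall>l k. q_out (C l k) = cp_siglen (cp_scheme Obf Eval) l)"
  interpret piracy DS Obf A split B C
    by unfold_locales (use * assms(3) in auto)
  show "negligible (piracy_prob (cp_scheme Obf Eval) A split B C)"
    by (rule negligible_piracy_prob[OF assms(1,2)])
qed

lemma output_prob_nonneg:
  assumes "psd q \<rho>" "length x = n" "p \<le> q_out (E l (q + n))" "length y = p"
  shows "0 \<le> output_prob E l q \<rho> x p y"
  unfolding output_prob_def meas_first_def meas_def qrun_def assms(2)
proof (rule sum_nonneg)
  fix w assume "w \<in> words (q_out (E l (q + n)) - p)"
  then have "length (y @ w) = q_out (E l (q + n))" using assms by simp
  then show "0 \<le> Re (sop_apply (q + n) (sop_of (E l (q + n))) (qop_tensor q \<rho> (basis_state x)) (y @ w) (y @ w))"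
    by (rule psd_diag[OF psd_sop_of[OF psd_qop_tensor[OF assms(1,2)]]])
qed

text \<open>If the honest signature verifies, its own term already contributes at least
  \<open>1 - \<delta> l\<close>; otherwise the sum is still nonnegative. On average the scheme loses
  \<open>\<delta>\<close> on top of the error of the signature scheme.\<close>

lemma cp_correct_cp_scheme:
  assumes ds: "ds_correct DS" and upo: "upo_correct (sign_class DS) Obf Eval" and O: "qpt Obf"
    and E: "\<And>l k. sgl l \<le> q_out (Eval l k)"
  shows "cp_correct (cp_scheme Obf Eval)"
proof -
  let ?E = "measure_pmf.expectation"
  from ds obtain \<epsilon> where \<epsilon>: "negligible \<epsilon>" "\<And>l m. length m = \<mu> l \<Longrightarrow>
      measure_pmf.prob (ds_keys DS l) {(sk, vk). accepts (ds_verify DS) l vk m (beval (sgl l) (sign_circ DS l sk) m)} \<ge> 1 - \<epsilon> l"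
    unfolding ds_correct_def by auto
  from upo obtain \<delta> where \<delta>: "negligible \<delta>" "\<And>l sk x. sk \<in> ds_support DS l \<Longrightarrow> length x = \<mu> l \<Longrightarrow>
      output_prob Eval l (obf_qubits Obf l (sign_circ DS l sk)) (obf_state Obf l (sign_circ DS l sk)) x (sgl l)
        (beval (sgl l) (sign_circ DS l sk) x) \<ge> 1 - \<delta> l"
    unfolding upo_correct_def sign_class_def Let_def by auto
  have "1 - (\<bar>\<epsilon> l\<bar> + \<bar>\<delta> l\<bar>) \<le> ?E (ds_keys DS l) (\<lambda>(sk, vk). \<Sum>\<sigma>\<in>{\<sigma> \<in> words (sgl l). accepts (ds_verify DS) l vk m \<sigma>}.
      output_prob Eval l (cp_key_qubits (cp_scheme Obf Eval) l) (cp_key_state (cp_scheme Obf Eval) l sk) m (sgl l) \<sigma>)"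
    (is "_ \<le> ?R") if m: "length m = \<mu> l" for l m
  proof -
    define acc where "acc = {(sk, vk). accepts (ds_verify DS) l vk m (beval (sgl l) (sign_circ DS l sk) m)}"
    have "1 - (\<bar>\<epsilon> l\<bar> + \<bar>\<delta> l\<bar>) \<le> measure_pmf.prob (ds_keys DS l) acc - \<bar>\<delta> l\<bar>"
      using \<epsilon>(2)[OF m] unfolding acc_def by linarith
    also have "\<dots> = ?E (ds_keys DS l) (\<lambda>p. indicator acc p - \<bar>\<delta> l\<bar>)"
      by (subst Bochner_Integration.integral_diff) (auto intro: integrable_finite_pmf finite_ds_keys)
    also have "\<dots> \<le> ?R"
    proof (rule expectation_mono[OF finite_ds_keys], unfold split_paired_all prod.case)
      fix sk vk assume keys: "(sk, vk) \<in> set_pmf (ds_keys DS l)"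
      have sk: "length sk = skl l" by (rule ds_keys_lengths[OF keys])
      have supp: "sk \<in> ds_support DS l" unfolding ds_support_def using keys by force
      let ?G = "sign_circ DS l sk" and ?s = "beval (sgl l) (sign_circ DS l sk) m"
      have nn: "0 \<le> output_prob Eval l (obf_qubits Obf l ?G) (obf_state Obf l ?G) m (sgl l) \<sigma>" if "length \<sigma> = sgl l" for \<sigma>
        by (rule output_prob_nonneg[OF psd_obf_state refl]) (use E that in auto)
      have ls: "length ?s = sgl l"
        unfolding sign_circ_def beval_hardwire by (rule length_beval[OF sign_wf]) (use m sk in simp)
      show "indicator acc (sk, vk) - \<bar>\<delta> l\<bar> \<le> (\<Sum>\<sigma>\<in>{\<sigma> \<in> words (sgl l). accepts (ds_verify DS) l vk m \<sigma>}.
          output_prob Eval l (cp_key_qubits (cp_scheme Obf Eval) l) (cp_key_state (cp_scheme Obf Eval) l sk) m (sgl l) \<sigma>)"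
        unfolding cp_key_qubits_eq[OF sk] cp_key_state_eq[OF O sk]
      proof (cases "(sk, vk) \<in> acc")
        case True
        then have mem: "?s \<in> {\<sigma> \<in> words (sgl l). accepts (ds_verify DS) l vk m \<sigma>}"
          using ls unfolding acc_def by simp
        have "indicator acc (sk, vk) - \<bar>\<delta> l\<bar> \<le> output_prob Eval l (obf_qubits Obf l ?G) (obf_state Obf l ?G) m (sgl l) ?s"
          using \<delta>(2)[OF supp m] True by simp
        also have "\<dots> \<le> (\<Sum>\<sigma>\<in>{\<sigma> \<in> words (sgl l). accepts (ds_verify DS) l vk m \<sigma>}.
            output_prob Eval l (obf_qubits Obf l ?G) (obf_state Obf l ?G) m (sgl l) \<sigma>)"
          by (rule member_le_sum[OF mem]) (use nn in \<open>auto intro: finite_subset[of _ "words (sgl l)"]\<close>)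
        finally show "indicator acc (sk, vk) - \<bar>\<delta> l\<bar> \<le> (\<Sum>\<sigma>\<in>{\<sigma> \<in> words (sgl l). accepts (ds_verify DS) l vk m \<sigma>}.
            output_prob Eval l (obf_qubits Obf l ?G) (obf_state Obf l ?G) m (sgl l) \<sigma>)" .
      next
        case False
        have "0 \<le> (\<Sum>\<sigma>\<in>{\<sigma> \<in> words (sgl l). accepts (ds_verify DS) l vk m \<sigma>}.
            output_prob Eval l (obf_qubits Obf l ?G) (obf_state Obf l ?G) m (sgl l) \<sigma>)"
          by (intro sum_nonneg nn) simp
        then show "indicator acc (sk, vk) - \<bar>\<delta> l\<bar> \<le> (\<Sum>\<sigma>\<in>{\<sigma> \<in> words (sgl l). accepts (ds_verify DS) l vk m \<sigma>}.
            output_prob Eval l (obf_qubits Obf l ?G) (obf_state Obf l ?G) m (sgl l) \<sigma>)"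
          using False by simp
      qed
    qed
    finally show ?thesis .
  qed
  moreover have "negligible (\<lambda>l. \<bar>\<epsilon> l\<bar> + \<bar>\<delta> l\<bar>)" by (intro negligible_add negligible_abs \<epsilon>(1) \<delta>(1))
  ultimately show ?thesis unfolding cp_correct_def cp_scheme_simps by auto
qed

end

theorem theorem68:
  fixes DS :: pds and Obf Eval :: qalg
  assumes "puncturable_ds DS"
    and "upo_scheme (sign_class DS) (uniform_pair (ds_msglen DS)) Obf Eval"
  shows "\<exists>CP :: cpds.
    copy_protection CP \<and>
    cp_msglen CP = ds_msglen DS \<and> cp_siglen CP = ds_siglen DS \<and>
    cp_sklen CP = ds_sklen DS \<and> cp_vklen CP = ds_vklen DS \<and>
    cp_gen CP = ds_gen DS \<and>
    cp_verify CP = ds_verify DS \<and>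
    (\<forall>l. \<forall>sk \<in> words (ds_sklen DS l).
       cp_key_qubits CP l = obf_qubits Obf l (sign_circ DS l sk) \<and>
       cp_key_state CP l sk = obf_state Obf l (sign_circ DS l sk)) \<and>
    cp_sign CP = Eval"
proof -
  interpret signature_scheme DS
    by unfold_locales (use assms(1) in \<open>simp add: puncturable_ds_def\<close>)
  have ds: "ds_correct DS" "puncturable_secure DS"
    using assms(1) unfolding puncturable_ds_def by auto
  have upo: "qpt Obf" "qpt Eval" "\<And>l k. ds_siglen DS l \<le> q_out (Eval l k)"
    "upo_correct (sign_class DS) Obf Eval" "upo_secure (sign_class DS) (uniform_pair (ds_msglen DS)) Obf"
    using assms(2) unfolding upo_scheme_def by (auto simp: sign_class_def)
  have "copy_protection (cp_scheme Obf Eval)"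
    unfolding copy_protection_def
    using cp_efficient_cp_scheme[OF upo(1-3)] cp_correct_cp_scheme[OF ds(1) upo(4,1,3)]
      cp_anti_piracy_cp_scheme[OF ds(2) upo(5,1)] by simp
  then show ?thesis
    by (intro exI[of _ "cp_scheme Obf Eval"]) (simp add: cp_key_qubits_eq cp_key_state_eq upo(1))
qed

end
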